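(* Let $\frac12\le s<1$, $\Lambda\in\mathbb{N}$, and let $X^0=(X^0)^{\rm ord}\in\mathcal{R}^\Lambda$. For every $\varepsilon>0$ let $X_\varepsilon=X_\varepsilon(t)$ be the unique solution to the Cauchy problem $$\dot X(t)=-\nabla\mathcal{E}^s_\varepsilon(X(t)),\qquad X(0)=X^0 .$$ Then, $X_\varepsilon$ converges uniformly in $[0,+\infty)$ (as $\varepsilon\to0$), with respect to the distance $\mathrm{dist}(\cdot,\cdot)$, to the global solution $X_0$ of the Cauchy problem $$\dot X=-\mathcal{F}^s(X),\qquad X(0)=X^0 .$$
   Context: Let $\mathcal{X}^\Lambda:=[0,\Lambda)^\Lambda$; entries of $X=(x_1,\dots,x_\Lambda)\in\mathcal{X}^\Lambda$ need not be distinct. Let $\mathcal{R}^\Lambda$ be the set of $X\in\mathcal{X}^\Lambda$ with pairwise distinct entries. For $X\in\mathcal{X}^\Lambda$, $X^{\rm ord}=(x_1^{\rm ord},\dots,x_\Lambda^{\rm ord})$ is the non-decreasing reordering of the entries of $X$. Let $|t|_{\rm per}:=\min_{z\in\mathbb{Z}}|t+\Lambda z|$ and, for $X,Y\in\mathcal{X}^\Lambda$, $$\mathrm{dist}(X,Y):=\Big(\sum_{\lambda=1}^\Lambda|x^{\rm ord}_\lambda-y^{\rm ord}_\lambda|_{\rm per}^2\Big)^{1/2}.$$ Let $\mu^X:=\sum_{\lambda=1}^{\Lambda}\sum_{k\in\mathbb{Z}}\delta_{x_\lambda+\Lambda k}$, and let $u^X\in BV_{\rm loc}(\mathbb{R})$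 be the function, unique up to additive constants and $\Lambda$-periodic, whose distributional derivative is $(u^X)'=\mathrm{d}x-\mu^X$. Let $\rho$ be a fixed standard mollifier supported in $(-1,1)$ (smooth, nonnegative, even, with integral $1$), $\rho_\varepsilon(x):=\frac1\varepsilon\rho(\frac x\varepsilon)$, and $u^X_\varepsilon:=\rho_\varepsilon*u^X$. For $\varepsilon>0$, $$\mathcal{E}^s_\varepsilon(X):=\frac12\int_0^\Lambda \mathrm{d}x\int_{\mathbb{R}}\frac{|u^X_\varepsilon(x)-u^X_\varepsilon(y)|^2}{|x-y|^{1+2s}}\,\mathrm{d}y .$$ Let $\bar u^X(x)$ be the average of the left and right traces of $u^X$ at $x$, and $$(-\Delta)^su^X(x):=2\,\mathrm{p.v.}\int_{\mathbb{R}}\frac{\bar u^X(x)-u^X(y)}{|x-y|^{1+2s}}\,\mathrm{d}y .$$ The map $\mathcal{F}^s:\mathcal{X}^\Lambda\to\mathbb{R}^\Lambda$ is defined by $\mathcal{F}^s_\lambda(X):=(-\Delta)^su^X(x_\lambda)$, $\lambda=1,\dots,\Lambda$. The gradient is taken with respect to $(x_1,\dots,x_\Lambda)$, positions being read modulo $\Lambda$, and the differential equations are understood for the $\Lambda$-periodic extension of the configuration: each particle of the periodic configuration moves continuously on $\mathbb{R}$. The problem for $\mathcal{E}^s_\varepsilon$ has a unique $C^1$ solution on $[0,+\infty)$ for every initial datum in $\mathcal{X}^\Lambda$; existence of a global solution of the problem for $\mathcal{F}^s$ is part of the claim. *)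

theory Defs
  imports "HOL-Analysis.Analysis"
begin

(* Particle labels are the elements of a finite linearly ordered type 'n, and the number of
   particles, which is also the period Lambda, is CARD('n).  A configuration is a vector in
   real^'n of positions on the line; everything below is defined for arbitrary real positions,
   since a particle moving continuously on the line may leave [0, Lambda). *)

definition config_space :: "(real ^ 'n::finite) set" where
  "config_space = {X. \<forall>i. X $ i \<in> {0..<real CARD('n)}}"

definition regular_configs :: "(real ^ 'n::finite) set" where
  "regular_configs = {X \<in> config_space. inj (\<lambda>i. X $ i)}"

text \<open>The label \<open>i\<close> has \<open>card {..<i}\<close> predecessors, so the \<open>i\<close>-th entry of the reordering is the
  entry of the sorted list at that (zero-based) position.\<close>

definition ord_config :: "real ^ ('n::{finite,linorder}) \<Rightarrow> real ^ ('n::{finite,linorder})" where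
  "ord_config X =
     (\<chi> i. sorted_list_of_multiset (image_mset (\<lambda>j. X $ j) (mset_set UNIV)) ! card {..<i})"

definition abs_per :: "real \<Rightarrow> real \<Rightarrow> real" where
  "abs_per L t = (INF z::int. \<bar>t + L * of_int z\<bar>)"

text \<open>Entries are sorted as real positions and not folded back into one period first: the sorted
  index of every particle jumps when one of them crosses the end of the period, so the folded
  version would not be continuous along continuous motions.  On \<open>config_space\<close> both agree.\<close>

definition config_dist :: "real ^ ('n::{finite,linorder}) \<Rightarrow> real ^ ('n::{finite,linorder}) \<Rightarrow> real" where
  "config_dist X Y =
     sqrt (\<Sum>i\<in>UNIV. (abs_per (real CARD('n)) (ord_config X $ i - ord_config Y $ i))\<^sup>2)"


definition smooth :: "(real \<Rightarrow> real) \<Rightarrow> bool" where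
  "smooth f \<longleftrightarrow> (\<forall>n. (deriv ^^ n) f differentiable_on UNIV)"

definition test_function :: "(real \<Rightarrow> real) \<Rightarrow> bool" where
  "test_function \<phi> \<longleftrightarrow> smooth \<phi> \<and> (\<exists>R. \<forall>x. \<bar>x\<bar> > R \<longrightarrow> \<phi> x = 0)"

text \<open>Sum of the Dirac masses at \<open>X $ i + CARD('n) * k\<close> over all labels \<open>i\<close> and integers \<open>k\<close>, as
  the push-forward of counting measure, so that coinciding particles are counted with
  multiplicity.\<close>

definition config_measure :: "real ^ 'n::finite \<Rightarrow> real measure" where
  "config_measure X =
     distr (count_space (UNIV :: ('n \<times> int) set)) borel
       (\<lambda>(i, k). X $ i + real CARD('n) * of_int k)"

text \<open>\<open>u\<close> is locally integrable and its distributional derivative is Lebesgue measure minus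
  \<open>config_measure X\<close>.  As this is a locally finite signed measure, \<open>u\<close> is locally of bounded
  variation.\<close>

definition is_potential :: "real ^ 'n::finite \<Rightarrow> (real \<Rightarrow> real) \<Rightarrow> bool" where
  "is_potential X u \<longleftrightarrow>
     (\<forall>a b. set_integrable lborel {a..b} u) \<and>
     (\<forall>\<phi>. test_function \<phi> \<longrightarrow>
        (LINT x|lborel. u x * deriv \<phi> x) =
          - ((LINT x|lborel. \<phi> x) - (LINT x|config_measure X. \<phi> x)))"

text \<open>A choice of representative: \<open>u\<close> is determined up to additive constants and null sets, and
  the notions below are invariant under both.\<close>

definition potential :: "real ^ 'n::finite \<Rightarrow> real \<Rightarrow> real" where
  "potential X = (SOME u. is_potential X u)"


definition standard_mollifier :: "(real \<Rightarrow> real) \<Rightarrow> bool" where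
  "standard_mollifier \<rho> \<longleftrightarrow>
     smooth \<rho> \<and> (\<forall>x. 0 \<le> \<rho> x) \<and> (\<forall>x. \<rho> (- x) = \<rho> x) \<and>
     (\<forall>x. x \<notin> {-1<..<1} \<longrightarrow> \<rho> x = 0) \<and> (LINT x|lborel. \<rho> x) = 1"

definition scaled_mollifier :: "(real \<Rightarrow> real) \<Rightarrow> real \<Rightarrow> real \<Rightarrow> real" where
  "scaled_mollifier \<rho> \<epsilon> x = (1 / \<epsilon>) * \<rho> (x / \<epsilon>)"

definition convolve :: "(real \<Rightarrow> real) \<Rightarrow> (real \<Rightarrow> real) \<Rightarrow> real \<Rightarrow> real" where
  "convolve f g x = (LINT y|lborel. f (x - y) * g y)"

definition mollified_energy ::
    "(real \<Rightarrow> real) \<Rightarrow> real \<Rightarrow> real \<Rightarrow> real ^ 'n::finite \<Rightarrow> real" where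
  "mollified_energy \<rho> s \<epsilon> X =
     (let v = convolve (scaled_mollifier \<rho> \<epsilon>) (potential X) in
      1 / 2 * (LINT x:{0..real CARD('n)}|lborel.
        (LINT y|lborel. \<bar>v x - v y\<bar>\<^sup>2 / \<bar>x - y\<bar> powr (1 + 2 * s))))"


text \<open>One-sided traces of a function of locally bounded variation, in the sense that the mean
  oscillation around the trace vanishes; this does not depend on the representative.\<close>

definition right_trace :: "(real \<Rightarrow> real) \<Rightarrow> real \<Rightarrow> real" where
  "right_trace u x =
     (THE l. ((\<lambda>r. (1 / r) * (LINT y:{x..x + r}|lborel. \<bar>u y - l\<bar>)) \<longlongrightarrow> 0) (at_right 0))"

definition left_trace :: "(real \<Rightarrow> real) \<Rightarrow> real \<Rightarrow> real" where
  "left_trace u x =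
     (THE l. ((\<lambda>r. (1 / r) * (LINT y:{x - r..x}|lborel. \<bar>u y - l\<bar>)) \<longlongrightarrow> 0) (at_right 0))"

definition trace_average :: "(real \<Rightarrow> real) \<Rightarrow> real \<Rightarrow> real" where
  "trace_average u x = (left_trace u x + right_trace u x) / 2"

definition fractional_laplacian :: "real \<Rightarrow> (real \<Rightarrow> real) \<Rightarrow> real \<Rightarrow> real" where
  "fractional_laplacian s u x =
     2 * Lim (at_right 0) (\<lambda>r. LINT y:{y. \<bar>x - y\<bar> > r}|lborel.
           (trace_average u x - u y) / \<bar>x - y\<bar> powr (1 + 2 * s))"

definition force :: "real \<Rightarrow> real ^ 'n::finite \<Rightarrow> real ^ 'n" where
  "force s X = (\<chi> i. fractional_laplacian s (potential X) (X $ i))"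


definition gradient :: "('a::real_inner \<Rightarrow> real) \<Rightarrow> 'a \<Rightarrow> 'a" where
  "gradient f x = (THE g. GDERIV f x :> g)"

definition solves_cauchy ::
    "('a::real_normed_vector \<Rightarrow> 'a) \<Rightarrow> 'a \<Rightarrow> (real \<Rightarrow> 'a) \<Rightarrow> bool" where
  "solves_cauchy V x\<^sub>0 x \<longleftrightarrow>
     x 0 = x\<^sub>0 \<and>
     (\<forall>t\<ge>0. (x has_vector_derivative V (x t)) (at t within {0..})) \<and>
     continuous_on {0..} (\<lambda>t. V (x t))"

end

(* A configuration has potential sum_i S(x - x_i) + c with a sawtooth S, so the force on particle i
   is the sum of pair interactions h(x_i - x_j), where h is the fractional Laplacian of S: odd,
   periodic and strongly increasing on one period, i.e. repulsive.  The gradient of the mollified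
   energy has the same form with h averaged over the law of the difference of two mollified points,
   a law living on [-2 epsilon, 2 epsilon]; as long as all gaps exceed 2 epsilon, only the regular
   part of h is seen.  Two facts then settle everything.  The smallest gap never decreases, for the
   limit flow as well as for the mollified ones, so all flows stay in a fixed set of well separated
   configurations on which the averaged interactions converge uniformly to h.  On that set strong
   monotonicity and conservation of the centre of mass make the flows exponentially contracting,
   which turns the uniform closeness of the vector fields into a bound that is uniform in time.
   The limit flow itself is obtained as the limit of the mollified flows. *)

theory Submission
  imports Defs "HOL-Probability.Probability_Measure"
begin

section \<open>Repulsive particle systems\<close>

text \<open>What links the energy to the force is that the autocorrelation A of the sawtooth S is a
  primitive of S. Expanding the squared increments of the potential over pairs of particles and
  integrating over one period first turns the energy of a pair at distance t into the integral of
  the second differences of A at t against the kernel |z|^(-1-2s). Its derivative in t has S in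
  place of A, and that is h(t). Since S is affine between its jumps, its second difference vanishes
  for small z, so neither h nor the difference quotients of the pair energy see the singularity of
  the kernel. The self-energy of a particle is different: unmollified it is infinite for s >= 1/2;
  mollified it is a finite constant, independent of the configuration, and is never differentiated.
  The mollified field is known in pair form only while all gaps exceed 2 \<epsilon>. Hence the gap
  estimate is a minimum principle with a threshold. The modulus of monotonicity is CARD('n) powr
  (-1-2s) for every \<epsilon>, since averaging preserves it.\<close>

text \<open>Tilting by \<eta> * r makes the argument strict. At the first time r at which some
  tilted g j has come down to \<delta> - \<eta>, that g j is minimal and still above \<theta>, so
  its tilted derivative is at least \<eta>; but the level is reached from above, so the same
  derivative is at most 0.\<close>

lemma minimum_principle:
  fixes g g' :: "'k \<Rightarrow> real \<Rightarrow> real"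
  assumes fin: "finite K"
    and der: "\<And>k t. k \<in> K \<Longrightarrow> t \<ge> 0 \<Longrightarrow> (g k has_real_derivative g' k t) (at t within {0..})"
    and ge: "\<And>k t. k \<in> K \<Longrightarrow> t \<ge> 0 \<Longrightarrow> \<theta> < g k t \<Longrightarrow> (\<And>j. j \<in> K \<Longrightarrow> g k t \<le> g j t) \<Longrightarrow> 0 \<le> g' k t"
    and init: "\<And>k. k \<in> K \<Longrightarrow> \<delta> \<le> g k 0" and "\<theta> < \<delta>"
    and k: "k \<in> K" and t: "0 \<le> t"
  shows "\<delta> \<le> g k t"
proof (rule ccontr)
  assume "\<not> \<delta> \<le> g k t"
  \<comment> \<open>The first argument of \<open>min\<close> yields \<open>\<eta>1\<close>, by which
    g k has crossed the barrier at time t; the second yields \<open>\<eta>2\<close>, which keeps the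
    barrier above \<theta>.\<close>
  define \<eta> where "\<eta> = min (\<delta> - g k t) (\<delta> - \<theta>) / (2 * (1 + t))"
  have \<eta>: "\<eta> > 0" using \<open>\<not> \<delta> \<le> g k t\<close> \<open>\<theta> < \<delta>\<close> t by (simp add: \<eta>_def)
  have "\<eta> * (1 + t) = min (\<delta> - g k t) (\<delta> - \<theta>) / 2" using t by (simp add: \<eta>_def field_simps)
  then have \<eta>1: "\<eta> * (1 + t) < \<delta> - g k t" and \<eta>2: "\<eta> * (1 + t) < \<delta> - \<theta>"
    using \<open>\<not> \<delta> \<le> g k t\<close> \<open>\<theta> < \<delta>\<close> by (auto simp: min_def split: if_splits)
  define S where "S j = {r \<in> {0..t}. g j r + \<eta> * r \<le> \<delta> - \<eta>}" for j
  have cont: "continuous_on {0..t} (\<lambda>r. g j r + \<eta> * r)" if "j \<in> K" for j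
  proof -
    have "continuous_on {0..} (g j)"
      using der[OF that] by (auto intro!: DERIV_continuous simp: continuous_on_eq_continuous_within)
    then have "continuous_on {0..t} (g j)" by (rule continuous_on_subset) auto
    then show ?thesis by (intro continuous_intros)
  qed
  have "closed (S j)" if "j \<in> K" for j
    unfolding S_def using cont[OF that]
    by (rule continuous_on_closed_Collect_le[OF _ continuous_on_const closed_atLeastAtMost])
  then have "closed (\<Union>j\<in>K. S j)" using fin by auto
  moreover have "(\<Union>j\<in>K. S j) \<subseteq> {0..t}" by (auto simp: S_def)
  ultimately have comp: "compact (\<Union>j\<in>K. S j)"
    by (meson bounded_subset compact_Icc compact_eq_bounded_closed)
  have "t \<in> S k" using \<eta>1 t by (auto simp: S_def algebra_simps)
  then have "(\<Union>j\<in>K. S j) \<noteq> {}" using k by auto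
  from compact_attains_inf[OF comp this] obtain r
    where r: "r \<in> (\<Union>j\<in>K. S j)" and rmin: "\<And>q. q \<in> (\<Union>j\<in>K. S j) \<Longrightarrow> r \<le> q" by blast
  from r obtain j where j: "j \<in> K" and rj: "0 \<le> r" "r \<le> t" "g j r + \<eta> * r \<le> \<delta> - \<eta>"
    by (auto simp: S_def)
  have "r \<noteq> 0" using init[OF j] rj \<eta> by auto
  then have r0: "r > 0" using rj by simp
  have before: "\<delta> - \<eta> < g i q + \<eta> * q" if "i \<in> K" "0 \<le> q" "q < r" for i q
    using rmin[of q] that rj by (force simp: S_def)
  have at: "\<delta> - \<eta> \<le> g i r + \<eta> * r" if i: "i \<in> K" for i
  proof -
    have "continuous_on {0..r} (\<lambda>q. g i q + \<eta> * q)"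
      using cont[OF i] by (rule continuous_on_subset) (use rj in auto)
    then have "((\<lambda>q. g i q + \<eta> * q) \<longlongrightarrow> g i r + \<eta> * r) (at r within {0..r})"
      using r0 by (auto simp: continuous_on)
    moreover have "eventually (\<lambda>q. \<delta> - \<eta> \<le> g i q + \<eta> * q) (at r within {0..r})"
      unfolding eventually_at_filter
      by (rule always_eventually) (use before[OF i] in \<open>auto simp: less_eq_real_def\<close>)
    moreover have "at r within {0..r} \<noteq> bot"
      using r0 by (simp add: trivial_limit_within islimpt_Icc)
    ultimately show ?thesis by (rule tendsto_lowerbound)
  qed
  have eq: "g j r + \<eta> * r = \<delta> - \<eta>" using at[OF j] rj by simp
  have "\<eta> * (1 + r) \<le> \<eta> * (1 + t)" using \<eta> rj by simp
  then have "\<theta> < g j r" using eq \<eta>2 by (simp add: algebra_simps)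
  moreover have "g j r \<le> g i r" if "i \<in> K" for i using at[OF that] eq by simp
  ultimately have "0 \<le> g' j r" using ge[OF j rj(1)] by blast
  moreover have "g' j r + \<eta> \<le> 0"
  proof -
    have "((\<lambda>q. g j q + \<eta> * q) has_real_derivative g' j r + \<eta>) (at r within {0..})"
      by (rule derivative_eq_intros der[OF j rj(1)] refl | simp)+
    then have "((\<lambda>q. g j q + \<eta> * q) has_real_derivative g' j r + \<eta>) (at r within {0..<r})"
      by (rule DERIV_subset) auto
    then have lim: "((\<lambda>q. ((g j q + \<eta> * q) - (g j r + \<eta> * r)) / (q - r)) \<longlongrightarrow> g' j r + \<eta>) (at r within {0..<r})"
      by (simp add: has_field_derivative_iff)
    have ev: "eventually (\<lambda>q. ((g j q + \<eta> * q) - (g j r + \<eta> * r)) / (q - r) \<le> 0) (at r within {0..<r})"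
      unfolding eventually_at_filter eq
    proof (intro always_eventually allI impI)
      fix q assume "q \<noteq> r" "q \<in> {0..<r}"
      then show "((g j q + \<eta> * q) - (\<delta> - \<eta>)) / (q - r) \<le> 0"
        using before[OF j, of q] by (intro divide_nonneg_nonpos) auto
    qed
    have "at r within {0..<r} \<noteq> bot"
      using r0 by (simp add: trivial_limit_within islimpt_Ico)
    then show ?thesis using tendsto_upperbound lim ev by blast
  qed
  ultimately show False using \<eta> by simp
qed

section \<open>The periodic configuration, counted along the line\<close>

definition label :: "nat \<Rightarrow> 'n::{finite,linorder}" where
  "label k = sorted_list_of_set UNIV ! k"

text \<open>The \<open>k\<close>-th particle, counted along the line, of the periodic configuration.\<close>

definition lift_config :: "real ^ 'n::{finite,linorder} \<Rightarrow> int \<Rightarrow> real" where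
  "lift_config X k = X $ label (nat (k mod int CARD('n))) + real CARD('n) * of_int (k div int CARD('n))"

text \<open>The index runs over all integers, so the gap from the last label to the periodic copy of
  the first one is included. For d > 0 the positions also increase strictly with the label.\<close>

definition separated :: "real \<Rightarrow> real ^ 'n::{finite,linorder} \<Rightarrow> bool" where
  "separated d X \<longleftrightarrow> (\<forall>k. d \<le> lift_config X (k + 1) - lift_config X k)"

text \<open>The term j = i is kept: it is f 0, which vanishes for odd f, and with it the sum runs
  over a full period of particles.\<close>

definition drift :: "(real \<Rightarrow> real) \<Rightarrow> real ^ 'n::finite \<Rightarrow> real ^ 'n" where
  "drift f X = (\<chi> i. - (\<Sum>j\<in>UNIV. f (X $ i - X $ j)))"

lemma bij_betw_label: "bij_betw label {..<CARD('n)} (UNIV :: 'n::{finite,linorder} set)"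
  unfolding label_def by (rule bij_betw_nth) auto

lemma label_strict_mono: "i < j \<Longrightarrow> j < CARD('n) \<Longrightarrow> label i < (label j :: 'n::{finite,linorder})"
  unfolding label_def
  by (rule sorted_wrt_nth_less[OF strict_sorted_list_of_set]) auto

lemma label_surj: obtains k where "k < CARD('n)" "label k = (i :: 'n::{finite,linorder})"
  using bij_betw_label[where 'n='n] unfolding bij_betw_def by (metis UNIV_I imageE lessThan_iff)

lemma lift_config_add_card:
  fixes X :: "real ^ 'n::{finite,linorder}"
  shows "lift_config X (k + int CARD('n)) = lift_config X k + real CARD('n)"
  by (simp add: lift_config_def algebra_simps)

lemma lift_config_of_nat:
  fixes X :: "real ^ 'n::{finite,linorder}"
  shows "k < CARD('n) \<Longrightarrow> lift_config X (int k) = X $ label k"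
  by (simp add: lift_config_def)

lemma periodic_of_int:
  fixes f :: "real \<Rightarrow> real"
  assumes per: "\<And>t. f (t + L) = f t"
  shows "f (t + L * of_int k) = f t"
proof (induction k rule: int_induct[where k=0])
  case base then show ?case by simp
next
  case (step1 i) then show ?case using per[of "t + L * of_int i"] by (simp add: algebra_simps)
next
  case (step2 i) then show ?case using per[of "t + L * of_int (i - 1)"] by (simp add: algebra_simps)
qed

text \<open>Counting down from k through N consecutive particles meets every residue class, hence
  every label, exactly once.\<close>

lemma bij_betw_shifted_residue:
  assumes "0 < N"
  shows "bij_betw (\<lambda>m. nat ((k - int m) mod int N)) {..<N} {..<N}"
proof (rule bij_betw_imageI)
  show inj: "inj_on (\<lambda>m. nat ((k - int m) mod int N)) {..<N}"
  proof (rule inj_onI)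
    fix a b assume ab: "a \<in> {..<N}" "b \<in> {..<N}" "nat ((k - int a) mod int N) = nat ((k - int b) mod int N)"
    then have "(k - int a) mod int N = (k - int b) mod int N"
      using assms by (simp add: eq_nat_nat_iff)
    then have "int N dvd (k - int a) - (k - int b)" by (simp add: mod_eq_dvd_iff)
    then have "int N dvd int b - int a" by simp
    moreover have "\<bar>int b - int a\<bar> < int N" using ab by auto
    ultimately have "int b - int a = 0" by (metis dvd_imp_le_int linorder_not_le abs_of_nat)
    then show "a = b" by simp
  qed
  have "(\<lambda>m. nat ((k - int m) mod int N)) ` {..<N} \<subseteq> {..<N}"
    using assms by (auto simp: nat_less_iff)
  then show "(\<lambda>m. nat ((k - int m) mod int N)) ` {..<N} = {..<N}"
    using inj by (simp add: card_subset_eq card_image)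
qed

text \<open>By periodicity the labels may be replaced by any CARD('n) consecutive particles.
  Counting down from k makes the sums for k and for k + 1 comparable term by term.\<close>

lemma sum_periodic_lift_config:
  fixes X :: "real ^ 'n::{finite,linorder}" and f :: "real \<Rightarrow> real"
  assumes per: "\<And>t. f (t + real CARD('n)) = f t"
  shows "(\<Sum>j\<in>UNIV. f (a - X $ j)) = (\<Sum>m<CARD('n). f (a - lift_config X (k - int m)))"
proof -
  have "bij_betw (label \<circ> (\<lambda>m. nat ((k - int m) mod int CARD('n)))) {..<CARD('n)} (UNIV :: 'n set)"
    by (rule bij_betw_trans[OF bij_betw_shifted_residue bij_betw_label]) simp
  then have "(\<Sum>j\<in>UNIV. f (a - X $ j)) =
      (\<Sum>m<CARD('n). f (a - X $ label (nat ((k - int m) mod int CARD('n)))))"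
    by (subst sum.reindex_bij_betw[symmetric]) (auto simp: o_def)
  also have "\<dots> = (\<Sum>m<CARD('n). f (a - lift_config X (k - int m)))"
  proof (rule sum.cong[OF refl])
    fix m
    show "f (a - X $ label (nat ((k - int m) mod int CARD('n)))) = f (a - lift_config X (k - int m))"
      using periodic_of_int[of f, OF per, of "a - lift_config X (k - int m)" "(k - int m) div int CARD('n)"]
      by (simp add: lift_config_def algebra_simps)
  qed
  finally show ?thesis .
qed

lemma drift_lift_config:
  fixes X :: "real ^ 'n::{finite,linorder}" and f :: "real \<Rightarrow> real"
  assumes per: "\<And>t. f (t + real CARD('n)) = f t"
  shows "drift f X $ label (nat (k mod int CARD('n))) =
    - (\<Sum>m<CARD('n). f (lift_config X k - lift_config X (k - int m)))"
proof -
  let ?a = "X $ label (nat (k mod int CARD('n)))"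
  have "(\<Sum>j\<in>UNIV. f (?a - X $ j)) = (\<Sum>j\<in>UNIV. f (lift_config X k - X $ j))"
    using periodic_of_int[of f, OF per, of "?a - X $ j" "k div int CARD('n)" for j]
    by (simp add: lift_config_def algebra_simps)
  then show ?thesis
    using sum_periodic_lift_config[of f "lift_config X k" X k, OF per] by (simp add: drift_def)
qed

lemma separated_add:
  assumes "separated d X"
  shows "d * real m \<le> lift_config X (k + int m) - lift_config X k"
proof (induction m)
  case (Suc m)
  have "d \<le> lift_config X (k + int m + 1) - lift_config X (k + int m)"
    using assms by (simp add: separated_def)
  then show ?case using Suc by (simp add: algebra_simps)
qed simp

text \<open>The lower bound adds up the m gaps below k. The upper bound adds up the remaining
  CARD('n) - m gaps from k to the periodic copy of k - m.\<close>

lemma separated_bounds: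
  fixes X :: "real ^ 'n::{finite,linorder}"
  assumes "separated d X" "0 \<le> d" "1 \<le> m" "m < CARD('n)"
  shows "lift_config X k - lift_config X (k - int m) \<in> {d..real CARD('n) - d}"
proof -
  have "d * real m \<le> lift_config X k - lift_config X (k - int m)"
    using separated_add[OF assms(1), of m "k - int m"] by simp
  moreover have "d * 1 \<le> d * real m" using assms by (intro mult_left_mono) auto
  moreover have "d * real (CARD('n) - m) \<le> lift_config X (k - int m + int CARD('n)) - lift_config X k"
    using separated_add[OF assms(1), of "CARD('n) - m" k] assms by (simp add: algebra_simps of_nat_diff)
  moreover have "d * 1 \<le> d * real (CARD('n) - m)" using assms by (intro mult_left_mono) auto
  ultimately show ?thesis by (simp add: lift_config_add_card)
qed

lemma separated_pair:
  fixes X :: "real ^ 'n::{finite,linorder}"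
  assumes "separated d X" "0 \<le> d" "i < j"
  shows "X $ j - X $ i \<in> {d..real CARD('n) - d}"
proof -
  obtain a b where a: "a < CARD('n)" "label a = i" and b: "b < CARD('n)" "label b = j"
    by (metis label_surj)
  have "a < b"
  proof (rule ccontr)
    assume "\<not> a < b"
    then have "b = a \<or> label b < (label a :: 'n)" using label_strict_mono[of b a] a by force
    then show False using a b \<open>i < j\<close> by auto
  qed
  then show ?thesis
    using separated_bounds[OF assms(1,2), of "b - a" "int b"] a b
    by (simp add: lift_config_of_nat of_nat_diff)
qed

text \<open>Reduces the gaps to those of one period, the finite index set over which
  \<open>minimum_principle\<close> can be applied.\<close>

lemma separated_iff_finite:
  fixes X :: "real ^ 'n::{finite,linorder}"
  shows "separated d X \<longleftrightarrow> (\<forall>k\<in>{..<CARD('n)}. d \<le> lift_config X (int k + 1) - lift_config X (int k))"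
proof (intro iffI)
  assume *: "\<forall>k\<in>{..<CARD('n)}. d \<le> lift_config X (int k + 1) - lift_config X (int k)"
  show "separated d X"
    unfolding separated_def
  proof
    fix k :: int
    define r q where "r = nat (k mod int CARD('n))" and "q = k div int CARD('n)"
    have shift: "lift_config X (j + int CARD('n) * i) = lift_config X j + real CARD('n) * of_int i" for i j
      by (simp add: lift_config_def algebra_simps)
    have "r < CARD('n)" by (simp add: r_def nat_less_iff)
    moreover have k: "k = int r + int CARD('n) * q" by (simp add: r_def q_def)
    ultimately show "d \<le> lift_config X (k + 1) - lift_config X k"
      using * shift[of "int r" q] shift[of "int r + 1" q] by (simp add: algebra_simps)
  qed
qed (simp add: separated_def)

text \<open>At a smallest gap, each particle to the left of \<open>k\<close> is at least as far from \<open>k\<close> as its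
  successor is from \<open>k + 1\<close>; since \<open>f\<close> is nondecreasing this makes the gap grow. Below gaps of
  size \<open>\<theta>\<close> nothing needs to be known about the vector field.\<close>

lemma separated_preserved:
  fixes X X' :: "real \<Rightarrow> real ^ 'n::{finite,linorder}" and f :: "real \<Rightarrow> real"
  assumes der: "\<And>t. t \<ge> 0 \<Longrightarrow> (X has_vector_derivative X' t) (at t within {0..})"
    and X': "\<And>t d. t \<ge> 0 \<Longrightarrow> \<theta> < d \<Longrightarrow> separated d (X t) \<Longrightarrow> X' t = drift f (X t)"
    and per: "\<And>t. f (t + real CARD('n)) = f t"
    and mono: "\<And>a b. \<theta> < a \<Longrightarrow> a \<le> b \<Longrightarrow> b < real CARD('n) - \<theta> \<Longrightarrow> f a \<le> f b"
    and "0 \<le> \<theta>" "\<theta> < \<delta>" and init: "separated \<delta> (X 0)" and t: "0 \<le> t"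
  shows "separated \<delta> (X t)"
  unfolding separated_iff_finite
proof
  fix k assume k: "k \<in> {..<CARD('n)}"
  define lab where "lab i = (label (nat (i mod int CARD('n))) :: 'n)" for i
  define g where "g k t = lift_config (X t) (int k + 1) - lift_config (X t) (int k)" for k :: nat and t
  define g' where "g' k t = X' t $ lab (int k + 1) - X' t $ lab (int k)" for k :: nat and t
  have "\<delta> \<le> g k t"
  proof (rule minimum_principle[where K="{..<CARD('n)}" and g=g and g'=g' and \<theta>=\<theta>])
    show "(g k has_real_derivative g' k t) (at t within {0..})" if "t \<ge> 0" for k t
    proof -
      have "((\<lambda>t. X t $ i) has_real_derivative X' t $ i) (at t within {0..})" for i
        using bounded_linear.has_vector_derivative[OF bounded_linear_vec_nth der[OF that]]
        by (simp add: has_real_derivative_iff_has_vector_derivative)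
      note this[THEN DERIV_add[OF _ DERIV_const]]
      from DERIV_diff[OF this this] show ?thesis
        unfolding g_def g'_def lift_config_def lab_def by simp
    qed
    show "0 \<le> g' k t" if "k \<in> {..<CARD('n)}" "t \<ge> 0" and big: "\<theta> < g k t"
      and min: "\<And>j. j \<in> {..<CARD('n)} \<Longrightarrow> g k t \<le> g j t" for k t
    proof -
      define y where "y = lift_config (X t)"
      define d where "d = g k t"
      \<comment> \<open>By minimality the smallest gap is itself a level of separation, and it
        exceeds \<theta>; this gives access to the drift form of X'.\<close>
      have sep: "separated d (X t)" using min unfolding separated_iff_finite g_def d_def by auto
      have d: "\<theta> < d" "0 \<le> d" using big \<open>0 \<le> \<theta>\<close> by (auto simp: d_def)
      have X't: "X' t = drift f (X t)" by (rule X'[OF \<open>t \<ge> 0\<close> d(1) sep])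
      have "X' t $ lab (int k + 1) = - (\<Sum>m<CARD('n). f (y (int k + 1) - y (int k + 1 - int m)))"
        unfolding X't lab_def y_def by (rule drift_lift_config) (rule per)
      moreover have "X' t $ lab (int k) = - (\<Sum>m<CARD('n). f (y (int k) - y (int k - int m)))"
        unfolding X't lab_def y_def by (rule drift_lift_config) (rule per)
      moreover have "(\<Sum>m<CARD('n). f (y (int k + 1) - y (int k + 1 - int m)))
          \<le> (\<Sum>m<CARD('n). f (y (int k) - y (int k - int m)))"
      proof (rule sum_mono)
        fix m assume m: "m \<in> {..<CARD('n)}"
        show "f (y (int k + 1) - y (int k + 1 - int m)) \<le> f (y (int k) - y (int k - int m))"
        proof (cases "m = 0")
          case False
          have "y (int k + 1) - y (int k + 1 - int m) \<in> {d..real CARD('n) - d}"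
               "y (int k) - y (int k - int m) \<in> {d..real CARD('n) - d}"
            using separated_bounds[OF sep d(2), of m] False m by (auto simp: y_def)
          moreover have "d = y (int k + 1) - y (int k)" by (simp add: d_def g_def y_def)
          moreover have "d \<le> y (int k - int m + 1) - y (int k - int m)"
            using sep by (simp add: separated_def y_def)
          ultimately show ?thesis
            using d by (intro mono) (auto simp: algebra_simps)
        qed simp
      qed
      ultimately show ?thesis by (simp add: g'_def)
    qed
    show "\<delta> \<le> g k 0" for k using init unfolding separated_def g_def by simp
  qed (use k t assms in auto)
  then show "\<delta> \<le> lift_config (X t) (int k + 1) - lift_config (X t) (int k)" by (simp add: g_def)
qed

section \<open>Contraction and stability of drift flows\<close>

text \<open>Gronwall with dissipation: multiplied by the integrating factor exp (\<alpha> * t), the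
  difference \<phi> - \<beta> / \<alpha> is nonincreasing and starts nonpositive. Because \<alpha> >
  0 the resulting bound does not grow with t.\<close>

lemma linear_differential_inequality:
  fixes \<phi> \<phi>' :: "real \<Rightarrow> real"
  assumes der: "\<And>t. t \<ge> 0 \<Longrightarrow> (\<phi> has_real_derivative \<phi>' t) (at t within {0..})"
    and le: "\<And>t. t \<ge> 0 \<Longrightarrow> \<phi>' t \<le> - \<alpha> * \<phi> t + \<beta>"
    and "\<phi> 0 \<le> 0" "0 < \<alpha>" "0 \<le> \<beta>" and t: "0 \<le> t"
  shows "\<phi> t \<le> \<beta> / \<alpha>"
proof -
  define \<psi> where "\<psi> t = exp (\<alpha> * t) * (\<phi> t - \<beta> / \<alpha>)" for t
  have "\<psi> t \<le> \<psi> 0"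
  proof (rule DERIV_nonpos_imp_decreasing_open[OF t])
    fix x assume x: "0 < x" "x < t"
    have "at x within {0..} = at x" using x by (intro at_within_interior) auto
    then have "(\<phi> has_real_derivative \<phi>' x) (at x)" using der[of x] x by simp
    then have "(\<psi> has_real_derivative exp (\<alpha> * x) * (\<phi>' x + \<alpha> * \<phi> x - \<beta>)) (at x)"
      unfolding \<psi>_def by (auto intro!: derivative_eq_intros simp: algebra_simps \<open>0 < \<alpha>\<close>[THEN less_imp_neq, symmetric])
    moreover have "exp (\<alpha> * x) * (\<phi>' x + \<alpha> * \<phi> x - \<beta>) \<le> 0"
      using le[of x] x by (intro mult_nonneg_nonpos) auto
    ultimately show "\<exists>y. (\<psi> has_real_derivative y) (at x) \<and> y \<le> 0" by blast
  next
    have "continuous_on {0..} \<phi>"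
      using der by (auto intro!: DERIV_continuous simp: continuous_on_eq_continuous_within)
    then have "continuous_on {0..t} \<phi>" by (rule continuous_on_subset) auto
    then show "continuous_on {0..t} \<psi>" unfolding \<psi>_def by (intro continuous_intros)
  qed
  also have "\<psi> 0 \<le> 0" using assms by (simp add: \<psi>_def) (meson divide_nonneg_pos order_trans)
  finally show ?thesis by (simp add: \<psi>_def mult_le_0_iff)
qed

text \<open>Applied with the sum of w equal to 0: pairwise differences then control all of w, which
  is how the conserved centre of mass enters the contraction.\<close>

lemma sum_sum_diff_square:
  fixes w :: "'a \<Rightarrow> real"
  shows "(\<Sum>i\<in>A. \<Sum>j\<in>A. (w i - w j)\<^sup>2) = 2 * real (card A) * (\<Sum>i\<in>A. (w i)\<^sup>2) - 2 * (\<Sum>i\<in>A. w i)\<^sup>2"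
proof -
  have "(\<Sum>i\<in>A. \<Sum>j\<in>A. (w i - w j)\<^sup>2) = (\<Sum>i\<in>A. \<Sum>j\<in>A. (w i)\<^sup>2) + (\<Sum>i\<in>A. \<Sum>j\<in>A. (w j)\<^sup>2) - 2 * (\<Sum>i\<in>A. \<Sum>j\<in>A. w i * w j)"
    by (simp add: power2_diff sum.distrib sum_subtractf sum_distrib_left algebra_simps)
  also have "(\<Sum>i\<in>A. \<Sum>j\<in>A. w i * w j) = (\<Sum>i\<in>A. w i)\<^sup>2"
    by (simp add: power2_eq_square sum_product)
  also have "(\<Sum>i\<in>A. \<Sum>j\<in>A. (w i)\<^sup>2) = real (card A) * (\<Sum>i\<in>A. (w i)\<^sup>2)"
    by (simp add: sum_distrib_left)
  finally show ?thesis by simp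
qed

lemma sum_odd_symmetrize:
  fixes w :: "'a \<Rightarrow> real"
  assumes "\<And>i j. F i j = - F j i"
  shows "2 * (\<Sum>i\<in>A. w i * (\<Sum>j\<in>A. F i j)) = (\<Sum>i\<in>A. \<Sum>j\<in>A. (w i - w j) * F i j)"
proof -
  have "(\<Sum>i\<in>A. \<Sum>j\<in>A. w j * F i j) = (\<Sum>j\<in>A. \<Sum>i\<in>A. w j * F i j)" by (rule sum.swap)
  also have "\<dots> = - (\<Sum>j\<in>A. \<Sum>i\<in>A. w j * F j i)"
    by (subst assms) (simp add: sum_negf)
  finally show ?thesis by (simp add: sum_distrib_left left_diff_distrib sum_subtractf)
qed

lemma sum_drift_eq_0:
  fixes X :: "real ^ 'n::finite"
  assumes odd: "\<And>t. f (- t) = - f t"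
  shows "(\<Sum>i\<in>UNIV. drift f X $ i) = 0"
proof -
  have "2 * (\<Sum>i\<in>UNIV. 1 * (\<Sum>j\<in>UNIV. f (X $ i - X $ j))) = 0"
    by (subst sum_odd_symmetrize) (metis odd minus_diff_eq, simp)
  then show ?thesis by (simp add: drift_def sum_negf)
qed

text \<open>Oddness turns the inner product into a sum over pairs. For one pair, f a - g b is split
  into f a - f b, which gives c * (a - b)^2, and f b - g b, which costs at most L * \<eta> because
  |a - b| is at most L. The L^2 ordered pairs produce the error L^3 * \<eta>, and equal centres of
  mass turn the main term into 2 * c * L times the squared norm.\<close>

lemma drift_contraction:
  fixes X Y :: "real ^ 'n::{finite,linorder}"
  defines "L \<equiv> real CARD('n)"
  assumes odd: "\<And>t. f (- t) = - f t" "\<And>t. g (- t) = - g t"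
    and mono: "\<And>a b. \<delta> \<le> b \<Longrightarrow> b \<le> a \<Longrightarrow> a \<le> L - \<delta> \<Longrightarrow> c * (a - b) \<le> f a - f b"
    and close: "\<And>b. \<delta> \<le> b \<Longrightarrow> b \<le> L - \<delta> \<Longrightarrow> \<bar>f b - g b\<bar> \<le> \<eta>"
    and sep: "separated \<delta> X" "separated \<delta> Y" and "0 \<le> \<delta>" "0 \<le> \<eta>"
    and mean: "(\<Sum>i\<in>UNIV. X $ i) = (\<Sum>i\<in>UNIV. Y $ i)"
  shows "2 * ((X - Y) \<bullet> (drift f X - drift g Y)) \<le> - (2 * c * L) * ((X - Y) \<bullet> (X - Y)) + L ^ 3 * \<eta>"
proof -
  define w where "w i = X $ i - Y $ i" for i
  define F where "F i j = f (X $ i - X $ j) - g (Y $ i - Y $ j)" for i j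
  have Fodd: "F i j = - F j i" for i j
    unfolding F_def using odd(1)[of "X $ j - X $ i"] odd(2)[of "Y $ j - Y $ i"] by simp
  have key: "c * (a - b)\<^sup>2 - L * \<eta> \<le> (a - b) * (f a - g b)"
    if a: "\<delta> \<le> a" "a \<le> L - \<delta>" and b: "\<delta> \<le> b" "b \<le> L - \<delta>" for a b
  proof -
    have "c * (a - b)\<^sup>2 \<le> (a - b) * (f a - f b)"
    proof (cases "b \<le> a")
      case True
      then have "(a - b) * (c * (a - b)) \<le> (a - b) * (f a - f b)"
        using mono[of b a] a b by (intro mult_left_mono) auto
      then show ?thesis by (simp add: power2_eq_square algebra_simps)
    next
      case False
      then have "(b - a) * (c * (b - a)) \<le> (b - a) * (f b - f a)"
        using mono[of a b] a b by (intro mult_left_mono) auto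
      then show ?thesis by (simp add: power2_eq_square algebra_simps)
    qed
    moreover have "\<bar>(a - b) * (f b - g b)\<bar> \<le> L * \<eta>"
      unfolding abs_mult using a b close[of b] \<open>0 \<le> \<delta>\<close> by (intro mult_mono) (auto simp: abs_le_iff)
    moreover have "(a - b) * (f a - g b) = (a - b) * (f a - f b) + (a - b) * (f b - g b)"
      by (simp add: algebra_simps)
    ultimately show ?thesis by linarith
  qed
  have pair: "c * (w i - w j)\<^sup>2 - L * \<eta> \<le> (w i - w j) * F i j" if "j < i" for i j
    using key[of "X $ i - X $ j" "Y $ i - Y $ j"] separated_pair[OF sep(1) \<open>0 \<le> \<delta>\<close> that]
      separated_pair[OF sep(2) \<open>0 \<le> \<delta>\<close> that]
    by (simp add: w_def F_def L_def algebra_simps)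
  have all: "c * (w i - w j)\<^sup>2 - L * \<eta> \<le> (w i - w j) * F i j" for i j
  proof -
    consider "j < i" | "i < j" | "i = j" by fastforce
    then show ?thesis
    proof cases
      case 2
      then show ?thesis using pair[of i j] Fodd[of i j] by (simp add: power2_commute algebra_simps)
    qed (use pair \<open>0 \<le> \<eta>\<close> in \<open>auto simp: L_def\<close>)
  qed
  have "2 * ((X - Y) \<bullet> (drift f X - drift g Y)) = - (2 * (\<Sum>i\<in>UNIV. w i * (\<Sum>j\<in>UNIV. F i j)))"
    by (simp add: inner_vec_def drift_def w_def F_def sum_subtractf sum_negf[symmetric] sum_distrib_left algebra_simps)
  also have "\<dots> = - (\<Sum>i\<in>UNIV. \<Sum>j\<in>UNIV. (w i - w j) * F i j)"
    by (subst sum_odd_symmetrize[OF Fodd]) simp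
  also have "\<dots> \<le> - (\<Sum>i\<in>UNIV. \<Sum>j\<in>UNIV. c * (w i - w j)\<^sup>2 - L * \<eta>)"
    by (intro le_imp_neg_le sum_mono all)
  also have "\<dots> = - c * (\<Sum>i\<in>UNIV. \<Sum>j\<in>UNIV. (w i - w j)\<^sup>2) + L ^ 3 * \<eta>"
    by (simp add: sum_subtractf sum_distrib_left sum_negf L_def power3_eq_cube)
  also have "(\<Sum>i\<in>UNIV. \<Sum>j\<in>UNIV. (w i - w j)\<^sup>2) = 2 * L * ((X - Y) \<bullet> (X - Y))"
    using mean by (subst sum_sum_diff_square) (simp add: w_def sum_subtractf L_def inner_vec_def power2_eq_square)
  finally show ?thesis by (simp add: algebra_simps)
qed

text \<open>Odd interactions have zero total drift, so both flows keep the common centre of mass and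
  the contraction applies at every time. The right-hand side is the ratio of the two constants in
  \<open>drift_contraction\<close>, free of t.\<close>

lemma drift_flow_stability:
  fixes X Y :: "real \<Rightarrow> real ^ 'n::{finite,linorder}"
  defines "L \<equiv> real CARD('n)"
  assumes derX: "\<And>t. t \<ge> 0 \<Longrightarrow> (X has_vector_derivative drift f (X t)) (at t within {0..})"
    and derY: "\<And>t. t \<ge> 0 \<Longrightarrow> (Y has_vector_derivative drift g (Y t)) (at t within {0..})"
    and init: "X 0 = Y 0"
    and odd: "\<And>t. f (- t) = - f t" "\<And>t. g (- t) = - g t"
    and mono: "\<And>a b. \<delta> \<le> b \<Longrightarrow> b \<le> a \<Longrightarrow> a \<le> L - \<delta> \<Longrightarrow> c * (a - b) \<le> f a - f b"
    and close: "\<And>b. \<delta> \<le> b \<Longrightarrow> b \<le> L - \<delta> \<Longrightarrow> \<bar>f b - g b\<bar> \<le> \<eta>"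
    and sep: "\<And>t. t \<ge> 0 \<Longrightarrow> separated \<delta> (X t)" "\<And>t. t \<ge> 0 \<Longrightarrow> separated \<delta> (Y t)"
    and "0 \<le> \<delta>" "0 \<le> \<eta>" "0 < c" and t: "0 \<le> t"
  shows "(norm (X t - Y t))\<^sup>2 \<le> L\<^sup>2 * \<eta> / (2 * c)"
proof -
  define \<phi> where "\<phi> t = (X t - Y t) \<bullet> (X t - Y t)" for t
  define \<phi>' where "\<phi>' t = 2 * ((X t - Y t) \<bullet> (drift f (X t) - drift g (Y t)))" for t
  have L: "L > 0" by (simp add: L_def)
  have der: "(\<phi> has_real_derivative \<phi>' t) (at t within {0..})" if "t \<ge> 0" for t
  proof -
    have d: "((\<lambda>t. X t - Y t) has_vector_derivative drift f (X t) - drift g (Y t)) (at t within {0..})"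
      by (intro has_vector_derivative_diff derX derY that)
    have "(\<phi> has_vector_derivative \<phi>' t) (at t within {0..})"
      using bounded_bilinear.has_vector_derivative[OF bounded_bilinear_inner d d]
      unfolding \<phi>_def \<phi>'_def by (simp add: inner_commute)
    then show ?thesis by (simp add: has_real_derivative_iff_has_vector_derivative)
  qed
  have mean: "(\<Sum>i\<in>UNIV. X t $ i) = (\<Sum>i\<in>UNIV. Y t $ i)" if "t \<ge> 0" for t
  proof -
    define m where "m t = (\<Sum>i\<in>UNIV. (X t - Y t) $ i)" for t
    have "(m has_vector_derivative 0) (at t within {0..})" if "t \<ge> 0" for t
    proof -
      have "bounded_linear (\<lambda>v :: (real, 'n) vec. \<Sum>i\<in>UNIV. v $ i)"
        by (intro bounded_linear_sum bounded_linear_vec_nth)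
      from bounded_linear.has_vector_derivative[OF this has_vector_derivative_diff[OF derX derY], OF that that]
      show ?thesis
        unfolding m_def by (simp add: sum_subtractf sum_drift_eq_0[of f, OF odd(1)] sum_drift_eq_0[of g, OF odd(2)])
    qed
    then have "m t = m 0"
      using has_vector_derivative_zero_constant[of "{0..}" m] that by (metis atLeast_iff convex_real_interval(1) order_refl)
    then show ?thesis using init by (simp add: m_def sum_subtractf)
  qed
  have "\<phi> t \<le> L ^ 3 * \<eta> / (2 * c * L)"
  proof (rule linear_differential_inequality[OF der _ _ _ _ t])
    fix t :: real assume "t \<ge> 0"
    show "\<phi>' t \<le> - (2 * c * L) * \<phi> t + L ^ 3 * \<eta>"
      unfolding \<phi>_def \<phi>'_def L_def
      by (rule drift_contraction[where \<delta>=\<delta>])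
        (use odd mono close sep mean \<open>t \<ge> 0\<close> \<open>0 \<le> \<delta>\<close> \<open>0 \<le> \<eta>\<close> in \<open>auto simp: L_def\<close>)
  qed (use init L \<open>0 < c\<close> \<open>0 \<le> \<eta>\<close> in \<open>auto simp: \<phi>_def\<close>)
  also have "\<dots> = L\<^sup>2 * \<eta> / (2 * c)" using L by (simp add: power3_eq_cube power2_eq_square)
  finally show ?thesis by (simp add: \<phi>_def dot_square_norm)
qed

text \<open>For passing to the limit in the velocities of approximating flows. Replacing f by h and
  moving the argument of h cost \<eta> each, for each of the L^2 pairs in the l1 norm; the factor 2
  in \<open>unif\<close> is there because a difference of two coordinates moves by up to twice the
  norm.\<close>

lemma norm_drift_diff_le:
  fixes X Y :: "real ^ 'n::{finite,linorder}"
  defines "L \<equiv> real CARD('n)"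
  assumes odd: "\<And>t. f (- t) = - f t" "\<And>t. h (- t) = - h t"
    and close: "\<And>b. \<delta> \<le> b \<Longrightarrow> b \<le> L - \<delta> \<Longrightarrow> \<bar>f b - h b\<bar> \<le> \<eta>"
    and unif: "\<And>a b. a \<in> {\<delta>..L - \<delta>} \<Longrightarrow> b \<in> {\<delta>..L - \<delta>} \<Longrightarrow> \<bar>a - b\<bar> \<le> 2 * norm (X - Y) \<Longrightarrow> \<bar>h a - h b\<bar> \<le> \<eta>"
    and sep: "separated \<delta> X" "separated \<delta> Y" and "0 \<le> \<delta>" "0 \<le> \<eta>"
  shows "norm (drift f X - drift h Y) \<le> 2 * L\<^sup>2 * \<eta>"
proof -
  have pair: "\<bar>f (X $ i - X $ j) - h (Y $ i - Y $ j)\<bar> \<le> 2 * \<eta>" if "j < i" for i j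
  proof -
    have a: "X $ i - X $ j \<in> {\<delta>..L - \<delta>}" and b: "Y $ i - Y $ j \<in> {\<delta>..L - \<delta>}"
      using separated_pair[OF _ \<open>0 \<le> \<delta>\<close> that] sep by (auto simp: L_def)
    have "\<bar>(X $ i - X $ j) - (Y $ i - Y $ j)\<bar> \<le> \<bar>(X - Y) $ i\<bar> + \<bar>(X - Y) $ j\<bar>" by simp
    also have "\<dots> \<le> 2 * norm (X - Y)"
      using component_le_norm_cart[of "X - Y" i] component_le_norm_cart[of "X - Y" j] by simp
    finally show ?thesis using unif[OF a b] close[of "X $ i - X $ j"] a by auto
  qed
  have all: "\<bar>f (X $ i - X $ j) - h (Y $ i - Y $ j)\<bar> \<le> 2 * \<eta>" for i j
  proof -
    consider "j < i" | "i < j" | "i = j" by fastforce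
    then show ?thesis
    proof cases
      case 2
      then show ?thesis
        using pair[of i j] odd(1)[of "X $ j - X $ i"] odd(2)[of "Y $ j - Y $ i"] by simp
    next
      case 3
      then show ?thesis using odd(1)[of 0] odd(2)[of 0] \<open>0 \<le> \<eta>\<close> by simp
    qed (use pair in auto)
  qed
  have "norm (drift f X - drift h Y) \<le> (\<Sum>i\<in>UNIV. \<bar>(drift f X - drift h Y) $ i\<bar>)"
    by (rule norm_le_l1_cart)
  also have "\<dots> \<le> (\<Sum>i\<in>(UNIV::'n set). \<Sum>j\<in>(UNIV::'n set). 2 * \<eta>)"
  proof (rule sum_mono)
    fix i
    have "\<bar>(drift f X - drift h Y) $ i\<bar> = \<bar>\<Sum>j\<in>UNIV. f (X $ i - X $ j) - h (Y $ i - Y $ j)\<bar>"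
      by (simp add: drift_def sum_subtractf)
    also have "\<dots> \<le> (\<Sum>j\<in>(UNIV::'n set). 2 * \<eta>)" by (rule sum_abs[THEN order_trans, OF sum_mono[OF all]])
    finally show "\<bar>(drift f X - drift h Y) $ i\<bar> \<le> (\<Sum>j\<in>(UNIV::'n set). 2 * \<eta>)" .
  qed
  also have "\<dots> = 2 * L\<^sup>2 * \<eta>" by (simp add: L_def power2_eq_square)
  finally show ?thesis .
qed

section \<open>Passage to the limit in the perturbed flows\<close>

lemma separated_limit:
  fixes X :: "nat \<Rightarrow> real ^ 'n::{finite,linorder}"
  assumes "X \<longlonglongrightarrow> Y" "\<And>n. separated d (X n)"
  shows "separated d Y"
  unfolding separated_def
proof
  fix k
  have "(\<lambda>n. lift_config (X n) (k + 1) - lift_config (X n) k) \<longlonglongrightarrow> lift_config Y (k + 1) - lift_config Y k"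
    unfolding lift_config_def by (intro tendsto_intros assms)
  then show "d \<le> lift_config Y (k + 1) - lift_config Y k"
    by (rule tendsto_lowerbound) (use assms in \<open>auto simp: separated_def\<close>)
qed

text \<open>Separates the dynamics from the particular energy. W and V are arbitrary fields that
  have drift form on sufficiently separated configurations, so no information about collisions
  enters; the constant c common to all \<epsilon> makes the estimates uniform in \<epsilon> and in
  time.\<close>

theorem perturbed_drift_flows_converge:
  fixes X\<^sub>0 :: "real ^ 'n::{finite,linorder}"
    and W :: "real ^ 'n::{finite,linorder} \<Rightarrow> real ^ 'n::{finite,linorder}" and V :: "real \<Rightarrow> real ^ 'n::{finite,linorder} \<Rightarrow> real ^ 'n::{finite,linorder}"
    and h :: "real \<Rightarrow> real" and k :: "real \<Rightarrow> real \<Rightarrow> real" and X :: "real \<Rightarrow> real \<Rightarrow> real ^ 'n::{finite,linorder}"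
  defines "L \<equiv> real CARD('n)"
  assumes "0 < \<delta>" and init: "separated \<delta> X\<^sub>0" and "0 < c"
    and W: "\<And>Z d. 0 < d \<Longrightarrow> separated d Z \<Longrightarrow> W Z = drift h Z"
    and V: "\<And>\<epsilon> Z d. 0 < \<epsilon> \<Longrightarrow> 2 * \<epsilon> < d \<Longrightarrow> separated d Z \<Longrightarrow> V \<epsilon> Z = drift (k \<epsilon>) Z"
    and h: "\<And>t. h (- t) = - h t" "\<And>t. h (t + L) = h t" "continuous_on {0<..<L} h"
      "\<And>a b. 0 < b \<Longrightarrow> b \<le> a \<Longrightarrow> a < L \<Longrightarrow> c * (a - b) \<le> h a - h b"
    and k: "\<And>\<epsilon> t. 0 < \<epsilon> \<Longrightarrow> k \<epsilon> (- t) = - k \<epsilon> t" "\<And>\<epsilon> t. 0 < \<epsilon> \<Longrightarrow> k \<epsilon> (t + L) = k \<epsilon> t"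
      "\<And>\<epsilon> a b. 0 < \<epsilon> \<Longrightarrow> 2 * \<epsilon> < b \<Longrightarrow> b \<le> a \<Longrightarrow> a < L - 2 * \<epsilon> \<Longrightarrow> c * (a - b) \<le> k \<epsilon> a - k \<epsilon> b"
    and close: "\<And>\<eta>. 0 < \<eta> \<Longrightarrow> \<exists>\<epsilon>\<^sub>0>0. \<forall>\<epsilon> b. 0 < \<epsilon> \<longrightarrow> \<epsilon> < \<epsilon>\<^sub>0 \<longrightarrow> \<delta> \<le> b \<longrightarrow> b \<le> L - \<delta> \<longrightarrow> \<bar>k \<epsilon> b - h b\<bar> \<le> \<eta>"
    and X: "\<And>\<epsilon>. 0 < \<epsilon> \<Longrightarrow> solves_cauchy (V \<epsilon>) X\<^sub>0 (X \<epsilon>)"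
  shows "\<exists>Z. solves_cauchy W X\<^sub>0 Z \<and> (\<forall>Y. solves_cauchy W X\<^sub>0 Y \<longrightarrow> (\<forall>t\<ge>0. Y t = Z t)) \<and>
    (\<forall>t\<ge>0. separated \<delta> (Z t)) \<and> (\<forall>\<epsilon> t. 0 < \<epsilon> \<longrightarrow> 2 * \<epsilon> < \<delta> \<longrightarrow> 0 \<le> t \<longrightarrow> separated \<delta> (X \<epsilon> t)) \<and>
    uniform_limit {0..} X Z (at_right 0)"
proof -
  have L: "L > 0" by (simp add: L_def)
  have sepX: "separated \<delta> (X \<epsilon> t)" if \<epsilon>: "0 < \<epsilon>" "2 * \<epsilon> < \<delta>" and t: "0 \<le> t" for \<epsilon> t
  proof (rule separated_preserved[where f="k \<epsilon>" and \<theta>="2 * \<epsilon>" and X="X \<epsilon>" and X'="\<lambda>t. V \<epsilon> (X \<epsilon> t)"])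
    show "k \<epsilon> a \<le> k \<epsilon> b" if "2 * \<epsilon> < a" "a \<le> b" "b < real CARD('n) - 2 * \<epsilon>" for a b
    proof -
      have "0 \<le> c * (b - a)" using \<open>0 < c\<close> that by simp
      then show ?thesis using k(3)[of \<epsilon> a b] that \<epsilon> by (simp add: L_def)
    qed
  qed (use X[OF \<epsilon>(1)] V[OF \<epsilon>(1)] k(2)[OF \<epsilon>(1)] \<epsilon> t init in \<open>auto simp: solves_cauchy_def L_def\<close>)
  \<comment> \<open>Threshold 0, and an arbitrary solution of the limit problem: every such solution
    stays where the stability estimate applies, which is later used for uniqueness.\<close>
  have sepW: "separated \<delta> (Y t)" if Y: "solves_cauchy W X\<^sub>0 Y" and t: "0 \<le> t" for Y t
  proof (rule separated_preserved[where f=h and \<theta>=0 and X=Y and X'="\<lambda>t. W (Y t)"])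
    show "h a \<le> h b" if "0 < a" "a \<le> b" "b < real CARD('n) - 0" for a b
    proof -
      have "0 \<le> c * (b - a)" using \<open>0 < c\<close> that by simp
      then show ?thesis using h(4)[of a b] that by (simp add: L_def)
    qed
  qed (use Y W h(2) \<open>0 < \<delta>\<close> t init in \<open>auto simp: solves_cauchy_def L_def\<close>)
  have derX: "(X \<epsilon> has_vector_derivative drift (k \<epsilon>) (X \<epsilon> t)) (at t within {0..})"
    if "0 < \<epsilon>" "2 * \<epsilon> < \<delta>" "0 \<le> t" for \<epsilon> t
    using X[OF that(1)] V[OF that(1,2) sepX[OF that]] that unfolding solves_cauchy_def by metis
  have X0: "X \<epsilon> 0 = X\<^sub>0" if "0 < \<epsilon>" for \<epsilon> using X[OF that] by (simp add: solves_cauchy_def)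
  have derW: "(Y has_vector_derivative drift h (Y t)) (at t within {0..})"
    if "solves_cauchy W X\<^sub>0 Y" "0 \<le> t" for Y t
    using that(1) W[OF \<open>0 < \<delta>\<close> sepW[OF that]] that unfolding solves_cauchy_def by metis
  have stabW: "(norm (Y t - X \<epsilon> t))\<^sup>2 \<le> L\<^sup>2 * \<eta> / (2 * c)"
    if Y: "solves_cauchy W X\<^sub>0 Y" and \<epsilon>: "0 < \<epsilon>" "2 * \<epsilon> < \<delta>" and "0 \<le> \<eta>" "0 \<le> t"
      and cl: "\<And>b. \<delta> \<le> b \<Longrightarrow> b \<le> L - \<delta> \<Longrightarrow> \<bar>k \<epsilon> b - h b\<bar> \<le> \<eta>" for Y \<epsilon> \<eta> t
    unfolding L_def
  proof (rule drift_flow_stability[where f=h and g="k \<epsilon>" and \<delta>=\<delta>])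
    show "\<bar>h b - k \<epsilon> b\<bar> \<le> \<eta>" if "\<delta> \<le> b" "b \<le> real CARD('n) - \<delta>" for b
      using cl[of b] that by (simp add: L_def abs_minus_commute)
    show "Y 0 = X \<epsilon> 0" using Y X0[OF \<epsilon>(1)] by (simp add: solves_cauchy_def)
  qed (use derW[OF Y] derX[OF \<epsilon>] h k(1)[OF \<epsilon>(1)] sepX[OF \<epsilon>] sepW[OF Y] \<open>0 < \<delta>\<close> that \<open>0 < c\<close> in \<open>auto simp: L_def\<close>)
  have stabX: "(norm (X \<epsilon> t - X \<epsilon>' t))\<^sup>2 \<le> L\<^sup>2 * (2 * \<eta>) / (2 * c)"
    if \<epsilon>: "0 < \<epsilon>" "2 * \<epsilon> < \<delta>" and \<epsilon>': "0 < \<epsilon>'" "2 * \<epsilon>' < \<delta>" and "0 \<le> \<eta>" "0 \<le> t"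
      and cl: "\<And>b. \<delta> \<le> b \<Longrightarrow> b \<le> L - \<delta> \<Longrightarrow> \<bar>k \<epsilon> b - h b\<bar> \<le> \<eta>"
        "\<And>b. \<delta> \<le> b \<Longrightarrow> b \<le> L - \<delta> \<Longrightarrow> \<bar>k \<epsilon>' b - h b\<bar> \<le> \<eta>" for \<epsilon> \<epsilon>' \<eta> t
    unfolding L_def
  proof (rule drift_flow_stability[where f="k \<epsilon>" and g="k \<epsilon>'" and \<delta>=\<delta>])
    show "\<bar>k \<epsilon> b - k \<epsilon>' b\<bar> \<le> 2 * \<eta>" if "\<delta> \<le> b" "b \<le> real CARD('n) - \<delta>" for b
      using cl(1)[of b] cl(2)[of b] that by (simp add: L_def)
    show "X \<epsilon> 0 = X \<epsilon>' 0" using X0[OF \<epsilon>(1)] X0[OF \<epsilon>'(1)] by simp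
  qed (use derX[OF \<epsilon>] derX[OF \<epsilon>'] k(3)[OF \<epsilon>(1)] k(1)[OF \<epsilon>(1)] k(1)[OF \<epsilon>'(1)] sepX[OF \<epsilon>] sepX[OF \<epsilon>'] \<open>0 < \<delta>\<close> that \<open>0 < c\<close> in \<open>auto simp: L_def\<close>)
  have choose: "\<exists>\<epsilon>\<^sub>0>0. 2 * \<epsilon>\<^sub>0 < \<delta> \<and> (\<forall>\<epsilon> b. 0 < \<epsilon> \<longrightarrow> \<epsilon> < \<epsilon>\<^sub>0 \<longrightarrow> \<delta> \<le> b \<longrightarrow> b \<le> L - \<delta> \<longrightarrow> \<bar>k \<epsilon> b - h b\<bar> \<le> \<eta>)"
    if \<eta>: "0 < \<eta>" for \<eta>
  proof -
    from close[OF \<eta>] obtain \<epsilon>\<^sub>0 where "0 < \<epsilon>\<^sub>0"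
      "\<forall>\<epsilon> b. 0 < \<epsilon> \<longrightarrow> \<epsilon> < \<epsilon>\<^sub>0 \<longrightarrow> \<delta> \<le> b \<longrightarrow> b \<le> L - \<delta> \<longrightarrow> \<bar>k \<epsilon> b - h b\<bar> \<le> \<eta>" by blast
    then show ?thesis using \<open>0 < \<delta>\<close> by (intro exI[of _ "min \<epsilon>\<^sub>0 (\<delta> / 3)"]) (auto simp: min_def)
  qed
  \<comment> \<open>The witness makes the squared bound of \<open>stabX\<close> equal to half of the
    square of e.\<close>
  have small: "\<exists>\<eta>>0. L\<^sup>2 * (2 * \<eta>) / (2 * c) < e\<^sup>2" if "e > 0" for e
  proof (intro exI[of _ "e\<^sup>2 * c / (2 * L\<^sup>2)"] conjI)
    have "e\<^sup>2 > 0" using that by simp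
    moreover have "L\<^sup>2 * (2 * (e\<^sup>2 * c / (2 * L\<^sup>2))) / (2 * c) = e\<^sup>2 / 2"
      using L \<open>0 < c\<close> by (simp add: field_simps)
    ultimately show "L\<^sup>2 * (2 * (e\<^sup>2 * c / (2 * L\<^sup>2))) / (2 * c) < e\<^sup>2" by simp
  qed (use L that \<open>0 < c\<close> in auto)

  \<comment> \<open>The factor 3 makes 2 * e n < \<delta> hold already for n = 0, so every member of
    the sequence is admissible.\<close>
  define e where "e n = \<delta> / (3 * real (Suc n))" for n
  have e: "0 < e n" "2 * e n < \<delta>" for n using \<open>0 < \<delta>\<close> by (auto simp: e_def field_simps intro!: add_pos_nonneg)
  have e0: "e \<longlonglongrightarrow> 0"
    using tendsto_mult_right[OF LIMSEQ_inverse_real_of_nat, of "\<delta> / 3"]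
    unfolding e_def by (simp add: field_simps)
  have uC: "uniformly_Cauchy_on {0..} (\<lambda>n. X (e n))"
  proof (rule uniformly_Cauchy_onI)
    fix r :: real assume "r > 0"
    then obtain \<eta> where \<eta>: "\<eta> > 0" "L\<^sup>2 * (2 * \<eta>) / (2 * c) < r\<^sup>2" using small by blast
    obtain \<epsilon>\<^sub>0 where \<epsilon>\<^sub>0: "\<epsilon>\<^sub>0 > 0" "\<And>\<epsilon> b. 0 < \<epsilon> \<Longrightarrow> \<epsilon> < \<epsilon>\<^sub>0 \<Longrightarrow> \<delta> \<le> b \<Longrightarrow> b \<le> L - \<delta> \<Longrightarrow> \<bar>k \<epsilon> b - h b\<bar> \<le> \<eta>"
      using choose[OF \<eta>(1)] by blast
    obtain M where M: "\<And>n. n \<ge> M \<Longrightarrow> e n < \<epsilon>\<^sub>0"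
      using order_tendstoD(2)[OF e0 \<epsilon>\<^sub>0(1)] by (auto simp: eventually_sequentially)
    show "\<exists>M. \<forall>x\<in>{0..}. \<forall>m\<ge>M. \<forall>n\<ge>M. dist (X (e m) x) (X (e n) x) < r"
    proof (intro exI[of _ M] ballI allI impI)
      fix x m n assume "x \<in> {0::real..}" "M \<le> m" "M \<le> n"
      then have "(norm (X (e m) x - X (e n) x))\<^sup>2 \<le> L\<^sup>2 * (2 * \<eta>) / (2 * c)"
        using \<eta>(1) e M by (intro stabX \<epsilon>\<^sub>0(2)) auto
      then have "(norm (X (e m) x - X (e n) x))\<^sup>2 < r\<^sup>2" using \<eta>(2) by simp
      then show "dist (X (e m) x) (X (e n) x) < r"
        using \<open>r > 0\<close> by (simp add: dist_norm power_less_imp_less_base)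
    qed
  qed
  then obtain Z0 where Z0: "uniform_limit {0..} (\<lambda>n. X (e n)) Z0 sequentially"
    using Cauchy_uniformly_convergent uniformly_convergent_on_def by blast
  have limZ0: "(\<lambda>n. X (e n) t) \<longlonglongrightarrow> Z0 t" if "t \<ge> 0" for t
    using tendsto_uniform_limitI[OF Z0] that by simp
  have sepZ0: "separated \<delta> (Z0 t)" if "t \<ge> 0" for t
    by (rule separated_limit[OF limZ0[OF that] sepX[OF e that]])
  have uch: "uniformly_continuous_on {\<delta>..L - \<delta>} h"
    by (rule compact_uniformly_continuous[OF continuous_on_subset[OF h(3)]]) (use \<open>0 < \<delta>\<close> in auto)
  \<comment> \<open>So far Z0 is only a uniform limit. The velocities converge uniformly as well,
    which yields a differentiable limit; it is identified with Z0 afterwards.\<close>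
  have "\<exists>g. \<forall>t\<in>{0..}. (\<lambda>n. X (e n) t) \<longlonglongrightarrow> g t \<and> (g has_derivative (\<lambda>r. r *\<^sub>R drift h (Z0 t))) (at t within {0..})"
  proof (rule has_derivative_sequence)
    show "(X (e n) has_derivative (\<lambda>r. r *\<^sub>R drift (k (e n)) (X (e n) t))) (at t within {0..})" if "t \<in> {0..}" for n t
      using derX[OF e] that by (simp add: has_vector_derivative_def)
    show "\<forall>\<^sub>F n in sequentially. \<forall>t\<in>{0..}. \<forall>r. norm (r *\<^sub>R drift (k (e n)) (X (e n) t) - r *\<^sub>R drift h (Z0 t)) \<le> r' * norm r"
      if "r' > 0" for r' :: real
    proof -
      \<comment> \<open>Chosen to undo the constant of \<open>norm_drift_diff_le\<close>.\<close>
      define \<eta> where "\<eta> = r' / (2 * L\<^sup>2)"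
      have \<eta>: "\<eta> > 0" "2 * L\<^sup>2 * \<eta> = r'" using that L by (auto simp: \<eta>_def)
      obtain \<epsilon>\<^sub>0 where \<epsilon>\<^sub>0: "\<epsilon>\<^sub>0 > 0" "\<And>\<epsilon> b. 0 < \<epsilon> \<Longrightarrow> \<epsilon> < \<epsilon>\<^sub>0 \<Longrightarrow> \<delta> \<le> b \<Longrightarrow> b \<le> L - \<delta> \<Longrightarrow> \<bar>k \<epsilon> b - h b\<bar> \<le> \<eta>"
        using choose[OF \<eta>(1)] by blast
      obtain d where d: "d > 0" "\<And>a b. a \<in> {\<delta>..L - \<delta>} \<Longrightarrow> b \<in> {\<delta>..L - \<delta>} \<Longrightarrow> \<bar>a - b\<bar> < d \<Longrightarrow> \<bar>h a - h b\<bar> < \<eta>"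
        using uch \<eta>(1) unfolding uniformly_continuous_on_def dist_real_def by meson
      \<comment> \<open>Half of d, since differences of coordinates move by up to twice the distance
        of the configurations.\<close>
      have "d / 2 > 0" using d by simp
      from uniform_limitD[OF Z0 this] order_tendstoD(2)[OF e0 \<epsilon>\<^sub>0(1)]
      show ?thesis
      proof eventually_elim
        case (elim n)
        show ?case
        proof (intro ballI allI)
          fix t r :: real assume t: "t \<in> {0..}"
          then have "dist (X (e n) t) (Z0 t) < d / 2" using elim(1) by blast
          then have cl: "2 * norm (X (e n) t - Z0 t) < d" by (simp add: dist_norm)
          have "norm (drift (k (e n)) (X (e n) t) - drift h (Z0 t)) \<le> 2 * (real CARD('n))\<^sup>2 * \<eta>"
            by (rule norm_drift_diff_le[where \<delta>=\<delta>])
              (use k(1)[OF e(1)] h(1) \<epsilon>\<^sub>0(2)[OF e(1) elim(2)] sepX[OF e] sepZ0 t \<open>0 < \<delta>\<close> \<eta>(1) cl d(2)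
                in \<open>auto simp: L_def intro!: less_imp_le[OF d(2)]\<close>)
          then have "\<bar>r\<bar> * norm (drift (k (e n)) (X (e n) t) - drift h (Z0 t)) \<le> \<bar>r\<bar> * r'"
            using \<eta>(2) by (intro mult_left_mono) (auto simp: L_def)
          then show "norm (r *\<^sub>R drift (k (e n)) (X (e n) t) - r *\<^sub>R drift h (Z0 t)) \<le> r' * norm r"
            by (simp add: scaleR_diff_right[symmetric] mult.commute)
        qed
      qed
    qed
    show "(\<lambda>n. X (e n) 0) \<longlonglongrightarrow> X\<^sub>0" using X0[OF e(1)] by simp
  qed auto
  then obtain Z where Z: "\<And>t. t \<ge> 0 \<Longrightarrow> (\<lambda>n. X (e n) t) \<longlonglongrightarrow> Z t"
    and derZ: "\<And>t. t \<ge> 0 \<Longrightarrow> (Z has_vector_derivative drift h (Z0 t)) (at t within {0..})"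
    by (auto simp: has_vector_derivative_def)
  have ZZ0: "Z t = Z0 t" if "t \<ge> 0" for t using LIMSEQ_unique[OF Z[OF that] limZ0[OF that]] .
  have contZ: "continuous_on {0..} Z"
    using derZ by (auto intro!: has_vector_derivative_continuous simp: continuous_on_eq_continuous_within)
  have solZ: "solves_cauchy W X\<^sub>0 Z"
    unfolding solves_cauchy_def
  proof (intro conjI allI impI)
    show "Z 0 = X\<^sub>0" using LIMSEQ_unique[OF Z[of 0]] X0[OF e(1)] by simp
    have WZ: "W (Z t) = drift h (Z t)" if "t \<ge> 0" for t
      using W[OF \<open>0 < \<delta>\<close>] sepZ0[OF that] ZZ0[OF that] by simp
    show "(Z has_vector_derivative W (Z t)) (at t within {0..})" if "0 \<le> t" for t
      using derZ[OF that] WZ[OF that] ZZ0[OF that] by simp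
    \<comment> \<open>Continuity of h is available inside the cell (0, L), where separation places
      the differences with j < i; oddness supplies the reversed pairs.\<close>
    have comp: "continuous_on {0..} (\<lambda>t. h (Z t $ i - Z t $ j))" for i j
    proof -
      have zc: "continuous_on {0..} (\<lambda>t. Z t $ i - Z t $ j)" for i j
        by (intro continuous_intros contZ)
      have pos: "continuous_on {0..} (\<lambda>t. h (Z t $ i - Z t $ j))" if "j < i" for i j
        by (rule continuous_on_compose2[OF h(3) zc])
          (use separated_pair[OF sepZ0 _ that] \<open>0 < \<delta>\<close> ZZ0 in \<open>fastforce simp: L_def\<close>)
      consider "j < i" | "i < j" | "i = j" by fastforce
      then show ?thesis
      proof cases
        case 2
        have "(\<lambda>t. h (Z t $ i - Z t $ j)) = (\<lambda>t. - h (Z t $ j - Z t $ i))"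
          by (simp flip: h(1))
        then show ?thesis using continuous_on_minus[OF pos[OF 2]] by metis
      qed (use pos in auto)
    qed
    have "continuous_on {0..} (\<lambda>t. drift h (Z t))"
      unfolding drift_def by (intro continuous_intros comp)
    then show "continuous_on {0..} (\<lambda>t. W (Z t))"
      by (rule continuous_on_eq) (use WZ in auto)
  qed
  \<comment> \<open>Proved for an arbitrary solution: as the mollified flows have only one limit,
    uniqueness follows at once.\<close>
  have lim: "uniform_limit {0..} X Z' (at_right 0)" if Z': "solves_cauchy W X\<^sub>0 Z'" for Z'
    unfolding uniform_limit_iff
  proof (intro allI impI)
    fix r :: real assume "r > 0"
    then obtain \<eta> where \<eta>: "\<eta> > 0" "L\<^sup>2 * (2 * \<eta>) / (2 * c) < r\<^sup>2" using small by blast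
    have \<eta>2: "L\<^sup>2 * \<eta> / (2 * c) \<le> L\<^sup>2 * (2 * \<eta>) / (2 * c)"
      using \<eta> \<open>0 < c\<close> by (intro divide_right_mono mult_left_mono) auto
    obtain \<epsilon>\<^sub>0 where \<epsilon>\<^sub>0: "\<epsilon>\<^sub>0 > 0" "2 * \<epsilon>\<^sub>0 < \<delta>"
      "\<And>\<epsilon> b. 0 < \<epsilon> \<Longrightarrow> \<epsilon> < \<epsilon>\<^sub>0 \<Longrightarrow> \<delta> \<le> b \<Longrightarrow> b \<le> L - \<delta> \<Longrightarrow> \<bar>k \<epsilon> b - h b\<bar> \<le> \<eta>"
      using choose[OF \<eta>(1)] by blast
    have "dist (X \<epsilon> t) (Z' t) < r" if \<epsilon>: "\<epsilon> \<in> {0<..<\<epsilon>\<^sub>0}" and t: "t \<ge> 0" for \<epsilon> t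
    proof -
      have "(norm (Z' t - X \<epsilon> t))\<^sup>2 \<le> L\<^sup>2 * \<eta> / (2 * c)"
        using \<eta>(1) \<epsilon> t \<epsilon>\<^sub>0(1,2) by (intro stabW Z' \<epsilon>\<^sub>0(3)) auto
      then have "(norm (Z' t - X \<epsilon> t))\<^sup>2 < r\<^sup>2" using \<eta>(2) \<eta>2 by linarith
      then show ?thesis
        using \<open>r > 0\<close> by (simp add: dist_norm norm_minus_commute power_less_imp_less_base)
    qed
    then show "\<forall>\<^sub>F \<epsilon> in at_right 0. \<forall>t\<in>{0..}. dist (X \<epsilon> t) (Z' t) < r"
      using \<epsilon>\<^sub>0(1) by (auto simp: eventually_at_right_field intro!: exI[of _ \<epsilon>\<^sub>0])
  qed
  have "Y t = Z t" if "solves_cauchy W X\<^sub>0 Y" "t \<ge> 0" for Y t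
    using tendsto_unique[OF _ tendsto_uniform_limitI[OF lim[OF that(1)]] tendsto_uniform_limitI[OF lim[OF solZ]]] that(2)
    by (simp add: trivial_limit_at_right_real)
  then show ?thesis using solZ lim[OF solZ] sepX sepW[OF solZ] by blast
qed

section \<open>The sawtooth and its pair interaction\<close>

definition kernel :: "real \<Rightarrow> real \<Rightarrow> real" where
  "kernel s z = 1 / \<bar>z\<bar> powr (1 + 2 * s)"

text \<open>Pairing z with -z turns a principal value into an ordinary integral: for the sawtooth
  this expression vanishes for small z when t is off the jumps, and for all z at a jump, where the
  sawtooth is odd.\<close>

definition second_diff :: "(real \<Rightarrow> real) \<Rightarrow> real \<Rightarrow> real \<Rightarrow> real" where
  "second_diff f t z = 2 * f t - f (t + z) - f (t - z)"

text \<open>Averaging floor and ceiling makes the sawtooth odd at every point, the jumps included, and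
  equal to its trace average there.\<close>

definition lattice_step :: "real \<Rightarrow> real \<Rightarrow> real" where
  "lattice_step L t = (of_int \<lfloor>t / L\<rfloor> + of_int \<lceil>t / L\<rceil>) / 2"

definition sawtooth :: "real \<Rightarrow> real \<Rightarrow> real" where
  "sawtooth L t = t / L - lattice_step L t"

text \<open>The fractional Laplacian of the sawtooth; its prefactor 2 is absorbed by the
  symmetrization in z.\<close>

definition interaction :: "real \<Rightarrow> real \<Rightarrow> real \<Rightarrow> real" where
  "interaction L s t = (LINT z|lborel. second_diff (sawtooth L) t z * kernel s z)"

lemma kernel_nonneg [simp]: "0 \<le> kernel s z" by (simp add: kernel_def)
lemma kernel_minus [simp]: "kernel s (- z) = kernel s z" by (simp add: kernel_def)
lemma kernel_measurable [measurable]: "kernel s \<in> borel_measurable borel"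
  unfolding kernel_def[abs_def] by measurable
lemma lattice_step_measurable [measurable]: "lattice_step L \<in> borel_measurable borel"
  unfolding lattice_step_def[abs_def] by measurable
lemma sawtooth_measurable [measurable]: "sawtooth L \<in> borel_measurable borel"
  unfolding sawtooth_def[abs_def] by measurable

lemma second_diff_measurable [measurable (raw)]:
  assumes [measurable]: "f \<in> borel_measurable borel" "t \<in> borel_measurable M" "z \<in> borel_measurable M"
  shows "(\<lambda>x. second_diff f (t x) (z x)) \<in> borel_measurable M"
  unfolding second_diff_def by measurable

section \<open>Integrability against the kernel\<close>

lemma integrable_real_even:
  fixes f :: "real \<Rightarrow> real"
  assumes int: "integrable lborel (\<lambda>x. indicator {0<..} x * f x)"
    and even: "\<And>x. f (- x) = f x" and meas: "f \<in> borel_measurable borel"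
  shows "integrable lborel f"
proof -
  define g where "g x = indicator {0<..} x * f x" for x
  have g: "integrable lborel g" using int by (simp add: g_def[abs_def])
  then have "integrable lborel (\<lambda>x. g (- x))"
    using lborel_integrable_real_affine[OF g, of "-1" 0] by simp
  with g have sum: "integrable lborel (\<lambda>x. g x + g (- x))" by (rule Bochner_Integration.integrable_add)
  have "AE x in lborel. f x = g x + g (- x)"
    using AE_lborel_singleton[of 0]
  proof eventually_elim
    case (elim x)
    then show ?case using even[of x] by (cases "0 < x") (auto simp: g_def)
  qed
  then show ?thesis
    using meas by (subst integrable_cong_AE[OF _ borel_measurable_integrable[OF sum]]) (auto intro: sum)
qed

lemma integrable_of_has_integral_nonneg:
  fixes f :: "real \<Rightarrow> real"
  assumes "f integrable_on S" "\<And>x. x \<in> S \<Longrightarrow> 0 \<le> f x" "(\<lambda>x. indicator S x * f x) \<in> borel_measurable borel"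
  shows "integrable lborel (\<lambda>x. indicator S x * f x)"
proof -
  have "f absolutely_integrable_on S"
    using assms by (intro nonnegative_absolutely_integrable_1)
  then have "integrable lebesgue (\<lambda>x. indicator S x * f x)" by (simp add: set_integrable_def)
  then show ?thesis using assms(3) by (subst (asm) integrable_completion) auto
qed

text \<open>s < 1 makes z powr (1 - 2 * s) integrable at 0, and s > 0 makes z powr (- 1 - 2 * s)
  integrable at infinity. This weight is the common majorant in all later domination arguments
  against the kernel.\<close>

lemma kernel_integrable:
  assumes "0 < s" "s < 1"
  shows "integrable lborel (\<lambda>z. min 1 (z\<^sup>2) * kernel s z)"
proof (rule integrable_real_even)
  have a: "integrable lborel (\<lambda>z. indicator {0..1} z * z powr (1 - 2 * s))"
    by (rule integrable_of_has_integral_nonneg) (use assms in \<open>auto intro!: integrable_on_powr_from_0\<close>)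
  have b: "integrable lborel (\<lambda>z. indicator {1..} z * z powr (- 1 - 2 * s))"
  proof (rule integrable_of_has_integral_nonneg)
    show "(\<lambda>z. z powr (- 1 - 2 * s)) integrable_on {1..}"
      using has_integral_powr_to_inf[of "- 1 - 2 * s" 1] assms by (auto simp: integrable_on_def)
  qed auto
  show "integrable lborel (\<lambda>z. indicator {0<..} z * (min 1 (z\<^sup>2) * kernel s z))"
  proof (rule Bochner_Integration.integrable_bound[OF Bochner_Integration.integrable_add[OF a b]])
    show "AE z in lborel. norm (indicator {0<..} z * (min 1 (z\<^sup>2) * kernel s z)) \<le>
        norm (indicator {0..1} z * z powr (1 - 2 * s) + indicator {1..} z * z powr (- 1 - 2 * s))"
    proof (intro AE_I2)
      fix z :: real
      consider "z \<le> 0" | "0 < z" "z \<le> 1" | "1 < z" by linarith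
      then show "norm (indicator {0<..} z * (min 1 (z\<^sup>2) * kernel s z)) \<le>
        norm (indicator {0..1} z * z powr (1 - 2 * s) + indicator {1..} z * z powr (- 1 - 2 * s))"
      proof cases
        case 2
        have "z\<^sup>2 * kernel s z = z powr 2 * z powr (- (1 + 2 * s))"
          using 2 by (simp only: kernel_def powr_minus powr_numeral) (simp add: field_simps)
        also have "\<dots> = z powr (1 - 2 * s)" by (simp add: powr_add[symmetric])
        finally have "z\<^sup>2 * kernel s z = z powr (1 - 2 * s)" .
        moreover have "z\<^sup>2 \<le> 1" using 2 by (simp add: power_le_one)
        ultimately show ?thesis using 2 by (auto simp: indicator_def min_def)
      next
        case 3
        have "1 \<le> z\<^sup>2" using 3 by (simp add: one_le_power)
        moreover have "kernel s z = z powr (- 1 - 2 * s)"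
          using 3 powr_minus_divide[of z "1 + 2 * s"] by (simp add: kernel_def)
        ultimately show ?thesis using 3 by (auto simp: indicator_def min_def)
      qed (auto simp: indicator_def)
    qed
  qed measurable
qed auto

lemma kernel_integrable_bound:
  assumes "0 < s" "s < 1" and [measurable]: "f \<in> borel_measurable borel"
    and "\<And>z. \<bar>f z\<bar> \<le> C * min 1 (z\<^sup>2)"
  shows "integrable lborel (\<lambda>z. f z * kernel s z)"
proof (rule Bochner_Integration.integrable_bound)
  show "integrable lborel (\<lambda>z. C * (min 1 (z\<^sup>2) * kernel s z))"
    using kernel_integrable[OF assms(1,2)] by simp
  show "AE z in lborel. norm (f z * kernel s z) \<le> norm (C * (min 1 (z\<^sup>2) * kernel s z))"
  proof (intro AE_I2)
    fix z
    have "\<bar>f z\<bar> * kernel s z \<le> C * min 1 (z\<^sup>2) * kernel s z"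
      by (intro mult_right_mono assms) simp
    also have "\<dots> \<le> \<bar>C * min 1 (z\<^sup>2) * kernel s z\<bar>" by (rule abs_ge_self)
    finally show "norm (f z * kernel s z) \<le> norm (C * (min 1 (z\<^sup>2) * kernel s z))"
      by (simp add: abs_mult mult.assoc)
  qed
qed measurable

text \<open>Off the core, min 1 (z^2) is at least min 1 (\<theta>^2), whence the constant.\<close>

lemma bound_off_core:
  fixes f :: "real \<Rightarrow> real"
  assumes "0 < \<theta>" "\<And>z. \<bar>z\<bar> < \<theta> \<Longrightarrow> f z = 0" "\<And>z. \<bar>f z\<bar> \<le> M"
  shows "\<bar>f z\<bar> \<le> (M / min 1 (\<theta>\<^sup>2)) * min 1 (z\<^sup>2)"
proof (cases "\<bar>z\<bar> < \<theta>")
  case True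
  have "0 \<le> M" using assms(3)[of z] by linarith
  then show ?thesis using assms(2)[OF True] by simp
next
  case False
  then have "\<theta>\<^sup>2 \<le> z\<^sup>2" using \<open>0 < \<theta>\<close> by (simp add: abs_le_square_iff[symmetric])
  then have "min 1 (\<theta>\<^sup>2) \<le> min 1 (z\<^sup>2)" by auto
  moreover have "0 < min 1 (\<theta>\<^sup>2)" using \<open>0 < \<theta>\<close> by simp
  moreover have "0 \<le> M" using assms(3)[of z] by linarith
  ultimately have "M * 1 \<le> M * (min 1 (z\<^sup>2) / min 1 (\<theta>\<^sup>2))" by (intro mult_left_mono) auto
  then show ?thesis using assms(3)[of z] by simp
qed

section \<open>The step function, the sawtooth and the interaction\<close>

lemma lattice_step_mono: "0 < L \<Longrightarrow> a \<le> b \<Longrightarrow> lattice_step L a \<le> lattice_step L b"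
  unfolding lattice_step_def
  by (intro divide_right_mono add_mono of_int_le_iff[THEN iffD2] floor_mono ceiling_mono) auto

lemma lattice_step_minus: "lattice_step L (- t) = - lattice_step L t"
proof -
  have "\<lfloor>- t / L\<rfloor> = - \<lceil>t / L\<rceil>" "\<lceil>- t / L\<rceil> = - \<lfloor>t / L\<rfloor>"
    by (simp_all add: floor_minus ceiling_minus)
  then show ?thesis unfolding lattice_step_def by (simp only: of_int_minus) argo
qed

lemma lattice_step_add: "0 < L \<Longrightarrow> lattice_step L (t + L) = lattice_step L t + 1"
  by (simp add: lattice_step_def add_divide_distrib)

lemma lattice_step_eq:
  assumes "0 < L" "L * of_int k < t" "t < L * (of_int k + 1)"
  shows "lattice_step L t = of_int k + 1 / 2"
proof -
  have "of_int k < t / L" "t / L < of_int k + 1" using assms by (auto simp: field_simps)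
  then have "\<lfloor>t / L\<rfloor> = k" "\<lceil>t / L\<rceil> = k + 1" by linarith+
  then show ?thesis by (simp add: lattice_step_def)
qed

lemma lattice_step_unit: "0 < t \<Longrightarrow> t < L \<Longrightarrow> lattice_step L t = 1 / 2"
  using lattice_step_eq[of L 0 t] by simp

lemma sawtooth_minus: "sawtooth L (- t) = - sawtooth L t"
  by (simp add: sawtooth_def lattice_step_minus)

lemma sawtooth_add_period: "0 < L \<Longrightarrow> sawtooth L (t + L) = sawtooth L t"
  by (simp add: sawtooth_def lattice_step_add add_divide_distrib)

lemma sawtooth_abs_le: "\<bar>sawtooth L t\<bar> \<le> 1 / 2"
proof -
  have "of_int \<lfloor>t / L\<rfloor> \<le> t / L" "t / L < of_int \<lfloor>t / L\<rfloor> + 1" "t / L \<le> of_int \<lceil>t / L\<rceil>" "of_int \<lceil>t / L\<rceil> < t / L + 1"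
    by linarith+
  moreover have "\<lceil>t / L\<rceil> \<le> \<lfloor>t / L\<rfloor> + 1" by linarith
  then have "real_of_int \<lceil>t / L\<rceil> \<le> of_int \<lfloor>t / L\<rfloor> + 1" by linarith
  moreover have "\<bar>x - (f + c) / 2\<bar> \<le> 1 / 2" if "f \<le> x" "x \<le> c" "c \<le> f + 1" for x f c :: real
    using that by (simp add: abs_le_iff field_simps)
  ultimately show ?thesis unfolding sawtooth_def lattice_step_def by blast
qed

text \<open>The linear part has no second difference. What remains is built from a nondecreasing
  step function, from which the repulsion is read off.\<close>

lemma second_diff_sawtooth:
  "second_diff (sawtooth L) t z = lattice_step L (t + z) + lattice_step L (t - z) - 2 * lattice_step L t"
  by (simp add: second_diff_def sawtooth_def add_divide_distrib diff_divide_distrib)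

lemma second_diff_sawtooth_abs_le: "\<bar>second_diff (sawtooth L) t z\<bar> \<le> 2"
  using sawtooth_abs_le[of L t] sawtooth_abs_le[of L "t + z"] sawtooth_abs_le[of L "t - z"]
  unfolding second_diff_def by linarith

lemma second_diff_sawtooth_eq_0:
  assumes "\<theta> \<le> t" "t \<le> L - \<theta>" "\<bar>z\<bar> < \<theta>"
  shows "second_diff (sawtooth L) t z = 0"
proof -
  have "lattice_step L (t + z) = 1 / 2" "lattice_step L (t - z) = 1 / 2" "lattice_step L t = 1 / 2"
    by (rule lattice_step_unit; use assms in linarith)+
  then show ?thesis by (simp add: second_diff_sawtooth)
qed

lemma second_diff_sawtooth_bound:
  assumes "0 < \<theta>" "\<theta> \<le> t" "t \<le> L - \<theta>"
  shows "\<bar>second_diff (sawtooth L) t z\<bar> \<le> (2 / min 1 (\<theta>\<^sup>2)) * min 1 (z\<^sup>2)"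
  by (rule bound_off_core[OF \<open>0 < \<theta>\<close>])
    (use assms second_diff_sawtooth_eq_0 second_diff_sawtooth_abs_le in auto)

lemma interaction_integrable:
  assumes "0 < s" "s < 1" "0 < t" "t < L"
  shows "integrable lborel (\<lambda>z. second_diff (sawtooth L) t z * kernel s z)"
  by (rule kernel_integrable_bound[OF assms(1,2) _ second_diff_sawtooth_bound[of "min t (L - t)"]])
    (use assms in auto)

lemma interaction_measurable [measurable]: "interaction L s \<in> borel_measurable borel"
  unfolding interaction_def[abs_def] by measurable

lemma interaction_minus: "interaction L s (- t) = - interaction L s t"
proof -
  have "second_diff (sawtooth L) (- t) z = - second_diff (sawtooth L) t z" for z
    using sawtooth_minus[of L t] sawtooth_minus[of L "t + z"] sawtooth_minus[of L "t - z"]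
    by (simp add: second_diff_def)
  then show ?thesis by (simp add: interaction_def)
qed

lemma interaction_add_period:
  assumes "0 < L"
  shows "interaction L s (t + L) = interaction L s t"
proof -
  have "second_diff (sawtooth L) (t + L) z = second_diff (sawtooth L) t z" for z
    using sawtooth_add_period[OF assms, of t] sawtooth_add_period[OF assms, of "t + z"]
      sawtooth_add_period[OF assms, of "t - z"]
    by (simp add: second_diff_def algebra_simps)
  then show ?thesis by (simp add: interaction_def)
qed

text \<open>The values of \<open>lattice_step\<close> at a and b are both 1 / 2 and cancel; the
  shifted values contribute nonnegative increments. For z in (L - a, L - b), an interval of length a
  - b, the point a + z has passed the jump at L and b + z has not, so the increment is at least 1,
  and the kernel is at least L powr (- 1 - 2 * s) because 0 < z < L.\<close>

lemma interaction_strongly_mono: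
  assumes "0 < s" "s < 1" "0 < b" "b \<le> a" "a < L"
  shows "L powr (- 1 - 2 * s) * (a - b) \<le> interaction L s a - interaction L s b"
proof -
  let ?D = "\<lambda>t z. second_diff (sawtooth L) t z"
  have "(a - b) * L powr (- 1 - 2 * s) = (LINT z|lborel. indicator {L - a<..<L - b} z * L powr (- 1 - 2 * s))"
    using assms by simp
  also have "\<dots> \<le> (LINT z|lborel. ?D a z * kernel s z - ?D b z * kernel s z)"
  proof (rule integral_mono)
    show "integrable lborel (\<lambda>z. indicator {L - a<..<L - b} z * L powr (- 1 - 2 * s))"
      by (intro integrable_mult_left integrable_real_indicator) (use assms in auto)
    show "integrable lborel (\<lambda>z. ?D a z * kernel s z - ?D b z * kernel s z)"
      using assms by (intro Bochner_Integration.integrable_diff interaction_integrable) auto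
    fix z
    have eq: "?D a z - ?D b z = (lattice_step L (a + z) - lattice_step L (b + z)) + (lattice_step L (a - z) - lattice_step L (b - z))"
      using assms by (simp add: second_diff_sawtooth lattice_step_unit)
    have m: "lattice_step L (b + z) \<le> lattice_step L (a + z)" "lattice_step L (b - z) \<le> lattice_step L (a - z)"
      using assms by (auto intro!: lattice_step_mono)
    show "indicator {L - a<..<L - b} z * L powr (- 1 - 2 * s) \<le> ?D a z * kernel s z - ?D b z * kernel s z"
    proof (cases "z \<in> {L - a<..<L - b}")
      case True
      then have z: "0 < z" "z < L" using assms by auto
      have "lattice_step L (b + z) = 1 / 2" using True assms z by (intro lattice_step_unit) auto
      moreover have "lattice_step L (a + z) = 1 + 1 / 2"
        using lattice_step_eq[of L 1 "a + z"] True assms z by auto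
      ultimately have "1 \<le> ?D a z - ?D b z" using eq m by linarith
      then have "1 * kernel s z \<le> (?D a z - ?D b z) * kernel s z" by (intro mult_right_mono) auto
      moreover have "L powr (- 1 - 2 * s) \<le> kernel s z"
      proof -
        have "z powr (1 + 2 * s) \<le> L powr (1 + 2 * s)" using z assms by (intro powr_mono2) auto
        then have "1 / L powr (1 + 2 * s) \<le> 1 / z powr (1 + 2 * s)"
          using z by (intro divide_left_mono) auto
        then show ?thesis using z powr_minus_divide[of L "1 + 2 * s"] by (simp add: kernel_def)
      qed
      ultimately show ?thesis using True by (simp add: left_diff_distrib)
    next
      case False
      have "0 \<le> (?D a z - ?D b z) * kernel s z" using eq m by (intro mult_nonneg_nonneg) auto
      then show ?thesis using False by (simp add: left_diff_distrib)
    qed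
  qed
  also have "\<dots> = interaction L s a - interaction L s b"
    unfolding interaction_def using assms
    by (intro Bochner_Integration.integral_diff interaction_integrable) auto
  finally show ?thesis by (simp add: mult.commute)
qed

lemma isCont_lattice_step:
  assumes "0 < L" "t \<notin> range (\<lambda>k. L * of_int k)"
  shows "isCont (lattice_step L) t"
proof -
  define k where "k = \<lfloor>t / L\<rfloor>"
  have "of_int k \<le> t / L" "t / L < of_int k + 1" by (auto simp: k_def)
  moreover have "t \<noteq> L * of_int k" using assms by auto
  ultimately have t: "t \<in> {L * of_int k<..<L * (of_int k + 1)}" using assms by (auto simp: field_simps)
  have "\<forall>\<^sub>F x in nhds t. lattice_step L x = of_int k + 1 / 2"
    using eventually_nhds_in_open[OF open_greaterThanLessThan t]
    by eventually_elim (auto intro: lattice_step_eq[OF \<open>0 < L\<close>])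
  then show ?thesis by (simp add: isCont_cong)
qed

lemma isCont_sawtooth:
  assumes "0 < L" "t \<notin> range (\<lambda>k. L * of_int k)"
  shows "isCont (sawtooth L) t"
  unfolding sawtooth_def[abs_def] using isCont_lattice_step[OF assms] assms by (intro continuous_intros) auto

lemma AE_off_lattice: "AE z in lborel. t + z \<notin> range (\<lambda>k. L * of_int k) \<and> t - z \<notin> range (\<lambda>k. L * real_of_int k)"
proof -
  let ?A = "\<Union>k. {L * real_of_int k - t, t - L * of_int k}"
  have "countable ?A" by auto
  then have "AE z in lborel. z \<notin> ?A"
    by (intro AE_not_in countable_imp_null_set_lborel)
  then show ?thesis
  proof eventually_elim
    case (elim z)
    have "t + z \<noteq> L * real_of_int k \<and> t - z \<noteq> L * real_of_int k" for k
    proof -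
      have "z \<noteq> L * real_of_int k - t" "z \<noteq> t - L * real_of_int k" using elim by auto
      then show ?thesis by auto
    qed
    then show ?case by blast
  qed
qed

text \<open>Continuity in t is asked for almost every z at each fixed t, with an exceptional set
  that may depend on t: the jumps of the shifted sawtooths move with t.\<close>

lemma continuous_on_integral_dominated:
  fixes f :: "real \<Rightarrow> real \<Rightarrow> real"
  assumes "\<And>t. t \<in> U \<Longrightarrow> f t \<in> borel_measurable M" "integrable M w"
    and "\<And>t. t \<in> U \<Longrightarrow> AE z in M. isCont (\<lambda>t. f t z) t"
    and "\<And>t. t \<in> U \<Longrightarrow> AE z in M. \<bar>f t z\<bar> \<le> w z"
  shows "continuous_on U (\<lambda>t. LINT z|M. f t z)"
proof (rule continuous_on_sequentiallyI)
  fix u a assume u: "\<forall>n. u n \<in> U" "a \<in> U" "u \<longlonglongrightarrow> a"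
  show "(\<lambda>n. LINT z|M. f (u n) z) \<longlonglongrightarrow> (LINT z|M. f a z)"
  proof (rule integral_dominated_convergence[where w=w])
    show "AE z in M. (\<lambda>n. f (u n) z) \<longlonglongrightarrow> f a z"
      using assms(3)[OF u(2)] by eventually_elim (rule isCont_tendsto_compose[OF _ u(3), where g="\<lambda>t. f t z" for z])
  qed (use u assms in auto)
qed

lemma continuous_on_interaction:
  assumes "0 < s" "s < 1"
  shows "continuous_on {0<..<L} (interaction L s)"
proof -
  have "isCont (interaction L s) t" if t: "t \<in> {0<..<L}" for t
  proof -
    \<comment> \<open>Half the distance to the ends of the cell, so that t is interior to the
      interval on which one majorant serves all r.\<close>
    define \<theta> where "\<theta> = min t (L - t) / 2"
    have \<theta>: "0 < \<theta>" "\<theta> < t" "t < L - \<theta>" using t by (auto simp: \<theta>_def min_def field_simps)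
    let ?C = "2 / min 1 (\<theta>\<^sup>2)"
    have "continuous_on {\<theta><..<L - \<theta>} (interaction L s)"
      unfolding interaction_def[abs_def]
    proof (rule continuous_on_integral_dominated[where w="\<lambda>z. ?C * (min 1 (z\<^sup>2) * kernel s z)"])
      show "integrable lborel (\<lambda>z. ?C * (min 1 (z\<^sup>2) * kernel s z))"
        using kernel_integrable[OF assms] by (rule integrable_mult_right)
      fix r assume r: "r \<in> {\<theta><..<L - \<theta>}"
      show "AE z in lborel. isCont (\<lambda>r. second_diff (sawtooth L) r z * kernel s z) r"
        using AE_off_lattice[of r L]
      proof eventually_elim
        case (elim z)
        have L: "0 < L" using \<theta> by linarith
        have "r \<notin> range (\<lambda>k. L * of_int k)"
        proof
          assume "r \<in> range (\<lambda>k. L * of_int k)"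
          then obtain k where k: "r = L * of_int k" by auto
          then have "0 < L * real_of_int k" "L * real_of_int k < L"
            using r \<theta>(1) unfolding greaterThanLessThan_iff by linarith+
          then have "L * 0 < L * real_of_int k" "L * real_of_int k < L * 1"
            by (simp_all only: mult_zero_right mult_1_right)
          then have "0 < real_of_int k" "real_of_int k < 1"
            using mult_less_cancel_left_pos[OF L] by blast+
          then have "0 < k" "k < 1" by simp_all
          then show False by simp
        qed
        then have "isCont (sawtooth L) r" "isCont (sawtooth L) (r + z)" "isCont (sawtooth L) (r - z)"
          using elim L by (auto intro!: isCont_sawtooth)
        moreover from this have "isCont (\<lambda>r. sawtooth L (r + z)) r" "isCont (\<lambda>r. sawtooth L (r - z)) r"
          by (auto intro: isCont_o2[where f="\<lambda>r. r + z"] isCont_o2[where f="\<lambda>r. r - z"])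
        ultimately show ?case unfolding second_diff_def
          by (intro continuous_intros)
      qed
      show "AE z in lborel. \<bar>second_diff (sawtooth L) r z * kernel s z\<bar> \<le> ?C * (min 1 (z\<^sup>2) * kernel s z)"
      proof (rule AE_I2)
        fix z
        have "\<bar>second_diff (sawtooth L) r z\<bar> * kernel s z \<le> ?C * min 1 (z\<^sup>2) * kernel s z"
          using r by (intro mult_right_mono second_diff_sawtooth_bound[OF \<theta>(1)]) auto
        then show "\<bar>second_diff (sawtooth L) r z * kernel s z\<bar> \<le> ?C * (min 1 (z\<^sup>2) * kernel s z)"
          by (simp only: abs_mult abs_of_nonneg[OF kernel_nonneg] mult.assoc)
      qed
    qed measurable
    then show ?thesis using \<theta> by (auto simp: continuous_on_eq_continuous_at)
  qed
  then show ?thesis by (simp add: continuous_at_imp_continuous_on)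
qed

section \<open>The potential of a configuration\<close>

text \<open>CARD('n) sawtooths of slope 1 / CARD('n) add up to slope 1, the Lebesgue part of the
  prescribed derivative, and each drops by 1 at its own particle.\<close>

definition config_sawtooth :: "real ^ 'n::finite \<Rightarrow> real \<Rightarrow> real" where
  "config_sawtooth X x = (\<Sum>i\<in>UNIV. sawtooth (real CARD('n)) (x - X $ i))"

lemma config_sawtooth_measurable [measurable]: "config_sawtooth X \<in> borel_measurable borel"
  unfolding config_sawtooth_def[abs_def] by measurable

lemma config_sawtooth_abs_le:
  fixes X :: "real ^ 'n::finite"
  shows "\<bar>config_sawtooth X x\<bar> \<le> real CARD('n) / 2"
  unfolding config_sawtooth_def
  using sum_mono[of UNIV "\<lambda>i. \<bar>sawtooth (real CARD('n)) (x - X $ i)\<bar>" "\<lambda>_. 1 / 2"] sawtooth_abs_le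
  by (intro order_trans[OF sum_abs]) auto

section \<open>Smooth functions and test functions\<close>

lemma smooth_differentiable: "smooth f \<Longrightarrow> (f has_real_derivative deriv f x) (at x)"
  unfolding smooth_def
  by (drule spec[of _ 0]) (auto simp: differentiable_on_def field_differentiable_derivI real_differentiable_def field_differentiable_def)

lemma smooth_deriv: "smooth f \<Longrightarrow> smooth (deriv f)"
  unfolding smooth_def by (metis funpow_swap1 funpow.simps(2) comp_apply)

lemma smooth_isCont: "smooth f \<Longrightarrow> isCont f x"
  using smooth_differentiable DERIV_isCont by blast

lemma smooth_measurable: "smooth f \<Longrightarrow> f \<in> borel_measurable borel"
  by (intro borel_measurable_continuous_onI continuous_at_imp_continuous_on ballI smooth_isCont)

lemma smooth_antiderivative:
  assumes "\<And>x. (F has_real_derivative f x) (at x)" "smooth f"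
  shows "smooth F"
  unfolding smooth_def
proof
  fix n
  have [simp]: "deriv F = f" using assms(1) DERIV_imp_deriv by blast
  show "(deriv ^^ n) F differentiable_on UNIV"
  proof (cases n)
    case 0
    then show ?thesis using assms(1) by (auto simp: differentiable_on_def real_differentiable_def)
  next
    case (Suc m)
    then have "(deriv ^^ n) F = (deriv ^^ m) f" by (simp add: funpow_swap1)
    then show ?thesis using assms(2) by (simp add: smooth_def)
  qed
qed

lemma smooth_nth_deriv:
  assumes "smooth f"
  shows "((deriv ^^ n) f has_real_derivative (deriv ^^ Suc n) f x) (at x)"
  using assms by (auto simp: smooth_def differentiable_on_def real_differentiable_def field_differentiable_def intro!: field_differentiable_derivI)

lemma smooth_sequenceI:
  assumes der: "\<And>n x. (F n has_real_derivative F (Suc n) x) (at x)"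
  shows "smooth (F 0)"
proof -
  have "(deriv ^^ n) (F 0) = F n" for n
  proof (induction n)
    case (Suc n)
    have "deriv (F n) = F (Suc n)" using DERIV_imp_deriv[OF der] by blast
    then show ?case by (simp add: Suc)
  qed simp
  then show ?thesis
    using der by (auto simp: smooth_def differentiable_on_def real_differentiable_def)
qed

lemma smooth_linear_combination:
  assumes "smooth f" "smooth g"
  shows "smooth (\<lambda>x. a * f (c * x + d) + b * g x)"
proof -
  have "((\<lambda>x. a * c ^ n * (deriv ^^ n) f (c * x + d) + b * (deriv ^^ n) g x) has_real_derivative
      a * c ^ Suc n * (deriv ^^ Suc n) f (c * x + d) + b * (deriv ^^ Suc n) g x) (at x)" for n x
  proof -
    have "((\<lambda>x. (deriv ^^ n) f (c * x + d)) has_real_derivative (deriv ^^ Suc n) f (c * x + d) * c) (at x)"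
      by (rule DERIV_chain2[where g="\<lambda>x. c * x + d", OF smooth_nth_deriv[OF assms(1)]]) (auto intro!: derivative_eq_intros)
    from DERIV_add[OF DERIV_cmult[OF this, of "a * c ^ n"] DERIV_cmult[OF smooth_nth_deriv[OF assms(2)], of b n x]]
    show ?thesis by (simp only: power_Suc mult_ac)
  qed
  from smooth_sequenceI[of "\<lambda>n x. a * c ^ n * (deriv ^^ n) f (c * x + d) + b * (deriv ^^ n) g x", OF this]
  show ?thesis by simp
qed

lemma set_integral_eq_of_vanishing:
  fixes f :: "real \<Rightarrow> real"
  assumes "\<And>x. x \<notin> A \<Longrightarrow> f x = 0"
  shows "(LINT x|lborel. f x) = (LINT x|lborel. indicator A x *\<^sub>R f x)"
  by (rule Bochner_Integration.integral_cong) (use assms in \<open>auto simp: indicator_def\<close>)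

lemma test_function_bound:
  assumes "test_function \<phi>"
  obtains R where "0 < R" "\<And>x. R \<le> \<bar>x\<bar> \<Longrightarrow> \<phi> x = 0" "\<And>x. R \<le> \<bar>x\<bar> \<Longrightarrow> deriv \<phi> x = 0"
proof -
  from assms obtain R where R: "\<And>x. R < \<bar>x\<bar> \<Longrightarrow> \<phi> x = 0" by (auto simp: test_function_def)
  have "deriv \<phi> x = 0" if "\<bar>R\<bar> < \<bar>x\<bar>" for x
  proof -
    have "open {y::real. \<bar>R\<bar> < \<bar>y\<bar>}" by (intro open_Collect_less continuous_intros)
    then have "\<forall>\<^sub>F y in nhds x. \<bar>R\<bar> < \<bar>y\<bar>" using that eventually_nhds_in_open by fastforce
    then have "\<forall>\<^sub>F y in nhds x. \<phi> y = 0" by eventually_elim (use R in auto)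
    then have "(\<phi> has_real_derivative 0) (at x) \<longleftrightarrow> ((\<lambda>_. 0) has_real_derivative 0) (at x)"
      by (intro DERIV_cong_ev) auto
    then show ?thesis by (simp add: DERIV_imp_deriv)
  qed
  \<comment> \<open>The derivative is known to vanish only strictly beyond |R|, and the radius has
    to be positive; adding 1 settles both.\<close>
  then show ?thesis using that[of "\<bar>R\<bar> + 1"] R by force
qed

text \<open>On a bounded window the sawtooth is a combination of 1, x and Heaviside functions. These
  are the corresponding integrations by parts.\<close>

lemma test_function_integrals:
  assumes \<phi>: "test_function \<phi>" and R: "0 < R" "\<And>x. R \<le> \<bar>x\<bar> \<Longrightarrow> \<phi> x = 0" "\<And>x. R \<le> \<bar>x\<bar> \<Longrightarrow> deriv \<phi> x = 0"
  shows "integrable lborel \<phi>" "integrable lborel (deriv \<phi>)" "integrable lborel (\<lambda>x. x * deriv \<phi> x)"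
    and "(LINT x|lborel. deriv \<phi> x) = 0"
    and "(LINT x|lborel. x * deriv \<phi> x) = - (LINT x|lborel. \<phi> x)"
    and "integrable lborel (\<lambda>x. indicator {c..} x * deriv \<phi> x)"
    and "(LINT x|lborel. indicator {c..} x * deriv \<phi> x) = - \<phi> c"
proof -
  have sm: "smooth \<phi>" using \<phi> by (simp add: test_function_def)
  have der: "(\<phi> has_real_derivative deriv \<phi> x) (at x)" for x by (rule smooth_differentiable[OF sm])
  have c\<phi>: "continuous_on S \<phi>" and c\<phi>': "continuous_on S (deriv \<phi>)" for S
    using sm smooth_deriv[OF sm] by (auto intro: continuous_at_imp_continuous_on smooth_isCont)
  have out: "\<phi> x = 0" "deriv \<phi> x = 0" if "x \<notin> {- R..R}" for x using R that by auto
  have int: "integrable lborel f" if "continuous_on {- R..R} f" "\<And>x. x \<notin> {- R..R} \<Longrightarrow> f x = 0" for f :: "real \<Rightarrow> real"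
  proof -
    have "integrable lborel (\<lambda>x. indicator {- R..R} x *\<^sub>R f x)"
      using borel_integrable_atLeastAtMost'[OF that(1)] by (simp add: set_integrable_def)
    also have "(\<lambda>x. indicator {- R..R} x *\<^sub>R f x) = f" using that(2) by (auto simp: fun_eq_iff indicator_def)
    finally show ?thesis .
  qed
  show i1: "integrable lborel \<phi>" and i2: "integrable lborel (deriv \<phi>)" and i3: "integrable lborel (\<lambda>x. x * deriv \<phi> x)"
    using out by (intro int continuous_intros c\<phi> c\<phi>'; simp)+
  have ftc: "(LINT x|lborel. f x) = F b - F a"
    if "a \<le> b" "\<And>x. (F has_real_derivative f x) (at x)" "continuous_on {a..b} f" "\<And>x. x \<notin> {a..b} \<Longrightarrow> f x = 0" for a b f F
    using integral_FTC_atLeastAtMost[OF that(1) has_vector_derivative_at_within that(3), of F] that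
      set_integral_eq_of_vanishing[of "{a..b}" f]
    by (simp add: has_real_derivative_iff_has_vector_derivative)
  show "(LINT x|lborel. deriv \<phi> x) = 0"
    using ftc[of "- R" R, OF _ der c\<phi>'] R out by auto
  have "(LINT x|lborel. \<phi> x + x * deriv \<phi> x) = R * \<phi> R - (- R) * \<phi> (- R)"
    by (rule ftc) (use R out in \<open>auto intro!: derivative_eq_intros der continuous_intros c\<phi> c\<phi>'\<close>)
  then show "(LINT x|lborel. x * deriv \<phi> x) = - (LINT x|lborel. \<phi> x)"
    using R i1 i3 by simp
  have "integrable lborel (\<lambda>x. indicator {c..} x *\<^sub>R deriv \<phi> x)"
    using i2 by (intro integrable_mult_indicator) auto
  then show "integrable lborel (\<lambda>x. indicator {c..} x * deriv \<phi> x)" by simp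
  define b where "b = max c R"
  have "(LINT x|lborel. indicator {c..} x * deriv \<phi> x) = (LINT x|lborel. indicator {c..b} x *\<^sub>R deriv \<phi> x)"
    by (rule Bochner_Integration.integral_cong) (use R out in \<open>auto simp: indicator_def b_def\<close>)
  also have "\<dots> = \<phi> b - \<phi> c"
    by (rule integral_FTC_atLeastAtMost)
      (use der c\<phi>' in \<open>auto simp: b_def has_real_derivative_iff_has_vector_derivative intro: has_vector_derivative_at_within\<close>)
  also have "\<phi> b = 0" using R by (simp add: b_def)
  finally show "(LINT x|lborel. indicator {c..} x * deriv \<phi> x) = - \<phi> c" by simp
qed

text \<open>A test function sees only a bounded window, where the floor is a finite sum of Heaviside
  functions, each of which contributes one Dirac mass.\<close>

lemma floor_eq_sum_indicator:
  fixes y :: real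
  assumes "- real K < y" "y < real K"
  shows "real_of_int \<lfloor>y\<rfloor> = - real K + (\<Sum>k\<in>{- int K<..int K}. indicator {of_int k..} y)"
proof -
  have "(\<Sum>k\<in>{- int K<..int K}. indicator {of_int k..} y) = (\<Sum>k\<in>{- int K<..int K}. if k \<in> {k. k \<le> \<lfloor>y\<rfloor>} then 1 else (0::real))"
    by (intro sum.cong) (auto simp: indicator_def le_floor_iff)
  also have "\<dots> = (\<Sum>k\<in>{- int K<..int K} \<inter> {k. k \<le> \<lfloor>y\<rfloor>}. 1::real)"
    by (rule sum.inter_restrict[symmetric]) simp
  also have "{- int K<..int K} \<inter> {k. k \<le> \<lfloor>y\<rfloor>} = {- int K<..\<lfloor>y\<rfloor>}"
    using assms by (auto simp: floor_le_iff) linarith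
  also have "(\<Sum>k\<in>{- int K<..\<lfloor>y\<rfloor>}. 1::real) = of_int (\<lfloor>y\<rfloor> + int K)"
  proof -
    have "- int K \<le> \<lfloor>y\<rfloor>" using assms by (simp add: le_floor_iff)
    then show ?thesis by simp
  qed
  finally show ?thesis by simp
qed

lemma sawtooth_AE:
  assumes "L \<noteq> 0"
  shows "AE x in lborel. sawtooth L (x - a) = (x - a) / L - \<lfloor>(x - a) / L\<rfloor> - 1 / 2"
  using AE_off_lattice[of "- a" L]
proof eventually_elim
  case (elim x)
  have "(x - a) / L \<notin> \<int>"
  proof
    assume "(x - a) / L \<in> \<int>"
    then obtain k where "(x - a) / L = of_int k" by (auto elim: Ints_cases)
    then have "- a + x = L * of_int k" using assms by (simp add: field_simps)
    then show False using elim by blast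
  qed
  then have "\<lceil>(x - a) / L\<rceil> = \<lfloor>(x - a) / L\<rfloor> + 1" by (simp add: ceiling_altdef) (metis Ints_of_int)
  then have "(real_of_int \<lfloor>(x - a) / L\<rfloor> + real_of_int \<lceil>(x - a) / L\<rceil>) / 2 = \<lfloor>(x - a) / L\<rfloor> + 1 / 2"
    by simp
  then show ?case by (simp only: sawtooth_def lattice_step_def)
qed

text \<open>The weak form of S' = 1 / L minus the Dirac masses on the shifted lattice. K counts
  enough periods to cover the support of \<phi>.\<close>

lemma integral_sawtooth_deriv:
  assumes "0 < L" and \<phi>: "test_function \<phi>"
    and R: "0 < R" "\<And>x. R \<le> \<bar>x\<bar> \<Longrightarrow> \<phi> x = 0" "\<And>x. R \<le> \<bar>x\<bar> \<Longrightarrow> deriv \<phi> x = 0"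
    and K: "R + \<bar>a\<bar> < L * real K"
  shows "integrable lborel (\<lambda>x. sawtooth L (x - a) * deriv \<phi> x)"
    and "(LINT x|lborel. sawtooth L (x - a) * deriv \<phi> x) =
      - (1 / L) * (LINT x|lborel. \<phi> x) + (\<Sum>k\<in>{- int K<..int K}. \<phi> (a + L * of_int k))"
proof -
  note I = test_function_integrals[OF \<phi> R]
  have [measurable]: "deriv \<phi> \<in> borel_measurable borel"
    using borel_measurable_integrable[OF I(2)] by simp
  \<comment> \<open>Collects the constants of the sawtooth: the shift by a, the K from
    \<open>floor_eq_sum_indicator\<close>, and the half that comes from averaging floor and
    ceiling.\<close>
  define c where "c = - a / L + real K - 1 / 2"
  define g where "g x = (1 / L) * (x * deriv \<phi> x) + c * deriv \<phi> x
      - (\<Sum>k\<in>{- int K<..int K}. indicator {a + L * of_int k..} x * deriv \<phi> x)" for x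
  have g: "integrable lborel g"
    unfolding g_def by (intro Bochner_Integration.integrable_add Bochner_Integration.integrable_diff
        Bochner_Integration.integrable_sum integrable_mult_right I)
  have AE: "AE x in lborel. sawtooth L (x - a) * deriv \<phi> x = g x"
    using sawtooth_AE[OF less_imp_neq[OF \<open>0 < L\<close>, symmetric], of a]
  proof eventually_elim
    case (elim x)
    show ?case
    proof (cases "R \<le> \<bar>x\<bar>")
      case True
      then show ?thesis using R(3) by (simp add: g_def)
    next
      case False
      have "- (L * real K) < x - a" "x - a < L * real K" using K False by auto
      then have "- real K < (x - a) / L" "(x - a) / L < real K" using \<open>0 < L\<close> by (auto simp: field_simps)
      from floor_eq_sum_indicator[OF this]
      have "real_of_int \<lfloor>(x - a) / L\<rfloor> = - real K + (\<Sum>k\<in>{- int K<..int K}. indicator {of_int k..} ((x - a) / L))" .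
      also have "(\<Sum>k\<in>{- int K<..int K}. indicator {of_int k..} ((x - a) / L)) = (\<Sum>k\<in>{- int K<..int K}. indicator {a + L * of_int k..} x :: real)"
        using \<open>0 < L\<close> by (intro sum.cong) (auto simp: indicator_def field_simps)
      finally have fl: "real_of_int \<lfloor>(x - a) / L\<rfloor> = - real K + (\<Sum>k\<in>{- int K<..int K}. indicator {a + L * of_int k..} x)" .
      have "sawtooth L (x - a) = x / L + c - (\<Sum>k\<in>{- int K<..int K}. indicator {a + L * of_int k..} x)"
        using elim \<open>0 < L\<close> unfolding fl by (simp add: c_def diff_divide_distrib)
      then show ?thesis by (simp only: g_def sum_distrib_right[symmetric]) (simp add: algebra_simps)
    qed
  qed
  show "integrable lborel (\<lambda>x. sawtooth L (x - a) * deriv \<phi> x)"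
    using AE by (subst integrable_cong_AE[OF _ borel_measurable_integrable[OF g]]) (auto intro: g)
  have "(LINT x|lborel. sawtooth L (x - a) * deriv \<phi> x) = (LINT x|lborel. g x)"
    using AE by (intro integral_cong_AE borel_measurable_integrable[OF g]) auto
  also have "\<dots> = (LINT x|lborel. (1 / L) * (x * deriv \<phi> x) + c * deriv \<phi> x)
      - (LINT x|lborel. (\<Sum>k\<in>{- int K<..int K}. indicator {a + L * of_int k..} x * deriv \<phi> x))"
    unfolding g_def by (intro Bochner_Integration.integral_diff Bochner_Integration.integrable_add
        Bochner_Integration.integrable_sum integrable_mult_right I)
  also have "(LINT x|lborel. (1 / L) * (x * deriv \<phi> x) + c * deriv \<phi> x) =
      (LINT x|lborel. (1 / L) * (x * deriv \<phi> x)) + (LINT x|lborel. c * deriv \<phi> x)"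
    by (intro Bochner_Integration.integral_add integrable_mult_right I)
  also have "(LINT x|lborel. (\<Sum>k\<in>{- int K<..int K}. indicator {a + L * of_int k..} x * deriv \<phi> x)) =
      (\<Sum>k\<in>{- int K<..int K}. - \<phi> (a + L * of_int k))"
    by (subst Bochner_Integration.integral_sum) (simp_all only: I)
  finally show "(LINT x|lborel. sawtooth L (x - a) * deriv \<phi> x) =
      - (1 / L) * (LINT x|lborel. \<phi> x) + (\<Sum>k\<in>{- int K<..int K}. \<phi> (a + L * of_int k))"
    using I by (simp add: sum_negf)
qed

text \<open>Also shows that a potential exists, so that the choice in \<open>potential\<close>
  really picks one.\<close>

lemma is_potential_config_sawtooth:
  fixes X :: "real ^ 'n::finite"
  shows "is_potential X (config_sawtooth X)"
  unfolding is_potential_def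
proof (intro conjI allI impI)
  fix a b
  have "integrable lborel (\<lambda>x. indicator {a..b} x *\<^sub>R config_sawtooth X x)"
    by (intro integrableI_bounded_set_indicator[where B="real CARD('n) / 2"]) (use config_sawtooth_abs_le in \<open>auto simp: emeasure_lborel_Icc_eq\<close>)
  then show "set_integrable lborel {a..b} (config_sawtooth X)" by (simp add: set_integrable_def)
next
  fix \<phi> assume \<phi>: "test_function \<phi>"
  define L where "L = real CARD('n)"
  have L: "0 < L" by (simp add: L_def)
  obtain R where R: "0 < R" "\<And>x. R \<le> \<bar>x\<bar> \<Longrightarrow> \<phi> x = 0" "\<And>x. R \<le> \<bar>x\<bar> \<Longrightarrow> deriv \<phi> x = 0"
    using test_function_bound[OF \<phi>] by metis
  obtain K where K: "(R + (\<Sum>i\<in>UNIV. \<bar>X $ i\<bar>)) / L < real K" using reals_Archimedean2 by blast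
  have Ki: "R + \<bar>X $ i\<bar> < L * real K" for i
  proof -
    have "\<bar>X $ i\<bar> \<le> (\<Sum>i\<in>UNIV. \<bar>X $ i\<bar>)" by (rule member_le_sum) auto
    then show ?thesis using K L by (simp add: field_simps)
  qed
  have [measurable]: "\<phi> \<in> borel_measurable borel" using \<phi> by (intro smooth_measurable) (simp add: test_function_def)
  have zero: "\<phi> (X $ i + L * of_int k) = 0" if "k \<notin> {- int K<..int K}" for i k
  proof -
    have "k \<le> - int K \<or> int K \<le> k" using that by auto
    then have "int K \<le> \<bar>k\<bar>" by auto
    then have "real_of_int (int K) \<le> real_of_int \<bar>k\<bar>" by (simp only: of_int_le_iff)
    then have "real K \<le> \<bar>real_of_int k\<bar>" by simp
    then have "L * real K \<le> \<bar>L * of_int k\<bar>" using L by (simp add: abs_mult)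
    then have "R \<le> \<bar>X $ i + L * of_int k\<bar>" using Ki[of i] by linarith
    then show ?thesis by (rule R(2))
  qed
  have "(LINT x|config_measure X. \<phi> x) = (LINT p|count_space UNIV. \<phi> (X $ fst p + L * of_int (snd p)))"
    unfolding config_measure_def by (subst integral_distr) (auto simp: L_def case_prod_beta)
  also have "\<dots> = (\<Sum>p\<in>UNIV \<times> {- int K<..int K}. \<phi> (X $ fst p + L * of_int (snd p)))"
  proof (subst lebesgue_integral_count_space_finite_support)
    have sub: "{p \<in> UNIV. \<phi> (X $ fst p + L * of_int (snd p)) \<noteq> 0} \<subseteq> UNIV \<times> {- int K<..int K}"
      using zero by fastforce
    then show "finite {p \<in> UNIV. \<phi> (X $ fst p + L * of_int (snd p)) \<noteq> 0}" by (rule finite_subset) simp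
    show "(\<Sum>p | p \<in> UNIV \<and> \<phi> (X $ fst p + L * of_int (snd p)) \<noteq> 0. \<phi> (X $ fst p + L * of_int (snd p))) =
        (\<Sum>p\<in>UNIV \<times> {- int K<..int K}. \<phi> (X $ fst p + L * of_int (snd p)))"
      using sub by (intro sum.mono_neutral_left) auto
  qed
  also have "\<dots> = (\<Sum>i\<in>UNIV. \<Sum>k\<in>{- int K<..int K}. \<phi> (X $ i + L * of_int k))"
    by (simp add: sum.cartesian_product case_prod_beta)
  finally have mu: "(LINT x|config_measure X. \<phi> x) = \<dots>" .
  have "(LINT x|lborel. config_sawtooth X x * deriv \<phi> x) = (\<Sum>i\<in>UNIV. LINT x|lborel. sawtooth L (x - X $ i) * deriv \<phi> x)"
    unfolding config_sawtooth_def sum_distrib_right L_def[symmetric]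
    by (rule Bochner_Integration.integral_sum) (rule integral_sawtooth_deriv(1)[OF L \<phi> R Ki])
  also have "\<dots> = (\<Sum>i\<in>UNIV. - (1 / L) * (LINT x|lborel. \<phi> x) + (\<Sum>k\<in>{- int K<..int K}. \<phi> (X $ i + L * of_int k)))"
    by (intro sum.cong refl integral_sawtooth_deriv(2)[OF L \<phi> R Ki])
  also have "\<dots> = - ((LINT x|lborel. \<phi> x) - (LINT x|config_measure X. \<phi> x))"
    unfolding mu using L by (simp add: sum.distrib sum_subtractf L_def)
  finally show "(LINT x|lborel. config_sawtooth X x * deriv \<phi> x) = - ((LINT x|lborel. \<phi> x) - (LINT x|config_measure X. \<phi> x))" .
qed

lemma is_potential_potential: "is_potential X (potential X)"
  unfolding potential_def by (rule someI[of "is_potential X", OF is_potential_config_sawtooth])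

lemma locally_integrable_measurable:
  fixes f :: "real \<Rightarrow> real"
  assumes "\<And>a b. set_integrable lborel {a..b} f"
  shows "f \<in> borel_measurable borel"
proof (rule borel_measurable_LIMSEQ_real)
  show "(\<lambda>n. indicator {- real n..real n} x * f x) \<longlonglongrightarrow> f x" for x
  proof (rule tendsto_eventually)
    obtain N where "\<bar>x\<bar> < real N" using reals_Archimedean2 by blast
    then show "\<forall>\<^sub>F n in sequentially. indicator {- real n..real n} x * f x = f x"
      by (intro eventually_sequentiallyI[of N]) (auto simp: indicator_def)
  qed
  show "(\<lambda>x. indicator {- real n..real n} x * f x) \<in> borel_measurable borel" for n
    using assms borel_measurable_integrable by (force simp: set_integrable_def)
qed

lemma locally_integrable_indicator:
  fixes f :: "real \<Rightarrow> real"
  assumes int: "\<And>a b. set_integrable lborel {a..b} f" and A: "A \<subseteq> {c..d}" "A \<in> sets borel"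
  shows "integrable lborel (\<lambda>x. indicator A x * f x)"
proof -
  have "set_integrable lborel A f" by (rule set_integrable_subset[OF int[of c d]]) (use A in auto)
  then show ?thesis by (simp add: set_integrable_def)
qed

section \<open>Uniqueness of the potential\<close>

text \<open>On a bounded window the positive and the negative part of w are densities of finite
  measures that agree on all half-lines. The measures are therefore equal, and so are their
  densities almost everywhere.\<close>

lemma AE_zero_of_interval_integrals:
  fixes w :: "real \<Rightarrow> real"
  assumes int: "\<And>a b. set_integrable lborel {a..b} w"
    and zero: "\<And>a b. a < b \<Longrightarrow> (LINT x|lborel. indicator {a<..b} x * w x) = 0"
  shows "AE x in lborel. w x = 0"
proof -
  have "AE x in lborel. x \<in> {- real n<..real n} \<longrightarrow> w x = 0" for n
  proof -
    let ?I = "{- real n<..real n}"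
    define v where "v x = indicator ?I x * w x" for x
    have v: "integrable lborel v" unfolding v_def by (rule locally_integrable_indicator[OF int, of _ "- real n" "real n"]) auto
    then have [measurable]: "v \<in> borel_measurable borel" using borel_measurable_integrable by force
    define p q where "p x = max 0 (v x)" and "q x = max 0 (- v x)" for x
    have pq: "integrable lborel p" "integrable lborel q"
      unfolding p_def q_def by (intro integrable_max integrable_zero integrable_minus v)+
    have [measurable]: "p \<in> borel_measurable borel" "q \<in> borel_measurable borel"
      unfolding p_def[abs_def] q_def[abs_def] by measurable
    have em: "emeasure (density lborel (\<lambda>x. ennreal (f x))) {x<..} = ennreal (LINT y|lborel. indicator {x<..} y * f y)"
      if "integrable lborel f" "\<And>x. 0 \<le> f x" for f :: "real \<Rightarrow> real" and x
    proof -
      have [measurable]: "f \<in> borel_measurable borel" using borel_measurable_integrable[OF that(1)] by simp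
      have "emeasure (density lborel (\<lambda>x. ennreal (f x))) {x<..} = (\<integral>\<^sup>+ y. ennreal (indicator {x<..} y * f y) \<partial>lborel)"
        by (subst emeasure_density) (auto intro!: nn_integral_cong simp: indicator_def)
      also have "\<dots> = ennreal (LINT y|lborel. indicator {x<..} y * f y)"
        using that integrable_mult_indicator[of "{x<..}" lborel f]
        by (intro nn_integral_eq_integral) auto
      finally show ?thesis .
    qed
    have nonneg: "0 \<le> p x" "0 \<le> q x" for x by (auto simp: p_def q_def)
    have same: "(LINT y|lborel. indicator {x<..} y * p y) = (LINT y|lborel. indicator {x<..} y * q y)" for x
    proof -
      have "(LINT y|lborel. indicator {x<..} y * p y) - (LINT y|lborel. indicator {x<..} y * q y) =
          (LINT y|lborel. indicator {x<..} y * p y - indicator {x<..} y * q y)"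
        using integrable_mult_indicator[of "{x<..}" lborel p] integrable_mult_indicator[of "{x<..}" lborel q] pq
        by (subst Bochner_Integration.integral_diff) auto
      also have "\<dots> = (LINT y|lborel. indicator {max x (- real n)<..real n} y * w y)"
        by (intro Bochner_Integration.integral_cong) (auto simp: p_def q_def v_def indicator_def max_def)
      also have "\<dots> = 0"
      proof (cases "max x (- real n) < real n")
        case False
        then have empty: "{max x (- real n)<..real n} = {}" by auto
        show ?thesis unfolding empty by simp
      qed (rule zero)
      finally show ?thesis by simp
    qed
    have "density lborel (\<lambda>x. ennreal (p x)) = density lborel (\<lambda>x. ennreal (q x))"
      by (rule measure_eqI_lessThan) (simp_all add: em pq nonneg same)
    then have "AE x in lborel. ennreal (p x) = ennreal (q x)"
      by (subst (asm) sigma_finite_measure.density_unique_iff[OF sigma_finite_lborel]) auto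
    then show ?thesis
    proof eventually_elim
      case (elim x)
      then have "p x = q x" using nonneg by simp
      then have "v x = 0" by (auto simp: p_def q_def max_def split: if_splits)
      then show ?case by (auto simp: v_def)
    qed
  qed
  then have "AE x in lborel. \<forall>n. x \<in> {- real n<..real n} \<longrightarrow> w x = 0"
    unfolding AE_all_countable by blast
  then show ?thesis
  proof eventually_elim
    case (elim x)
    obtain n where "\<bar>x\<bar> < real n" using reals_Archimedean2 by blast
    then have "x \<in> {- real n<..real n}" by auto
    then show ?case using elim by blast
  qed
qed

text \<open>P is a smooth Heaviside function and Q a smooth substitute for the positive part. That Q
  is exactly x + q to the right of 1 lets suitable combinations of scaled translates of Q have
  compact support; q cancels in differences.\<close>

lemma mollifier_primitives:
  assumes \<rho>: "standard_mollifier \<rho>"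
  obtains P Q q where "\<And>x. (P has_real_derivative \<rho> x) (at x)" "\<And>x. (Q has_real_derivative P x) (at x)"
    "\<And>x. 0 \<le> P x" "\<And>x. P x \<le> 1" "\<And>x. x \<le> -1 \<Longrightarrow> P x = 0" "\<And>x. 1 \<le> x \<Longrightarrow> P x = 1"
    "\<And>x. x \<le> -1 \<Longrightarrow> Q x = 0" "\<And>x. 1 \<le> x \<Longrightarrow> Q x = x + q" "smooth Q"
proof -
  have sm: "smooth \<rho>" and nn: "\<And>x. 0 \<le> \<rho> x" and out: "\<And>x. x \<notin> {-1<..<1} \<Longrightarrow> \<rho> x = 0"
    and one: "(LINT x|lborel. \<rho> x) = 1"
    using \<rho> by (auto simp: standard_mollifier_def)
  have prim: "\<exists>F. (\<forall>x. (F has_real_derivative f x) (at x)) \<and> F (- 1) = 0" if "\<And>x. isCont f x" for f :: "real \<Rightarrow> real"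
  proof -
    have "\<exists>F. \<forall>x. (F has_vector_derivative f x) (at x)"
      using einterval_antiderivative[of "- \<infinity>" \<infinity> f] that by simp
    then obtain F where "\<forall>x. (F has_real_derivative f x) (at x)"
      unfolding has_real_derivative_iff_has_vector_derivative by blast
    then show ?thesis
      by (intro exI[of _ "\<lambda>x. F x - F (- 1)"]) (auto intro!: derivative_eq_intros)
  qed
  have const: "f x = f y" if "\<And>z. z \<in> S \<Longrightarrow> (f has_real_derivative 0) (at z)" "convex S" "x \<in> S" "y \<in> S" for f :: "real \<Rightarrow> real" and S x y
    using has_field_derivative_zero_constant[of S f] that by (metis has_field_derivative_at_within)
  obtain P where P: "\<And>x. (P has_real_derivative \<rho> x) (at x)" "P (- 1) = 0"
    using prim[of \<rho>] smooth_isCont[OF sm] by blast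
  have "isCont P x" for x using P(1) DERIV_isCont by blast
  then obtain Q where Q: "\<And>x. (Q has_real_derivative P x) (at x)" "Q (- 1) = 0" using prim[of P] by blast
  have P0: "P x = 0" if "x \<le> -1" for x
    using const[of "{..-1}" P x "-1"] P out that by (metis atMost_iff convex_real_interval(2) greaterThanLessThan_iff linorder_not_less order_refl)
  have P1: "P x = P 1" if "1 \<le> x" for x
    using const[of "{1..}" P x 1] P(1) out that by (metis atLeast_iff convex_real_interval(1) greaterThanLessThan_iff linorder_not_less order_refl)
  have "\<rho> x = 0" if "x \<notin> {-1..1}" for x using out that by auto
  then have "(LINT x|lborel. \<rho> x) = P 1 - P (- 1)"
    using integral_FTC_atLeastAtMost[of "- 1" 1 P \<rho>] P(1) set_integral_eq_of_vanishing[of "{-1..1}" \<rho>]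
      continuous_at_imp_continuous_on[of "{-1..1}" \<rho>] smooth_isCont[OF sm]
    by (simp add: has_real_derivative_iff_has_vector_derivative has_vector_derivative_at_within)
  then have "P 1 = 1" using one P(2) by simp
  with P1 have P1: "P x = 1" if "1 \<le> x" for x using that by simp
  have mono: "P x \<le> P y" if "x \<le> y" for x y
    using DERIV_nonneg_imp_nondecreasing[OF that] P(1) nn by blast
  have Pb: "0 \<le> P x" "P x \<le> 1" for x
    using mono[of "min x (- 1)" x] mono[of x "max x 1"] P0[of "min x (- 1)"] P1[of "max x 1"] by auto
  have Q0: "Q x = 0" if "x \<le> -1" for x
    using const[of "{..-1}" Q x "-1"] Q P0 that by (metis atMost_iff convex_real_interval(2) order_refl)
  have Q1: "Q x = x + (Q 1 - 1)" if "1 \<le> x" for x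
  proof -
    have "((\<lambda>x. Q x - x) has_real_derivative 0) (at z)" if "z \<in> {1..}" for z
      using DERIV_diff[OF Q(1)[of z] DERIV_ident] P1[of z] that by simp
    from const[OF this, of "{1..}" x 1] show ?thesis using that by simp
  qed
  have "smooth Q" using smooth_antiderivative[OF Q(1)] smooth_antiderivative[OF P(1) sm] by blast
  then show ?thesis using that[OF P(1) Q(1) Pb P0 P1 Q0 Q1] by blast
qed

text \<open>The du Bois-Reymond lemma. The test function is the primitive of a mollified
  \<open>indicator {a<..b} - (b - a) * indicator {0<..1}\<close>, which has integral zero.\<close>

lemma weakly_constant_imp_AE_constant:
  assumes \<rho>: "standard_mollifier \<rho>"
    and int: "\<And>a b. set_integrable lborel {a..b} w"
    and weak: "\<And>\<phi>. test_function \<phi> \<Longrightarrow> (LINT x|lborel. w x * deriv \<phi> x) = 0"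
  shows "\<exists>c. AE x in lborel. w x = c"
proof -
  have intI: "integrable lborel (\<lambda>x. indicator A x * w x)" if "A \<subseteq> {c..d}" "A \<in> sets borel" for A c d
    by (rule locally_integrable_indicator[OF int that])
  obtain P Q q where P: "\<And>x. (P has_real_derivative \<rho> x) (at x)" "\<And>x. 0 \<le> P x" "\<And>x. P x \<le> 1"
      "\<And>x. x \<le> -1 \<Longrightarrow> P x = 0" "\<And>x. 1 \<le> x \<Longrightarrow> P x = 1"
    and Q: "\<And>x. (Q has_real_derivative P x) (at x)" "\<And>x. x \<le> -1 \<Longrightarrow> Q x = 0" "\<And>x. 1 \<le> x \<Longrightarrow> Q x = x + q" "smooth Q"
    using mollifier_primitives[OF \<rho>] by metis
  have [measurable]: "P \<in> borel_measurable borel"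
    by (intro borel_measurable_continuous_onI continuous_at_imp_continuous_on ballI DERIV_isCont[OF P(1)])
  define c where "c = (LINT x|lborel. indicator {0<..1} x * w x)"
  have main: "(LINT x|lborel. indicator {a<..b} x * w x) = (b - a) * c" if "a < b" for a b
  proof -
    \<comment> \<open>From M on, each of the transition points a, b, 0, 1 is at least 1 away, so for
      every n the scaled arguments lie outside (-1, 1).\<close>
    define M where "M = \<bar>a\<bar> + \<bar>b\<bar> + 2"
    define \<psi> where "\<psi> n x = P (real (Suc n) * (x - a)) - P (real (Suc n) * (x - b))
        - (b - a) * (P (real (Suc n) * x) - P (real (Suc n) * (x - 1)))" for n x
    \<comment> \<open>To the right of all transitions the linear parts of Q leave (b - a) - (b - a)
      * 1 = 0, and to the left Q vanishes; hence the support is compact.\<close>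
    define \<phi> where "\<phi> n x = (1 / real (Suc n)) * (Q (real (Suc n) * (x - a)) - Q (real (Suc n) * (x - b))
        - (b - a) * (Q (real (Suc n) * x) - Q (real (Suc n) * (x - 1))))" for n x
    have der: "(\<phi> n has_real_derivative \<psi> n x) (at x)" for n x
    proof -
      have d: "((\<lambda>x. Q (real (Suc n) * (x - r))) has_real_derivative P (real (Suc n) * (x - r)) * real (Suc n)) (at x)" for r
        by (rule DERIV_chain2[where g="\<lambda>x. real (Suc n) * (x - r)", OF Q(1)]) (auto intro!: derivative_eq_intros)
      have "(\<phi> n has_real_derivative (1 / real (Suc n)) * (P (real (Suc n) * (x - a)) * real (Suc n) - P (real (Suc n) * (x - b)) * real (Suc n)
        - (b - a) * (P (real (Suc n) * (x - 0)) * real (Suc n) - P (real (Suc n) * (x - 1)) * real (Suc n)))) (at x)"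
        unfolding \<phi>_def using d[of 0] by (intro DERIV_cmult DERIV_diff d) simp
      also have "(1 / real (Suc n)) * (P (real (Suc n) * (x - a)) * real (Suc n) - P (real (Suc n) * (x - b)) * real (Suc n)
        - (b - a) * (P (real (Suc n) * (x - 0)) * real (Suc n) - P (real (Suc n) * (x - 1)) * real (Suc n))) = \<psi> n x"
        unfolding \<psi>_def by (simp add: left_diff_distrib[symmetric] mult.assoc[symmetric] del: of_nat_Suc)
      finally show ?thesis .
    qed
    have far: "1 \<le> real (Suc n) * (x - r)" if "M \<le> x" "r \<in> {a, b, 0, 1}" for n x r
    proof -
      have "1 \<le> x - r" using that by (auto simp: M_def)
      then show ?thesis using mult_mono[of 1 "real (Suc n)" 1 "x - r"] by simp
    qed
    have far': "real (Suc n) * (x - r) \<le> - 1" if "x \<le> - M" "r \<in> {a, b, 0, 1}" for n x r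
    proof -
      have "1 \<le> r - x" using that by (auto simp: M_def)
      then have "1 \<le> real (Suc n) * (r - x)" using mult_mono[of 1 "real (Suc n)" 1 "r - x"] by simp
      then show ?thesis by (simp add: algebra_simps)
    qed
    have \<phi>0: "\<phi> n x = 0" if "M < \<bar>x\<bar>" for n x
    proof (cases "M \<le> x")
      case True
      have "Q (real (Suc n) * (x - r)) = real (Suc n) * (x - r) + q" if "r \<in> {a, b, 0, 1}" for r
        using Q(3) far[OF True that] by blast
      note this[of a] this[of b] this[of "0::real"] this[of 1]
      then have "Q (real (Suc n) * (x - a)) = real (Suc n) * (x - a) + q" "Q (real (Suc n) * (x - b)) = real (Suc n) * (x - b) + q"
        "Q (real (Suc n) * x) = real (Suc n) * x + q" "Q (real (Suc n) * (x - 1)) = real (Suc n) * (x - 1) + q"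
        by (simp_all only: insert_iff simp_thms diff_zero)
      then show ?thesis
        unfolding \<phi>_def by (simp only:) (simp add: algebra_simps)
    next
      case False
      then have "x \<le> - M" using that by auto
      then have "Q (real (Suc n) * (x - r)) = 0" if "r \<in> {a, b, 0, 1}" for r
        using Q(2) far'[OF _ that] by blast
      from this[of a] this[of b] this[of 0] this[of 1] show ?thesis
        unfolding \<phi>_def by simp
    qed
    have \<psi>0: "\<psi> n x = 0" if "M \<le> \<bar>x\<bar>" for n x
    proof (cases "M \<le> x")
      case True
      have "P (real (Suc n) * (x - r)) = 1" if "r \<in> {a, b, 0, 1}" for r
        using P(5) far[OF True that] by blast
      from this[of a] this[of b] this[of 0] this[of 1] show ?thesis
        unfolding \<psi>_def by simp
    next
      case False
      then have "x \<le> - M" using that by auto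
      then have "P (real (Suc n) * (x - r)) = 0" if "r \<in> {a, b, 0, 1}" for r
        using P(4) far'[OF _ that] by blast
      from this[of a] this[of b] this[of 0] this[of 1] show ?thesis
        unfolding \<psi>_def by simp
    qed
    have smQ: "smooth (\<lambda>x. u * Q (real (Suc n) * (x - r)) + 1 * g x)" if "smooth g" for u r n g
      using smooth_linear_combination[OF Q(4) that, of u "real (Suc n)" "- real (Suc n) * r" 1]
      by (simp add: algebra_simps)
    have sm: "smooth (\<phi> n)" for n
    proof -
      define N where "N = real (Suc n)"
      have z: "smooth (\<lambda>x. 0)"
        using smooth_linear_combination[OF Q(4) Q(4), of 0 0 0 0] by simp
      have "smooth (\<lambda>x. (1 / N) * Q (N * (x - a)) + 1 * ((- 1 / N) * Q (N * (x - b)) + 1 * (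
          (- (b - a) / N) * Q (N * (x - 0)) + 1 * (((b - a) / N) * Q (N * (x - 1)) + 1 * 0))))"
        unfolding N_def by (intro smQ z)
      also have "(\<lambda>x. (1 / N) * Q (N * (x - a)) + 1 * ((- 1 / N) * Q (N * (x - b)) + 1 * (
          (- (b - a) / N) * Q (N * (x - 0)) + 1 * (((b - a) / N) * Q (N * (x - 1)) + 1 * 0)))) = \<phi> n"
      proof -
        have "N \<noteq> 0" by (simp add: N_def)
        then show ?thesis unfolding \<phi>_def N_def[symmetric] by (simp add: fun_eq_iff field_simps)
      qed
      finally show ?thesis .
    qed
    have test: "test_function (\<phi> n)" for n using sm \<phi>0 unfolding test_function_def by blast
    have zero: "(LINT x|lborel. w x * \<psi> n x) = 0" for n
    proof -
      have "deriv (\<phi> n) = \<psi> n" using der DERIV_imp_deriv by blast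
      then show ?thesis using weak[OF test, of n] by simp
    qed
    define \<psi>' where "\<psi>' x = indicator {a<..b} x - (b - a) * indicator {0<..1::real} x" for x :: real
    have w: "integrable lborel (\<lambda>x. indicator {- M..M} x * w x)" by (rule intI) auto
    have wm: "w \<in> borel_measurable borel" using int by (rule locally_integrable_measurable)
    have "(\<lambda>n. LINT x|lborel. w x * \<psi> n x) \<longlonglongrightarrow> (LINT x|lborel. w x * \<psi>' x)"
    proof (rule integral_dominated_convergence[where w="\<lambda>x. (2 + 2 * (b - a)) * \<bar>indicator {- M..M} x * w x\<bar>"])
      show "integrable lborel (\<lambda>x. (2 + 2 * (b - a)) * \<bar>indicator {- M..M} x * w x\<bar>)"
        using w by (intro integrable_mult_right integrable_abs)
      show "(\<lambda>x. w x * \<psi>' x) \<in> borel_measurable lborel" "(\<lambda>x. w x * \<psi> n x) \<in> borel_measurable lborel" for n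
        using wm unfolding \<psi>'_def \<psi>_def by measurable
      \<comment> \<open>For x \<noteq> r the scaled argument eventually leaves (-1, 1), so the
        sequence is eventually constant.\<close>
      have lim: "(\<lambda>n. P (real (Suc n) * (x - r))) \<longlonglongrightarrow> indicator {r<..} x" if "x \<noteq> r" for x r
      proof (rule tendsto_eventually)
        obtain N where N: "1 / \<bar>x - r\<bar> < real N" using reals_Archimedean2 by blast
        have big: "1 \<le> real (Suc n) * \<bar>x - r\<bar>" if "n \<ge> N" for n
        proof -
          have "1 / \<bar>x - r\<bar> \<le> real (Suc n)" using N that by simp
          then show ?thesis using \<open>x \<noteq> r\<close> by (simp add: divide_le_eq del: of_nat_Suc)
        qed
        show "\<forall>\<^sub>F n in sequentially. P (real (Suc n) * (x - r)) = indicator {r<..} x"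
        proof (rule eventually_sequentiallyI[of N])
          fix n assume "N \<le> n"
          from big[OF this] show "P (real (Suc n) * (x - r)) = indicator {r<..} x"
          proof (cases "r < x")
            case False
            then have "real (Suc n) * (x - r) \<le> -1" using big[OF \<open>N \<le> n\<close>] by (simp add: algebra_simps)
            then show ?thesis using P(4) False by (simp add: indicator_def)
          qed (use P(5) in \<open>simp add: indicator_def\<close>)
        qed
      qed
      have "AE x in lborel. x \<noteq> a \<and> x \<noteq> b \<and> x \<noteq> 0 \<and> x \<noteq> (1::real)"
        using AE_lborel_singleton[of a] AE_lborel_singleton[of b] AE_lborel_singleton[of 0] AE_lborel_singleton[of 1]
        by eventually_elim auto
      then show "AE x in lborel. (\<lambda>n. w x * \<psi> n x) \<longlonglongrightarrow> w x * \<psi>' x"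
      proof eventually_elim
        case (elim x)
        have "(\<lambda>n. w x * \<psi> n x) \<longlonglongrightarrow> w x * (indicator {a<..} x - indicator {b<..} x - (b - a) * (indicator {0<..} x - indicator {1<..} x))"
          unfolding \<psi>_def using elim lim[of x 0] by (intro tendsto_intros lim) auto
        also have "indicator {a<..} x - indicator {b<..} x - (b - a) * (indicator {0<..} x - indicator {1<..} x) = \<psi>' x"
          using \<open>a < b\<close> by (auto simp: \<psi>'_def indicator_def)
        finally show ?case .
      qed
      show "AE x in lborel. norm (w x * \<psi> n x) \<le> (2 + 2 * (b - a)) * \<bar>indicator {- M..M} x * w x\<bar>" for n
      proof (rule AE_I2)
        fix x
        have "\<bar>\<psi> n x\<bar> \<le> (2 + 2 * (b - a)) * indicator {- M..M} x"
        proof (cases "x \<in> {- M..M}")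
          case True
          have "\<bar>P u - P v\<bar> \<le> 1" for u v using P(2)[of u] P(3)[of u] P(2)[of v] P(3)[of v] by linarith
          then have A: "\<bar>P (real (Suc n) * (x - a)) - P (real (Suc n) * (x - b))\<bar> \<le> 1"
            and B: "\<bar>P (real (Suc n) * x) - P (real (Suc n) * (x - 1))\<bar> \<le> 1" by blast+
          have "\<bar>(b - a) * (P (real (Suc n) * x) - P (real (Suc n) * (x - 1)))\<bar> \<le> (b - a) * 1"
            unfolding abs_mult using B \<open>a < b\<close> by (intro mult_mono) auto
          then have "\<bar>\<psi> n x\<bar> \<le> 2 + 2 * (b - a)" unfolding \<psi>_def using A \<open>a < b\<close> by argo
          then show ?thesis using True by simp
        next
          case False
          then show ?thesis using \<psi>0[of x n] by auto
        qed
        then have "\<bar>w x\<bar> * \<bar>\<psi> n x\<bar> \<le> \<bar>w x\<bar> * ((2 + 2 * (b - a)) * indicator {- M..M} x)"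
          by (intro mult_left_mono) auto
        then show "norm (w x * \<psi> n x) \<le> (2 + 2 * (b - a)) * \<bar>indicator {- M..M} x * w x\<bar>"
          by (simp add: abs_mult mult_ac)
      qed
    qed
    then have "(LINT x|lborel. w x * \<psi>' x) = 0"
      using LIMSEQ_unique[OF _ tendsto_const] by (simp add: zero)
    moreover have "(LINT x|lborel. w x * \<psi>' x) = (LINT x|lborel. indicator {a<..b} x * w x - (b - a) * (indicator {0<..1} x * w x))"
      by (intro Bochner_Integration.integral_cong) (auto simp: \<psi>'_def algebra_simps)
    moreover have "\<dots> = (LINT x|lborel. indicator {a<..b} x * w x) - (LINT x|lborel. (b - a) * (indicator {0<..1} x * w x))"
      by (intro Bochner_Integration.integral_diff integrable_mult_right intI[of "{a<..b}" a b] intI[of "{0<..1}" 0 1]) auto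
    moreover have "(LINT x|lborel. (b - a) * (indicator {0<..1} x * w x)) = (b - a) * c"
      by (simp add: c_def)
    ultimately show ?thesis by simp
  qed
  have "AE x in lborel. w x - c = 0"
  proof (rule AE_zero_of_interval_integrals)
    have cint: "set_integrable lborel {a..b} (\<lambda>x. c)" for a b :: real
      by (rule borel_integrable_atLeastAtMost'[OF continuous_on_const])
    show "set_integrable lborel {a..b} (\<lambda>x. w x - c)" for a b
      by (rule set_integral_diff(1)[OF int cint])
    fix a b :: real assume "a < b"
    have "integrable lborel (\<lambda>x. indicator {a<..b} x * c)"
      using \<open>a < b\<close> by (intro integrable_mult_left integrable_real_indicator) auto
    moreover have "integrable lborel (\<lambda>x. indicator {a<..b} x * w x)" by (rule intI[of _ a b]) auto
    ultimately have "(LINT x|lborel. indicator {a<..b} x * w x - indicator {a<..b} x * c) = (b - a) * c - (b - a) * c"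
      using \<open>a < b\<close> by (subst Bochner_Integration.integral_diff) (auto simp: main)
    then show "(LINT x|lborel. indicator {a<..b} x * (w x - c)) = 0"
      by (simp add: right_diff_distrib)
  qed
  then show ?thesis by (intro exI[of _ c]) auto
qed

text \<open>The difference of the chosen potential and the explicit one is weakly constant. The
  mollifier supplies the test functions for the du Bois-Reymond argument.\<close>

lemma potential_AE:
  fixes X :: "real ^ 'n::finite"
  assumes "standard_mollifier \<rho>"
  obtains c where "AE x in lborel. potential X x = config_sawtooth X x + c"
proof -
  let ?u = "potential X" and ?v = "config_sawtooth X"
  have u: "is_potential X ?u" and v: "is_potential X ?v"
    by (rule is_potential_potential is_potential_config_sawtooth)+
  have "\<exists>c. AE x in lborel. ?u x - ?v x = c"
  proof (rule weakly_constant_imp_AE_constant[OF assms])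
    show "set_integrable lborel {a..b} (\<lambda>x. ?u x - ?v x)" for a b
      using u v by (intro set_integral_diff(1)) (auto simp: is_potential_def)
    fix \<phi> assume \<phi>: "test_function \<phi>"
    then have sm: "smooth \<phi>" by (simp add: test_function_def)
    obtain R where R: "0 < R" "\<And>x. R \<le> \<bar>x\<bar> \<Longrightarrow> deriv \<phi> x = 0"
      using test_function_bound[OF \<phi>] by metis
    have "\<exists>B. \<forall>x\<in>{- R..R}. \<bar>deriv \<phi> x\<bar> \<le> B"
      using compact_imp_bounded[OF compact_continuous_image[OF continuous_at_imp_continuous_on compact_Icc]]
        smooth_isCont[OF smooth_deriv[OF sm]]
      by (fastforce simp: bounded_iff)
    then obtain B where B: "\<And>x. x \<in> {- R..R} \<Longrightarrow> \<bar>deriv \<phi> x\<bar> \<le> B" by blast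
    have [measurable]: "deriv \<phi> \<in> borel_measurable borel" by (rule smooth_measurable[OF smooth_deriv[OF sm]])
    have int: "integrable lborel (\<lambda>x. f x * deriv \<phi> x)" if "is_potential X f" for f
    proof (rule Bochner_Integration.integrable_bound)
      have fi: "integrable lborel (\<lambda>x. indicator {- R..R} x * f x)"
        using that by (auto simp: is_potential_def set_integrable_def)
      then show "integrable lborel (\<lambda>x. B * (indicator {- R..R} x * f x))" by (rule integrable_mult_right)
      have "(\<lambda>x. (indicator {- R..R} x * f x) * deriv \<phi> x) \<in> borel_measurable lborel"
        using borel_measurable_integrable[OF fi] by measurable
      also have "(\<lambda>x. (indicator {- R..R} x * f x) * deriv \<phi> x) = (\<lambda>x. f x * deriv \<phi> x)"
      proof
        fix x
        show "(indicator {- R..R} x * f x) * deriv \<phi> x = f x * deriv \<phi> x"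
        proof (cases "x \<in> {- R..R}")
          case False
          then have "R \<le> \<bar>x\<bar>" by auto
          then show ?thesis using R(2) by simp
        qed simp
      qed
      finally show "(\<lambda>x. f x * deriv \<phi> x) \<in> borel_measurable lborel" .
      show "AE x in lborel. norm (f x * deriv \<phi> x) \<le> norm (B * (indicator {- R..R} x * f x))"
      proof (rule AE_I2)
        fix x
        show "norm (f x * deriv \<phi> x) \<le> norm (B * (indicator {- R..R} x * f x))"
        proof (cases "x \<in> {- R..R}")
          case True
          then have "\<bar>deriv \<phi> x\<bar> * \<bar>f x\<bar> \<le> \<bar>B\<bar> * \<bar>f x\<bar>" using B[OF True] by (intro mult_right_mono) auto
          then show ?thesis using True by (simp add: abs_mult mult.commute)
        next
          case False
          then have "R \<le> \<bar>x\<bar>" by auto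
          then show ?thesis using R(2) by simp
        qed
      qed
    qed
    have "(LINT x|lborel. (?u x - ?v x) * deriv \<phi> x) = (LINT x|lborel. ?u x * deriv \<phi> x) - (LINT x|lborel. ?v x * deriv \<phi> x)"
      unfolding left_diff_distrib by (rule Bochner_Integration.integral_diff[OF int[OF u] int[OF v]])
    also have "\<dots> = 0" using u v \<phi> by (simp add: is_potential_def)
    finally show "(LINT x|lborel. (?u x - ?v x) * deriv \<phi> x) = 0" .
  qed
  then show ?thesis using that by (force simp: algebra_simps)
qed

lemma potential_measurable [measurable]: "potential X \<in> borel_measurable borel"
  using is_potential_potential[of X] by (intro locally_integrable_measurable) (simp add: is_potential_def)

section \<open>The force\<close>

text \<open>The rate y - x fits a potential of slope 1 between particles and bounds the mean
  oscillation by r. That no other value qualifies, as \<open>THE\<close> demands, is the triangle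
  inequality averaged over {x..x + r}.\<close>

lemma right_trace_eqI:
  assumes [measurable]: "u \<in> borel_measurable borel" and "0 < r\<^sub>0"
    and near: "AE y in lborel. x < y \<and> y < x + r\<^sub>0 \<longrightarrow> \<bar>u y - l\<bar> \<le> y - x"
  shows "right_trace u x = l"
proof -
  define A where "A m r = (LINT y:{x..x + r}|lborel. \<bar>u y - m\<bar>)" for m r
  have near': "AE y in lborel. y \<in> {x..x + r} \<longrightarrow> \<bar>u y - l\<bar> \<le> r" if "0 < r" "r < r\<^sub>0" for r
    using near AE_lborel_singleton[of x] by eventually_elim (use that in auto)
  have int: "set_integrable lborel {x..x + r} (\<lambda>y. \<bar>u y - m\<bar>)" if r: "0 < r" "r < r\<^sub>0" for r m
    unfolding set_integrable_def
  proof (rule integrableI_bounded_set_indicator[where B="r + \<bar>l - m\<bar>"])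
    show "AE y in lborel. y \<in> {x..x + r} \<longrightarrow> norm \<bar>u y - m\<bar> \<le> r + \<bar>l - m\<bar>"
      using near'[OF r] by eventually_elim auto
  qed (use r in auto)
  have const: "(LINT y:{x..x + r}|lborel. m) = r * m" "set_integrable lborel {x..x + r} (\<lambda>_. m)" if "0 < r" for r m :: real
    using that borel_integrable_atLeastAtMost'[OF continuous_on_const, of x "x + r" m]
    by (auto simp: set_lebesgue_integral_def)
  have bound: "A l r \<le> r * r" if r: "0 < r" "r < r\<^sub>0" for r
    unfolding A_def const(1)[OF r(1), symmetric, of r]
    by (rule set_integral_mono_AE[OF int[OF r] const(2)[OF r(1)]]) (rule near'[OF r])
  have nonneg: "0 \<le> A m r" for m r
    unfolding A_def set_lebesgue_integral_def by (intro Bochner_Integration.integral_nonneg) auto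
  have ev: "\<forall>\<^sub>F r in at_right 0. 0 < r \<and> r < r\<^sub>0"
    using \<open>0 < r\<^sub>0\<close> by (auto simp: eventually_at_right_field intro!: exI[of _ r\<^sub>0])
  have lim: "((\<lambda>r. (1 / r) * A l r) \<longlongrightarrow> 0) (at_right 0)"
  proof (rule tendsto_sandwich[of "\<lambda>_. 0" _ _ "\<lambda>r. r"])
    show "\<forall>\<^sub>F r in at_right 0. (1 / r) * A l r \<le> r"
      using ev by eventually_elim (use bound in \<open>auto simp: field_simps\<close>)
    show "\<forall>\<^sub>F r in at_right 0. 0 \<le> (1 / r) * A l r"
      using ev by eventually_elim (use nonneg in auto)
    show "((\<lambda>r. r) \<longlongrightarrow> 0) (at_right (0::real))" by (rule tendsto_ident_at)
  qed simp
  have uniq: "m = l" if m: "((\<lambda>r. (1 / r) * A m r) \<longlongrightarrow> 0) (at_right 0)" for m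
  proof -
    have sum: "((\<lambda>r. (1 / r) * A l r + (1 / r) * A m r) \<longlongrightarrow> 0) (at_right 0)"
      using tendsto_add[OF lim m] by simp
    have "\<forall>\<^sub>F r in at_right 0. \<bar>l - m\<bar> \<le> (1 / r) * A l r + (1 / r) * A m r"
      using ev
    proof eventually_elim
      case (elim r)
      then have r: "0 < r" "r < r\<^sub>0" by auto
      have "r * \<bar>l - m\<bar> = (LINT y:{x..x + r}|lborel. \<bar>l - m\<bar>)" by (rule const(1)[OF r(1), symmetric])
      also have "\<dots> \<le> (LINT y:{x..x + r}|lborel. \<bar>u y - l\<bar> + \<bar>u y - m\<bar>)"
        by (rule set_integral_mono[OF const(2)[OF r(1)] set_integral_add(1)[OF int[OF r] int[OF r]]]) auto
      also have "\<dots> = A l r + A m r" unfolding A_def by (rule set_integral_add(2)[OF int[OF r] int[OF r]])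
      finally show ?case using r by (simp add: field_simps)
    qed
    from tendsto_lowerbound[OF sum this] have "\<bar>l - m\<bar> \<le> 0" by (simp add: trivial_limit_at_right_real)
    then show ?thesis by simp
  qed
  have "right_trace u x = (THE l. ((\<lambda>r. (1 / r) * A l r) \<longlongrightarrow> 0) (at_right 0))"
    unfolding right_trace_def A_def ..
  also have "\<dots> = l" by (rule the_equality) (rule lim, rule uniq)
  finally show ?thesis .
qed

lemma left_trace_eq_right_trace: "left_trace u x = right_trace (\<lambda>y. u (- y)) (- x)"
proof -
  have "(LINT y:{x - r..x}|lborel. \<bar>u y - l\<bar>) = (LINT y:{- x..- x + r}|lborel. \<bar>u (- y) - l\<bar>)" for r l
  proof -
    have "(LINT y:{x - r..x}|lborel. \<bar>u y - l\<bar>) = (LINT y|lborel. indicator {x - r..x} (- y) * \<bar>u (- y) - l\<bar>)"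
      unfolding set_lebesgue_integral_def by (subst lborel_integral_real_affine[where c="-1" and t=0]) auto
    also have "\<dots> = (LINT y:{- x..- x + r}|lborel. \<bar>u (- y) - l\<bar>)"
      unfolding set_lebesgue_integral_def by (intro Bochner_Integration.integral_cong) (auto simp: indicator_def)
    finally show ?thesis .
  qed
  then show ?thesis by (simp add: left_trace_def right_trace_def)
qed

lemma sawtooth_shift:
  assumes "\<theta> \<le> \<bar>t\<bar>" "\<bar>t\<bar> \<le> L - \<theta>" "\<bar>z\<bar> < \<theta>"
  shows "sawtooth L (t + z) = sawtooth L t + z / L"
proof -
  have pos: "sawtooth L (t + z) = sawtooth L t + z / L" if "\<theta> \<le> t" "t \<le> L - \<theta>" "\<bar>z\<bar> < \<theta>" for t z
  proof -
    have "lattice_step L (t + z) = 1 / 2" "lattice_step L t = 1 / 2"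
      by (rule lattice_step_unit; use that in linarith)+
    then show ?thesis by (simp add: sawtooth_def add_divide_distrib)
  qed
  show ?thesis
  proof (cases "0 \<le> t")
    case False
    then show ?thesis
      using pos[of "- t" "- z"] assms sawtooth_minus[of L "t + z"] sawtooth_minus[of L t] by simp
  qed (use pos assms in auto)
qed

lemma sawtooth_near_0:
  assumes "0 < z" "z < L"
  shows "sawtooth L z = z / L - 1 / 2" "sawtooth L (- z) = 1 / 2 - z / L"
  using assms lattice_step_unit[of z L] sawtooth_minus[of L z] by (auto simp: sawtooth_def)

lemma sum_affine_minus_jump:
  fixes a :: "'n::finite \<Rightarrow> real"
  assumes "\<And>j. j \<noteq> i \<Longrightarrow> b j = a j + z / real CARD('n)" "b i = a i + z / real CARD('n) + e"
  shows "(\<Sum>j\<in>UNIV. b j) = (\<Sum>j\<in>UNIV. a j) + z + e"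
proof -
  have "(\<Sum>j\<in>UNIV. b j) = b i + (\<Sum>j\<in>UNIV - {i}. b j)" by (subst sum.remove[of _ i]) auto
  also have "(\<Sum>j\<in>UNIV - {i}. b j) = (\<Sum>j\<in>UNIV - {i}. a j + z / real CARD('n))"
    using assms by (intro sum.cong) auto
  also have "b i + \<dots> = (\<Sum>j\<in>UNIV. a j + z / real CARD('n)) + e"
    using assms(2) by (subst (2) sum.remove[of _ i]) auto
  also have "\<dots> = (\<Sum>j\<in>UNIV. a j) + z + e" by (simp add: sum.distrib)
  finally show ?thesis .
qed

text \<open>Separation keeps the other sawtooths affine near the particle; only its own one jumps,
  and its value there is halfway. The offsets of opposite sign cancel in the trace average and in
  second differences.\<close>

lemma config_sawtooth_near_particle:
  fixes X :: "real ^ 'n::finite"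
  assumes sep: "\<And>j. j \<noteq> i \<Longrightarrow> \<theta> \<le> \<bar>X $ i - X $ j\<bar> \<and> \<bar>X $ i - X $ j\<bar> \<le> real CARD('n) - \<theta>"
    and "\<theta> \<le> real CARD('n)" "0 < z" "z < \<theta>"
  shows "config_sawtooth X (X $ i + z) = config_sawtooth X (X $ i) + z - 1 / 2"
    and "config_sawtooth X (X $ i - z) = config_sawtooth X (X $ i) - z + 1 / 2"
proof -
  let ?L = "real CARD('n)"
  have 0: "sawtooth ?L 0 = 0" using sawtooth_minus[of ?L 0] by simp
  have s: "sawtooth ?L (X $ i + y - X $ j) = sawtooth ?L (X $ i - X $ j) + y / ?L" if "j \<noteq> i" "\<bar>y\<bar> < \<theta>" for j y
    using sawtooth_shift[of \<theta> "X $ i - X $ j" ?L y] sep[OF that(1)] that(2) by (simp add: algebra_simps)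
  show "config_sawtooth X (X $ i + z) = config_sawtooth X (X $ i) + z - 1 / 2"
    unfolding config_sawtooth_def
    using sum_affine_minus_jump[of i "\<lambda>j. sawtooth ?L (X $ i + z - X $ j)" "\<lambda>j. sawtooth ?L (X $ i - X $ j)" z "- 1 / 2"]
      s[of _ z] assms 0 sawtooth_near_0[of z ?L] by simp
  show "config_sawtooth X (X $ i - z) = config_sawtooth X (X $ i) - z + 1 / 2"
    unfolding config_sawtooth_def
    using sum_affine_minus_jump[of i "\<lambda>j. sawtooth ?L (X $ i + (- z) - X $ j)" "\<lambda>j. sawtooth ?L (X $ i - X $ j)" "- z" "1 / 2"]
      s[of _ "- z"] assms 0 sawtooth_near_0[of z ?L] by simp
qed

lemma trace_average_potential:
  fixes X :: "real ^ 'n::finite"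
  assumes sep: "\<And>j. j \<noteq> i \<Longrightarrow> \<theta> \<le> \<bar>X $ i - X $ j\<bar> \<and> \<bar>X $ i - X $ j\<bar> \<le> real CARD('n) - \<theta>"
    and \<theta>: "0 < \<theta>" "\<theta> \<le> real CARD('n)"
    and c: "AE x in lborel. potential X x = config_sawtooth X x + c"
  shows "trace_average (potential X) (X $ i) = config_sawtooth X (X $ i) + c"
proof -
  let ?v = "config_sawtooth X (X $ i) + c"
  have "right_trace (potential X) (X $ i) = ?v - 1 / 2"
  proof (rule right_trace_eqI[OF _ \<theta>(1)])
    show "AE y in lborel. X $ i < y \<and> y < X $ i + \<theta> \<longrightarrow> \<bar>potential X y - (?v - 1 / 2)\<bar> \<le> y - X $ i"
      using c
    proof eventually_elim
      case (elim y)
      show ?case using config_sawtooth_near_particle(1)[OF sep \<theta>(2), of "y - X $ i"] elim by auto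
    qed
  qed measurable
  moreover have "left_trace (potential X) (X $ i) = ?v + 1 / 2"
    unfolding left_trace_eq_right_trace
  proof (rule right_trace_eqI[OF _ \<theta>(1)])
    have "AE y in lborel. potential X (- y) = config_sawtooth X (- y) + c"
      using AE_borel_affine[of "-1" "\<lambda>x. potential X x = config_sawtooth X x + c" 0] c by simp
    then show "AE y in lborel. - (X $ i) < y \<and> y < - (X $ i) + \<theta> \<longrightarrow> \<bar>potential X (- y) - (?v + 1 / 2)\<bar> \<le> y - - (X $ i)"
    proof eventually_elim
      case (elim y)
      show ?case using config_sawtooth_near_particle(2)[OF sep \<theta>(2), of "y + X $ i"] elim by auto
    qed
  qed measurable
  ultimately show ?thesis by (simp add: trace_average_def)
qed

lemma second_diff_config_sawtooth:
  fixes X :: "real ^ 'n::finite"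
  shows "second_diff (config_sawtooth X) x z = (\<Sum>j\<in>UNIV. second_diff (sawtooth (real CARD('n))) (x - X $ j) z)"
  by (simp add: second_diff_def config_sawtooth_def sum_subtractf sum.distrib sum_distrib_left algebra_simps)

text \<open>Twice the truncated integral does not depend on the truncation radius r < \<theta>:
  after pairing z with -z the integrand is the second difference, which vanishes for |z| \<le> r
  anyway. The principal value is thus the limit of an eventually constant function.\<close>

lemma force_eq:
  fixes X :: "real ^ 'n::finite"
  assumes s: "0 < s" "s < 1" and \<rho>: "standard_mollifier \<rho>"
    and sep: "\<And>j. j \<noteq> i \<Longrightarrow> \<theta> \<le> \<bar>X $ i - X $ j\<bar> \<and> \<bar>X $ i - X $ j\<bar> \<le> real CARD('n) - \<theta>"
    and \<theta>: "0 < \<theta>" "\<theta> \<le> real CARD('n)"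
  shows "force s X $ i = (\<Sum>j\<in>UNIV. interaction (real CARD('n)) s (X $ i - X $ j))"
proof -
  let ?L = "real CARD('n)" and ?x = "X $ i"
  obtain c where c: "AE x in lborel. potential X x = config_sawtooth X x + c" using potential_AE[OF \<rho>] .
  note tr = trace_average_potential[OF sep \<theta> c]
  define v where "v = config_sawtooth X"
  have [measurable]: "v \<in> borel_measurable borel" by (simp add: v_def)
  define J where "J r = (LINT y:{y. \<bar>?x - y\<bar> > r}|lborel. (trace_average (potential X) ?x - potential X y) / \<bar>?x - y\<bar> powr (1 + 2 * s))" for r
  have twice: "2 * J r = (\<Sum>j\<in>UNIV. interaction ?L s (?x - X $ j))" if r: "0 < r" "r < \<theta>" for r
  proof -
    define w where "w z = indicator {z. r < \<bar>z\<bar>} z * (v ?x - v (?x + z))" for z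
    have [measurable]: "w \<in> borel_measurable borel" unfolding w_def[abs_def] by measurable
    have wb: "\<bar>w z\<bar> \<le> ?L" for z
      using config_sawtooth_abs_le[of X ?x] config_sawtooth_abs_le[of X "?x + z"]
      by (auto simp: w_def v_def indicator_def abs_le_iff)
    have int: "integrable lborel (\<lambda>z. w z * kernel s z)"
      by (rule kernel_integrable_bound[OF s _ bound_off_core[OF r(1)]]) (use wb in \<open>auto simp: w_def\<close>)
    have "J r = (LINT y|lborel. w (y - ?x) * kernel s (y - ?x))"
      unfolding J_def set_lebesgue_integral_def
    proof (rule integral_cong_AE)
      show "AE y in lborel. indicator {y. r < \<bar>?x - y\<bar>} y *\<^sub>R ((trace_average (potential X) ?x - potential X y) / \<bar>?x - y\<bar> powr (1 + 2 * s)) =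
          w (y - ?x) * kernel s (y - ?x)"
        using c by eventually_elim (auto simp: tr w_def v_def kernel_def indicator_def abs_minus_commute)
    qed measurable
    also have "\<dots> = (LINT z|lborel. w z * kernel s z)"
      by (subst lborel_integral_real_affine[where c=1 and t="?x"]) auto
    finally have J1: "J r = (LINT z|lborel. w z * kernel s z)" .
    also have "\<dots> = (LINT z|lborel. w (- z) * kernel s z)"
      by (subst lborel_integral_real_affine[where c="-1" and t=0]) auto
    finally have J2: "J r = (LINT z|lborel. w (- z) * kernel s z)" .
    have int2: "integrable lborel (\<lambda>z. w (- z) * kernel s z)"
      using lborel_integrable_real_affine[OF int, of "-1" 0] by simp
    have "2 * J r = (LINT z|lborel. w z * kernel s z + w (- z) * kernel s z)"
      using Bochner_Integration.integral_add[OF int int2] J1 J2 by simp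
    also have "\<dots> = (LINT z|lborel. (\<Sum>j\<in>UNIV. second_diff (sawtooth ?L) (?x - X $ j) z * kernel s z))"
    proof (rule Bochner_Integration.integral_cong)
      fix z
      have "w z + w (- z) = second_diff v ?x z"
      proof (cases "r < \<bar>z\<bar>")
        case False
        have "second_diff v ?x z = 0"
        proof (cases "z = 0")
          case False
          have "v (?x + \<bar>z\<bar>) = v ?x + \<bar>z\<bar> - 1 / 2" "v (?x - \<bar>z\<bar>) = v ?x - \<bar>z\<bar> + 1 / 2"
            unfolding v_def using config_sawtooth_near_particle[OF sep \<theta>(2), of "\<bar>z\<bar>"] False \<open>\<not> r < \<bar>z\<bar>\<close> r by auto
          then show ?thesis by (cases "0 \<le> z") (auto simp: second_diff_def)
        qed (simp add: second_diff_def)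
        then show ?thesis using False by (simp add: w_def)
      qed (simp add: w_def second_diff_def)
      then show "w z * kernel s z + w (- z) * kernel s z = (\<Sum>j\<in>UNIV. second_diff (sawtooth ?L) (?x - X $ j) z * kernel s z)"
        by (simp add: distrib_right[symmetric] second_diff_config_sawtooth v_def sum_distrib_right)
    qed simp
    also have "\<dots> = (\<Sum>j\<in>UNIV. interaction ?L s (?x - X $ j))"
      unfolding interaction_def
    proof (rule Bochner_Integration.integral_sum)
      fix j
      show "integrable lborel (\<lambda>z. second_diff (sawtooth ?L) (?x - X $ j) z * kernel s z)"
      \<comment> \<open>A particle exerts no force on itself: the sawtooth is odd at its jump, so
        its second difference there is identically 0.\<close>
      proof (cases "j = i")
        case True
        have "second_diff (sawtooth ?L) 0 z = 0" for z
          using sawtooth_minus[of ?L 0] sawtooth_minus[of ?L z] by (simp add: second_diff_def)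
        then show ?thesis using True by simp
      next
        case False
        have neg: "second_diff (sawtooth ?L) (- t) z = - second_diff (sawtooth ?L) t z" for t z
          using sawtooth_minus[of ?L t] sawtooth_minus[of ?L "t + z"] sawtooth_minus[of ?L "t - z"]
          by (simp add: second_diff_def)
        have "integrable lborel (\<lambda>z. second_diff (sawtooth ?L) \<bar>?x - X $ j\<bar> z * kernel s z)"
          using sep[OF False] \<theta> by (intro interaction_integrable s) auto
        then show ?thesis
          using neg[of "?x - X $ j"] by (cases "0 \<le> ?x - X $ j") auto
      qed
    qed
    finally show ?thesis .
  qed
  have "J r = (\<Sum>j\<in>UNIV. interaction ?L s (?x - X $ j)) / 2" if "0 < r" "r < \<theta>" for r
    using twice[OF that] by simp
  then have "\<forall>\<^sub>F r in at_right 0. (\<Sum>j\<in>UNIV. interaction ?L s (?x - X $ j)) / 2 = J r"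
    using \<theta>(1) by (auto simp: eventually_at_right_field intro!: exI[of _ \<theta>])
  then have "(J \<longlongrightarrow> (\<Sum>j\<in>UNIV. interaction ?L s (?x - X $ j)) / 2) (at_right 0)"
    by (rule tendsto_eventually[OF eventually_mono]) auto
  then have "Lim (at_right 0) J = (\<Sum>j\<in>UNIV. interaction ?L s (?x - X $ j)) / 2"
    by (intro tendsto_Lim) (auto simp: trivial_limit_at_right_real)
  then show ?thesis by (simp add: force_def fractional_laplacian_def J_def[abs_def])
qed

section \<open>The pair energy\<close>

lemma (in pair_sigma_finite) integrable_product_bound:
  fixes f :: "'a \<times> 'b \<Rightarrow> real"
  assumes [measurable]: "f \<in> borel_measurable (M1 \<Otimes>\<^sub>M M2)"
    and g: "integrable M1 g" and w: "integrable M2 w"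
    and bound: "\<And>x y. x \<in> space M1 \<Longrightarrow> y \<in> space M2 \<Longrightarrow> \<bar>f (x, y)\<bar> \<le> g x * w y"
  shows "integrable (M1 \<Otimes>\<^sub>M M2) f"
proof (rule Bochner_Integration.integrable_bound)
  have [measurable]: "g \<in> borel_measurable M1" "w \<in> borel_measurable M2" using g w by auto
  show "integrable (M1 \<Otimes>\<^sub>M M2) (\<lambda>(x, y). g x * w y)"
  proof (rule Fubini_integrable)
    show "integrable M1 (\<lambda>x. \<integral>y. norm (case (x, y) of (x, y) \<Rightarrow> g x * w y) \<partial>M2)"
      using g by (simp add: abs_mult)
    show "AE x in M1. integrable M2 (\<lambda>y. case (x, y) of (x, y) \<Rightarrow> g x * w y)"
      using w by simp
  qed measurable
  show "AE p in M1 \<Otimes>\<^sub>M M2. norm (f p) \<le> norm (case p of (x, y) \<Rightarrow> g x * w y)"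
  proof (rule AE_I2)
    fix p assume "p \<in> space (M1 \<Otimes>\<^sub>M M2)"
    then obtain x y where p: "p = (x, y)" "x \<in> space M1" "y \<in> space M2" by (auto simp: space_pair_measure)
    show "norm (f p) \<le> norm (case p of (x, y) \<Rightarrow> g x * w y)"
      using bound[OF p(2,3)] by (simp add: p(1))
  qed
qed measurable

lemma integrable_indicator_bounded:
  fixes f :: "real \<Rightarrow> real"
  assumes [measurable]: "f \<in> borel_measurable borel" and "\<And>x. \<bar>f x\<bar> \<le> B"
  shows "integrable lborel (\<lambda>x. indicator {a..b} x * f x)" "integrable lborel (\<lambda>x. indicator {a..<b} x * f x)"
proof -
  have "emeasure lborel {a..<b} < \<infinity>" by (cases "a \<le> b") auto
  then have "integrable lborel (\<lambda>x. indicator {a..<b} x *\<^sub>R f x)"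
    by (intro integrableI_bounded_set_indicator[where B=B]) (use assms(2) in auto)
  moreover have "integrable lborel (\<lambda>x. indicator {a..b} x *\<^sub>R f x)"
    by (intro integrableI_bounded_set_indicator[where B=B]) (use assms(2) in \<open>auto simp: emeasure_lborel_Icc_eq\<close>)
  ultimately show "integrable lborel (\<lambda>x. indicator {a..b} x * f x)" "integrable lborel (\<lambda>x. indicator {a..<b} x * f x)"
    by simp_all
qed

lemma integral_period_shift:
  fixes f :: "real \<Rightarrow> real"
  assumes "0 < L" and per: "\<And>x. f (x + L) = f x" and meas: "f \<in> borel_measurable borel"
    and bound: "\<And>x. \<bar>f x\<bar> \<le> B"
  shows "(LINT x|lborel. indicator {0..L} x * f (x - a)) = (LINT x|lborel. indicator {0..L} x * f x)"
proof -
  have int: "integrable lborel (\<lambda>x. indicator {c..<d} x * f x)" for c d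
    by (rule integrable_indicator_bounded(2)[OF meas bound])
  have perk: "f (x + L * of_int k) = f x" for x and k :: int
    by (rule periodic_of_int) (rule per)
  \<comment> \<open>Half-open intervals tile the line, so cutting and translating is done with
    them.\<close>
  have half: "(LINT x|lborel. indicator {0..L} x * g x) = (LINT x|lborel. indicator {0..<L} x * g x)"
    if [measurable]: "g \<in> borel_measurable borel" for g :: "real \<Rightarrow> real"
    by (rule integral_cong_AE) (use AE_lborel_singleton[of L] in \<open>auto simp: indicator_def elim: eventually_mono\<close>)
  define k where "k = \<lfloor>- a / L\<rfloor>"
  define b where "b = - a - L * of_int k"
  have "of_int k \<le> - a / L" "- a / L < of_int k + 1" by (auto simp: k_def)
  then have b: "0 \<le> b" "b < L" using \<open>0 < L\<close> by (auto simp: b_def field_simps)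
  have "(LINT x|lborel. indicator {0..L} x * f (x - a)) = (LINT x|lborel. indicator {0..<L} x * f (x - a))"
    by (intro half measurable_compose[OF _ meas]) measurable
  also have "\<dots> = (LINT x|lborel. indicator {b..<L + b} x * f x)"
  proof (subst lborel_integral_real_affine[where c=1 and t="- b"])
    have "(\<lambda>x. indicator {0..<L} (- b + 1 * x) * f (- b + 1 * x - a)) = (\<lambda>x. indicator {b..<L + b} x * f x)"
      using perk[of _ k] by (auto simp: fun_eq_iff indicator_def b_def algebra_simps)
    then show "\<bar>1\<bar> *\<^sub>R (LINT x|lborel. indicator {0..<L} (- b + 1 * x) * f (- b + 1 * x - a)) =
        (LINT x|lborel. indicator {b..<L + b} x * f x)" by simp
  qed simp
  also have "\<dots> = (LINT x|lborel. indicator {b..<L} x * f x) + (LINT x|lborel. indicator {L..<L + b} x * f x)"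
    by (subst Bochner_Integration.integral_add[OF int int, symmetric], rule Bochner_Integration.integral_cong)
      (use b in \<open>auto simp: indicator_def\<close>)
  also have "(LINT x|lborel. indicator {L..<L + b} x * f x) = (LINT x|lborel. indicator {0..<b} x * f x)"
  proof (subst lborel_integral_real_affine[where c=1 and t=L])
    have "(\<lambda>x. indicator {L..<L + b} (L + 1 * x) * f (L + 1 * x)) = (\<lambda>x. indicator {0..<b} x * f x)"
      using per by (auto simp: fun_eq_iff indicator_def add.commute)
    then show "\<bar>1\<bar> *\<^sub>R (LINT x|lborel. indicator {L..<L + b} (L + 1 * x) * f (L + 1 * x)) =
        (LINT x|lborel. indicator {0..<b} x * f x)" by simp
  qed simp
  also have "(LINT x|lborel. indicator {b..<L} x * f x) + (LINT x|lborel. indicator {0..<b} x * f x) =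
      (LINT x|lborel. indicator {0..<L} x * f x)"
    by (subst Bochner_Integration.integral_add[OF int int, symmetric], rule Bochner_Integration.integral_cong)
      (use b in \<open>auto simp: indicator_def\<close>)
  also have "\<dots> = (LINT x|lborel. indicator {0..L} x * f x)" by (rule half[symmetric]) (rule meas)
  finally show ?thesis .
qed

section \<open>The autocorrelation of the sawtooth\<close>

text \<open>The energy of two sawtooths at distance t is bilinear in their increments; integrated
  over x, the product of the increments becomes a second difference of this function, see
  \<open>autocorrelation_expand\<close>.\<close>

definition autocorrelation :: "real \<Rightarrow> real \<Rightarrow> real" where
  "autocorrelation L t = (LINT x|lborel. indicator {0..L} x * (sawtooth L x * sawtooth L (x - t)))"

lemma sawtooth_product_abs_le: "\<bar>sawtooth L x * sawtooth L y\<bar> \<le> 1 / 4"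
proof -
  have "\<bar>sawtooth L x\<bar> * \<bar>sawtooth L y\<bar> \<le> (1 / 2) * (1 / 2)"
    by (intro mult_mono sawtooth_abs_le) auto
  then show ?thesis by (simp add: abs_mult)
qed

lemma autocorrelation_add_period:
  assumes "0 < L"
  shows "autocorrelation L (t + L) = autocorrelation L t"
proof -
  have "sawtooth L (x - (t + L)) = sawtooth L (x - t)" for x
    using sawtooth_add_period[OF assms, of "x - (t + L)"] by (simp add: algebra_simps)
  then show ?thesis by (simp add: autocorrelation_def)
qed

text \<open>The result is L / 2 times the second Bernoulli polynomial at t / L. In the integrand, ?p
  is the product for x > t; for x < t the shifted sawtooth is one tooth earlier and larger by 1,
  which adds ?q on {0..t}.\<close>

lemma autocorrelation_eq:
  assumes "0 \<le> t" "t \<le> L" "0 < L"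
  shows "autocorrelation L t = t\<^sup>2 / (2 * L) - t / 2 + L / 12"
proof -
  let ?p = "\<lambda>x. (x / L - 1 / 2) * ((x - t) / L - 1 / 2)" and ?q = "\<lambda>x. x / L - 1 / 2"
  have ftc: "integrable lborel (\<lambda>x. indicator {0..b} x * f x)" "(LINT x|lborel. indicator {0..b} x * f x) = F b - F 0"
    if "0 \<le> b" "\<And>x. (F has_real_derivative f x) (at x)" "continuous_on {0..b} f" for b f F
    using integral_FTC_atLeastAtMost[OF that(1) has_vector_derivative_at_within that(3), of F] that
      borel_integrable_atLeastAtMost'[OF that(3)]
    by (auto simp: has_real_derivative_iff_has_vector_derivative set_integrable_def)
  have dq: "((\<lambda>x. x\<^sup>2 / (2 * L) - x / 2) has_real_derivative ?q x) (at x)" for x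
    using \<open>0 < L\<close> by (auto intro!: derivative_eq_intros simp: field_simps)
  have dp: "((\<lambda>x. x ^ 3 / (3 * L\<^sup>2) - (t / L + 1) * x\<^sup>2 / (2 * L) + (t / L + 1 / 2) * x / 2) has_real_derivative ?p x) (at x)" for x
    using \<open>0 < L\<close> by (auto intro!: derivative_eq_intros simp: field_simps power2_eq_square)
  note P = ftc[OF less_imp_le[OF \<open>0 < L\<close>] dp] and Q = ftc[OF \<open>0 \<le> t\<close> dq]
  have cP: "continuous_on S ?p" and cQ: "continuous_on S ?q" for S
    by (intro continuous_intros; use \<open>0 < L\<close> in simp)+
  have "autocorrelation L t = (LINT x|lborel. indicator {0..L} x * ?p x + indicator {0..t} x * ?q x)"
    unfolding autocorrelation_def
  proof (rule integral_cong_AE)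
    show "AE x in lborel. indicator {0..L} x * (sawtooth L x * sawtooth L (x - t)) = indicator {0..L} x * ?p x + indicator {0..t} x * ?q x"
      using AE_lborel_singleton[of 0] AE_lborel_singleton[of L] AE_lborel_singleton[of t]
    proof eventually_elim
      case (elim x)
      consider "x \<notin> {0..L}" | "0 < x" "x < L" using elim by force
      then show ?case
      proof cases
        case 1
        then show ?thesis using assms by (auto simp: indicator_def)
      next
        case 2
        have 1: "sawtooth L x = x / L - 1 / 2" using lattice_step_unit[OF 2] by (simp add: sawtooth_def)
        show ?thesis
        proof (cases "t < x")
          case True
          then have "lattice_step L (x - t) = 1 / 2" using 2 assms by (intro lattice_step_unit) auto
          then have "sawtooth L (x - t) = (x - t) / L - 1 / 2" by (simp add: sawtooth_def)
          then show ?thesis using 1 2 True by simp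
        next
          case False
          then have "lattice_step L (t - x) = 1 / 2" using 2 elim assms by (intro lattice_step_unit) auto
          then have "sawtooth L (x - t) = (x - t) / L + 1 / 2"
            using lattice_step_minus[of L "t - x"] by (simp add: sawtooth_def)
          then have "sawtooth L x * sawtooth L (x - t) = ?p x + ?q x"
            unfolding 1 by (simp add: algebra_simps)
          then show ?thesis using 2 False by simp
        qed
      qed
    qed
  qed measurable
  also have "\<dots> = (LINT x|lborel. indicator {0..L} x * ?p x) + (LINT x|lborel. indicator {0..t} x * ?q x)"
    by (intro Bochner_Integration.integral_add P(1) Q(1) cP cQ)
  also have "\<dots> = t\<^sup>2 / (2 * L) - t / 2 + L / 12"
    unfolding P(2)[OF cP] Q(2)[OF cQ] using \<open>0 < L\<close> by (simp add: field_simps power2_eq_square power3_eq_cube)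
  finally show ?thesis .
qed

lemma autocorrelation_of_int:
  assumes "0 < L"
  shows "autocorrelation L (t + L * of_int k) = autocorrelation L t"
  by (rule periodic_of_int) (rule autocorrelation_add_period[OF assms])

lemma autocorrelation_cell:
  assumes "0 < L" "L * of_int k \<le> t" "t \<le> L * (of_int k + 1)"
  shows "autocorrelation L t = (t - L * of_int k)\<^sup>2 / (2 * L) - (t - L * of_int k) / 2 + L / 12"
  using autocorrelation_eq[of "t - L * of_int k" L] autocorrelation_of_int[of L "t - L * of_int k" k] assms
  by (simp add: algebra_simps)

lemma cell_exists:
  assumes "0 < L"
  obtains k where "L * real_of_int k \<le> t" "t < L * (of_int k + 1)"
proof -
  define k where "k = \<lfloor>t / L\<rfloor>"
  have "of_int k \<le> t / L" "t / L < of_int k + 1" by (auto simp: k_def)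
  then have "L * of_int k \<le> t" "t < L * (of_int k + 1)" using assms by (auto simp: field_simps)
  then show ?thesis by (rule that)
qed

text \<open>The bridge from energy to force: second differences of the autocorrelation differentiate
  to second differences of the sawtooth.\<close>

lemma DERIV_autocorrelation:
  assumes "0 < L" "t \<notin> range (\<lambda>k. L * real_of_int k)"
  shows "(autocorrelation L has_real_derivative sawtooth L t) (at t)"
proof -
  obtain k where k: "L * real_of_int k \<le> t" "t < L * (of_int k + 1)" using cell_exists[OF \<open>0 < L\<close>] .
  have "t \<noteq> L * of_int k" using assms(2) by auto
  then have t: "t \<in> {L * of_int k<..<L * (of_int k + 1)}" using k by auto
  let ?f = "\<lambda>t. (t - L * of_int k)\<^sup>2 / (2 * L) - (t - L * of_int k) / 2 + L / 12"
  have "sawtooth L t = (t - L * of_int k) / L - 1 / 2"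
    using lattice_step_eq[OF \<open>0 < L\<close>, of k t] t \<open>0 < L\<close> by (simp add: sawtooth_def field_simps)
  moreover have "(?f has_real_derivative (t - L * of_int k) / L - 1 / 2) (at t)"
    using \<open>0 < L\<close> by (auto intro!: derivative_eq_intros simp: field_simps)
  ultimately have "(?f has_real_derivative sawtooth L t) (at t)" by simp
  moreover have ev: "\<forall>\<^sub>F x in nhds t. autocorrelation L x = ?f x"
    using eventually_nhds_in_open[OF open_greaterThanLessThan t]
    by eventually_elim (auto intro!: autocorrelation_cell[OF \<open>0 < L\<close>])
  ultimately show ?thesis by (intro DERIV_cong_ev[OF refl ev refl, THEN iffD2])
qed

text \<open>The constant 1 / 2 bounds the sawtooth, that is, the derivative. At the lattice there
  are corners, so one cell is treated by the explicit formula and cells are chained by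
  induction.\<close>

lemma autocorrelation_lipschitz:
  assumes "0 < L"
  shows "\<bar>autocorrelation L a - autocorrelation L b\<bar> \<le> \<bar>a - b\<bar> / 2"
proof -
  have cell: "\<bar>autocorrelation L x - autocorrelation L y\<bar> \<le> \<bar>x - y\<bar> / 2"
    if "L * of_int k \<le> x" "x \<le> L * (of_int k + 1)" "L * of_int k \<le> y" "y \<le> L * (of_int k + 1)" for x y k
  proof -
    define u v where "u = x - L * of_int k" and "v = y - L * of_int k"
    have uv: "0 \<le> u" "u \<le> L" "0 \<le> v" "v \<le> L" using that by (auto simp: u_def v_def algebra_simps)
    have "autocorrelation L x - autocorrelation L y = (u - v) * ((u + v) / (2 * L) - 1 / 2)"
      unfolding autocorrelation_cell[OF assms that(1,2)] autocorrelation_cell[OF assms that(3,4)] u_def[symmetric] v_def[symmetric]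
      using assms by (simp add: field_simps power2_eq_square)
    moreover have "\<bar>(u + v) / (2 * L) - 1 / 2\<bar> \<le> 1 / 2"
      using uv assms by (auto simp: abs_le_iff field_simps)
    then have "\<bar>u - v\<bar> * \<bar>(u + v) / (2 * L) - 1 / 2\<bar> \<le> \<bar>u - v\<bar> * (1 / 2)" by (intro mult_left_mono) auto
    ultimately show ?thesis by (simp add: abs_mult u_def v_def)
  qed
  have "\<bar>autocorrelation L y - autocorrelation L x\<bar> \<le> (y - x) / 2"
    if "x \<in> {L * of_int k..L * (of_int k + 1)}" "x \<le> y" "y \<le> L * (of_int k + 1 + of_nat n)" for x y k n
    using that
  proof (induction n arbitrary: y)
    case 0
    then show ?case using cell[of k y x] by auto
  next
    case (Suc n)
    let ?z = "L * (of_int k + 1 + of_nat n)"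
    show ?case
    proof (cases "y \<le> ?z")
      case False
      have "L * (of_int k + 1) \<le> ?z" using \<open>0 < L\<close> by (intro mult_left_mono) auto
      then have "x \<le> ?z" using Suc.prems by (meson atLeastAtMost_iff order_trans)
      then have "\<bar>autocorrelation L ?z - autocorrelation L x\<bar> \<le> (?z - x) / 2"
        using Suc by auto
      moreover have "\<bar>autocorrelation L y - autocorrelation L ?z\<bar> \<le> \<bar>y - ?z\<bar> / 2"
        by (rule cell[of "k + 1 + int n"]) (use False Suc.prems \<open>0 < L\<close> in \<open>auto simp: algebra_simps\<close>)
      moreover have "\<bar>p - q\<bar> \<le> (y - x) / 2" if "\<bar>r - q\<bar> \<le> (w - x) / 2" "\<bar>p - r\<bar> \<le> (y - w) / 2" for p q r w :: real
        using that abs_triangle_ineq[of "p - r" "r - q"] by (simp add: field_simps)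
      ultimately show ?thesis using False by force
    qed (use Suc in auto)
  qed
  note chain = this
  have le: "\<bar>autocorrelation L y - autocorrelation L x\<bar> \<le> (y - x) / 2" if "x \<le> y" for x y
  proof -
    obtain k where k: "L * real_of_int k \<le> x" "x < L * (of_int k + 1)" using cell_exists[OF \<open>0 < L\<close>] .
    obtain n where "(y - L * (of_int k + 1)) / L < real n" using reals_Archimedean2 by blast
    then have "y \<le> L * (of_int k + 1 + of_nat n)" using \<open>0 < L\<close> by (simp add: field_simps)
    then show ?thesis using chain[of x k y n] k that by auto
  qed
  show ?thesis using le[of a b] le[of b a] by (cases "a \<le> b") (auto simp: abs_minus_commute)
qed

lemma autocorrelation_measurable [measurable]: "autocorrelation L \<in> borel_measurable borel"
  unfolding autocorrelation_def[abs_def] by measurable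

lemma autocorrelation_abs_le:
  assumes "0 < L"
  shows "\<bar>autocorrelation L t\<bar> \<le> L / 4"
proof -
  have "\<bar>autocorrelation L t\<bar> \<le> (LINT x|lborel. \<bar>indicator {0..L} x * (sawtooth L x * sawtooth L (x - t))\<bar>)"
    unfolding autocorrelation_def by (rule integral_abs_bound)
  also have "\<dots> \<le> (LINT x|lborel. indicator {0..L} x * (1 / 4))"
  proof (rule integral_mono)
    show "integrable lborel (\<lambda>x. \<bar>indicator {0..L} x * (sawtooth L x * sawtooth L (x - t))\<bar>)"
      by (intro integrable_abs integrable_indicator_bounded(1)[where B="1 / 4", OF _ sawtooth_product_abs_le]) measurable
    show "integrable lborel (\<lambda>x. indicator {0..L} x * (1 / 4 :: real))"
      by (rule integrable_indicator_bounded(1)[where B="1 / 4"]) auto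
    show "\<bar>indicator {0..L} x * (sawtooth L x * sawtooth L (x - t))\<bar> \<le> indicator {0..L} x * (1 / 4)" for x
      using sawtooth_product_abs_le[of L x "x - t"] by (auto simp: indicator_def)
  qed
  also have "\<dots> = L / 4" using assms by simp
  finally show ?thesis .
qed

text \<open>Multiplying out gives four products, each of which a shift over the period turns into an
  autocorrelation: two at t, one at t + z and one at t - z.\<close>

lemma autocorrelation_expand:
  assumes "0 < L"
  shows "(LINT x|lborel. indicator {0..L} x * ((sawtooth L x - sawtooth L (x + z)) * (sawtooth L (x - t) - sawtooth L (x - t + z)))) =
    second_diff (autocorrelation L) t z"
proof -
  let ?I = "\<lambda>f. LINT x|lborel. indicator {0..L} x * f x" and ?S = "sawtooth L"
  have int: "integrable lborel (\<lambda>x. indicator {0..L} x * (?S (x + a) * ?S (x - b)))" for a b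
    by (rule integrable_indicator_bounded(1)[where B="1 / 4", OF _ sawtooth_product_abs_le]) measurable
  have I: "?I (\<lambda>x. ?S (x + a) * ?S (x - b)) = autocorrelation L (a + b)" for a b
  proof -
    have "(LINT x|lborel. indicator {0..L} x * (?S (x - (- a)) * ?S ((x - (- a)) - (a + b)))) = autocorrelation L (a + b)"
      unfolding autocorrelation_def
    proof (rule integral_period_shift[OF assms, where f="\<lambda>x. ?S x * ?S (x - (a + b))", OF _ _ sawtooth_product_abs_le])
      show "?S (x + L) * ?S (x + L - (a + b)) = ?S x * ?S (x - (a + b))" for x
        using sawtooth_add_period[OF assms, of x] sawtooth_add_period[OF assms, of "x - (a + b)"]
        by (simp add: algebra_simps)
    qed measurable
    then show ?thesis by (simp add: algebra_simps)
  qed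
  have "?I (\<lambda>x. (?S x - ?S (x + z)) * (?S (x - t) - ?S (x - t + z))) =
      (LINT x|lborel. (indicator {0..L} x * (?S (x + 0) * ?S (x - t)) + indicator {0..L} x * (?S (x + z) * ?S (x - (t - z))))
        - (indicator {0..L} x * (?S (x + 0) * ?S (x - (t - z))) + indicator {0..L} x * (?S (x + z) * ?S (x - t))))"
    by (intro Bochner_Integration.integral_cong) (auto simp: algebra_simps)
  also have "\<dots> = (?I (\<lambda>x. ?S (x + 0) * ?S (x - t)) + ?I (\<lambda>x. ?S (x + z) * ?S (x - (t - z))))
      - (?I (\<lambda>x. ?S (x + 0) * ?S (x - (t - z))) + ?I (\<lambda>x. ?S (x + z) * ?S (x - t)))"
    by (simp only: Bochner_Integration.integral_diff Bochner_Integration.integral_add Bochner_Integration.integrable_add int)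
  also have "\<dots> = second_diff (autocorrelation L) t z"
    unfolding I by (simp add: second_diff_def add.commute)
  finally show ?thesis .
qed

lemma second_diff_autocorrelation_core:
  assumes "0 < L" "\<theta> \<le> t" "t \<le> L - \<theta>" "\<bar>z\<bar> < \<theta>"
  shows "second_diff (autocorrelation L) t z = - (z\<^sup>2) / L"
proof -
  have "autocorrelation L t = t\<^sup>2 / (2 * L) - t / 2 + L / 12"
    "autocorrelation L (t + z) = (t + z)\<^sup>2 / (2 * L) - (t + z) / 2 + L / 12"
    "autocorrelation L (t - z) = (t - z)\<^sup>2 / (2 * L) - (t - z) / 2 + L / 12"
    by (rule autocorrelation_eq; use assms in linarith)+
  then show ?thesis using \<open>0 < L\<close> by (simp add: second_diff_def field_simps power2_eq_square)
qed

lemma second_diff_autocorrelation_abs_le: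
  assumes "0 < L"
  shows "\<bar>second_diff (autocorrelation L) t z\<bar> \<le> L"
  using autocorrelation_abs_le[OF assms, of t] autocorrelation_abs_le[OF assms, of "t + z"]
    autocorrelation_abs_le[OF assms, of "t - z"]
  unfolding second_diff_def by linarith

text \<open>The quadratic core contributes 1 / L; elsewhere the global bound L is compared with the
  weight as in \<open>bound_off_core\<close>.\<close>

lemma second_diff_autocorrelation_bound:
  assumes "0 < L" "0 < \<theta>" "\<theta> \<le> t" "t \<le> L - \<theta>"
  shows "\<bar>second_diff (autocorrelation L) t z\<bar> \<le> (1 / L + L / min 1 (\<theta>\<^sup>2)) * min 1 (z\<^sup>2)"
proof (cases "\<bar>z\<bar> < \<theta> \<and> z\<^sup>2 \<le> 1")
  case True
  then have "\<bar>second_diff (autocorrelation L) t z\<bar> = z\<^sup>2 / L"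
    using second_diff_autocorrelation_core[OF assms(1,3,4)] \<open>0 < L\<close> by simp
  also have "\<dots> \<le> z\<^sup>2 / L + L / min 1 (\<theta>\<^sup>2) * z\<^sup>2" using assms by simp
  finally show ?thesis using True by (simp add: algebra_simps min_absorb2)
next
  case False
  have "min 1 (\<theta>\<^sup>2) \<le> min 1 (z\<^sup>2)"
  proof (cases "\<bar>z\<bar> < \<theta>")
    case False
    then have "\<theta>\<^sup>2 \<le> z\<^sup>2" using \<open>0 < \<theta>\<close> by (simp add: abs_le_square_iff[symmetric])
    then show ?thesis by auto
  qed (use False in auto)
  moreover have "0 < min 1 (\<theta>\<^sup>2)" using assms by simp
  ultimately have "L * 1 \<le> L * (min 1 (z\<^sup>2) / min 1 (\<theta>\<^sup>2))" using assms by (intro mult_left_mono) auto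
  moreover have "0 \<le> 1 / L * min 1 (z\<^sup>2)" using assms by simp
  moreover have "(1 / L + L / m) * a = 1 / L * a + L * (a / m)" for m a by (simp add: distrib_right)
  ultimately show ?thesis
    using second_diff_autocorrelation_abs_le[OF \<open>0 < L\<close>, of t z] by (smt (verit))
qed

section \<open>The pair energy and its derivative\<close>

text \<open>Of interest off the lattice. At t = 0 the second difference behaves like |z|, so for s
  \<ge> 1 / 2 the integrand is not integrable and the integral has the default value 0: this is the
  infinite self-energy of a jump.\<close>

definition pair_energy :: "real \<Rightarrow> real \<Rightarrow> real \<Rightarrow> real" where
  "pair_energy L s t = (LINT z|lborel. second_diff (autocorrelation L) t z * kernel s z)"

lemma pair_energy_measurable [measurable]: "pair_energy L s \<in> borel_measurable borel"
  unfolding pair_energy_def[abs_def] by measurable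

lemma pair_energy_integrable:
  assumes "0 < s" "s < 1" "0 < t" "t < L"
  shows "integrable lborel (\<lambda>z. second_diff (autocorrelation L) t z * kernel s z)"
  by (rule kernel_integrable_bound[OF assms(1,2) _ second_diff_autocorrelation_bound[of L "min t (L - t)"]])
    (use assms in auto)

text \<open>Near \<open>t\<close> the second difference is constant in \<open>t\<close> for small \<open>z\<close>, so the singularity of
  the kernel does not enter the difference quotient.\<close>

lemma DERIV_pair_energy:
  assumes s: "0 < s" "s < 1" and t: "0 < t" "t < L"
  shows "(pair_energy L s has_real_derivative interaction L s t) (at t)"
proof -
  have L: "0 < L" using t by simp
  define \<theta> where "\<theta> = min t (L - t) / 2"
  have \<theta>: "0 < \<theta>" "\<theta> < t" "t < L - \<theta>" using t by (auto simp: \<theta>_def min_def field_simps)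
  let ?A = "second_diff (autocorrelation L)" and ?U = "{\<theta><..<L - \<theta>}"
  have "(\<lambda>n. (pair_energy L s (u n) - pair_energy L s t) / (u n - t)) \<longlonglongrightarrow> interaction L s t"
    if u: "\<And>n. u n \<in> ?U - {t}" "u \<longlonglongrightarrow> t" for u
  proof -
    define q where "q n z = (?A (u n) z - ?A t z) / (u n - t)" for n z
    have [measurable]: "q n \<in> borel_measurable borel" for n unfolding q_def[abs_def] by measurable
    have "(\<lambda>n. LINT z|lborel. q n z * kernel s z) \<longlonglongrightarrow> interaction L s t"
      unfolding interaction_def
    proof (rule integral_dominated_convergence[where w="\<lambda>z. (2 / min 1 (\<theta>\<^sup>2)) * (min 1 (z\<^sup>2) * kernel s z)"])
      show "integrable lborel (\<lambda>z. (2 / min 1 (\<theta>\<^sup>2)) * (min 1 (z\<^sup>2) * kernel s z))"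
        using kernel_integrable[OF s] by (rule integrable_mult_right)
      show "AE z in lborel. (\<lambda>n. q n z * kernel s z) \<longlonglongrightarrow> second_diff (sawtooth L) t z * kernel s z"
        using AE_off_lattice[of t L]
      proof eventually_elim
        case (elim z)
        have tl: "t \<notin> range (\<lambda>k. L * real_of_int k)"
        proof
          assume "t \<in> range (\<lambda>k. L * real_of_int k)"
          then obtain k where k: "t = L * of_int k" by auto
          then have "L * 0 < L * real_of_int k" "L * real_of_int k < L * 1" using t by (simp_all only: mult_zero_right mult_1_right)
          then have "0 < real_of_int k" "real_of_int k < 1" using mult_less_cancel_left_pos[OF L] by blast+
          then have "0 < k" "k < 1" by simp_all
          then show False by simp
        qed
        have d0: "(autocorrelation L has_real_derivative sawtooth L t) (at t)" by (rule DERIV_autocorrelation[OF L tl])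
        have d1: "((\<lambda>t. autocorrelation L (t + z)) has_real_derivative sawtooth L (t + z)) (at t)"
          using DERIV_shift[of "autocorrelation L" "sawtooth L (t + z)" t z] DERIV_autocorrelation[OF L, of "t + z"] elim by simp
        have d2: "((\<lambda>t. autocorrelation L (t + (- z))) has_real_derivative sawtooth L (t - z)) (at t)"
          using DERIV_shift[of "autocorrelation L" "sawtooth L (t - z)" t "- z"] DERIV_autocorrelation[OF L, of "t - z"] elim by simp
        have "((\<lambda>t. ?A t z) has_real_derivative second_diff (sawtooth L) t z) (at t)"
          unfolding second_diff_def using DERIV_diff[OF DERIV_diff[OF DERIV_cmult[OF d0, of 2] d1] d2] by simp
        then have "((\<lambda>y. (?A y z - ?A t z) / (y - t)) \<longlongrightarrow> second_diff (sawtooth L) t z) (at t)"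
          by (simp add: has_field_derivative_iff)
        then have "((\<lambda>y. (?A y z - ?A t z) / (y - t)) \<longlongrightarrow> second_diff (sawtooth L) t z) (at t within ?U)"
          by (rule tendsto_within_subset) simp
        then have "(\<lambda>n. q n z) \<longlonglongrightarrow> second_diff (sawtooth L) t z"
          using u unfolding tendsto_at_iff_sequentially q_def comp_def by blast
        then show ?case by (intro tendsto_intros)
      qed
      show "AE z in lborel. norm (q n z * kernel s z) \<le> (2 / min 1 (\<theta>\<^sup>2)) * (min 1 (z\<^sup>2) * kernel s z)" for n
      proof (rule AE_I2)
        fix z
        have un: "u n \<in> ?U" "u n \<noteq> t" using u(1)[of n] by auto
        have "\<bar>q n z\<bar> \<le> (2 / min 1 (\<theta>\<^sup>2)) * min 1 (z\<^sup>2)"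
        proof (rule bound_off_core[OF \<theta>(1)])
          show "q n z = 0" if "\<bar>z\<bar> < \<theta>" for z
            using second_diff_autocorrelation_core[OF L, of \<theta> "u n" z] second_diff_autocorrelation_core[OF L, of \<theta> t z] un \<theta> that
            by (simp add: q_def)
          \<comment> \<open>The Lipschitz constant 1 / 2 of the autocorrelation enters with the
            weights 2, 1 and 1 of the second difference.\<close>
          show "\<bar>q n z\<bar> \<le> 2" for z
          proof -
            have "\<bar>?A (u n) z - ?A t z\<bar> \<le> 2 * \<bar>u n - t\<bar>"
            proof -
              have "\<bar>autocorrelation L (u n + r) - autocorrelation L (t + r)\<bar> \<le> \<bar>u n - t\<bar> / 2" for r
                using autocorrelation_lipschitz[OF L, of "u n + r" "t + r"] by simp
              from this[of 0] this[of z] this[of "- z"] show ?thesis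
                unfolding second_diff_def add_0_right diff_conv_add_uminus[symmetric] by linarith
            qed
            then show ?thesis using un by (simp add: q_def divide_le_eq)
          qed
        qed
        then have "\<bar>q n z\<bar> * kernel s z \<le> (2 / min 1 (\<theta>\<^sup>2)) * min 1 (z\<^sup>2) * kernel s z"
          by (intro mult_right_mono) auto
        then show "norm (q n z * kernel s z) \<le> (2 / min 1 (\<theta>\<^sup>2)) * (min 1 (z\<^sup>2) * kernel s z)"
          by (simp only: real_norm_def abs_mult abs_of_nonneg[OF kernel_nonneg] mult.assoc)
      qed
    qed measurable
    moreover have "(LINT z|lborel. q n z * kernel s z) = (pair_energy L s (u n) - pair_energy L s t) / (u n - t)" for n
    proof -
      have un: "0 < u n" "u n < L" using u(1)[of n] \<theta> by auto
      have "(LINT z|lborel. q n z * kernel s z) = (LINT z|lborel. (?A (u n) z * kernel s z - ?A t z * kernel s z) / (u n - t))"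
        by (simp add: q_def left_diff_distrib diff_divide_distrib)
      also have "\<dots> = (pair_energy L s (u n) - pair_energy L s t) / (u n - t)"
        using Bochner_Integration.integral_diff[OF pair_energy_integrable[OF s un] pair_energy_integrable[OF s t]]
        by (simp add: pair_energy_def)
      finally show ?thesis .
    qed
    ultimately show ?thesis by simp
  qed
  then have "((\<lambda>y. (pair_energy L s y - pair_energy L s t) / (y - t)) \<longlongrightarrow> interaction L s t) (at t within ?U)"
    unfolding tendsto_at_iff_sequentially comp_def by blast
  moreover have "at t within ?U = at t" by (rule at_within_open) (use \<theta> in auto)
  ultimately show ?thesis by (simp add: has_field_derivative_iff)
qed

section \<open>The mollified energy\<close>

definition mollifier_law :: "(real \<Rightarrow> real) \<Rightarrow> real \<Rightarrow> real measure" where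
  "mollifier_law \<rho> \<epsilon> = density lborel (\<lambda>x. ennreal (scaled_mollifier \<rho> \<epsilon> x))"

definition difference_law :: "(real \<Rightarrow> real) \<Rightarrow> real \<Rightarrow> real measure" where
  "difference_law \<rho> \<epsilon> = distr (mollifier_law \<rho> \<epsilon> \<Otimes>\<^sub>M mollifier_law \<rho> \<epsilon>) borel (\<lambda>(a, b). b - a)"

definition mollified_interaction :: "(real \<Rightarrow> real) \<Rightarrow> real \<Rightarrow> real \<Rightarrow> real \<Rightarrow> real \<Rightarrow> real" where
  "mollified_interaction \<rho> \<epsilon> L s t = (LINT \<tau>|difference_law \<rho> \<epsilon>. interaction L s (t + \<tau>))"

locale mollification =
  fixes \<rho> :: "real \<Rightarrow> real" and \<epsilon> L s :: real
  assumes \<rho>: "standard_mollifier \<rho>" and \<epsilon>: "0 < \<epsilon>" and L: "0 < L" and s: "0 < s" "s < 1"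
begin

abbreviation "\<rho>\<^sub>\<epsilon> \<equiv> scaled_mollifier \<rho> \<epsilon>"
abbreviation "\<nu> \<equiv> mollifier_law \<rho> \<epsilon>"
abbreviation "\<mu> \<equiv> difference_law \<rho> \<epsilon>"
abbreviation "S\<^sub>\<epsilon> \<equiv> convolve \<rho>\<^sub>\<epsilon> (sawtooth L)"

lemma mollifier_measurable [measurable]: "\<rho>\<^sub>\<epsilon> \<in> borel_measurable borel"
proof -
  have [measurable]: "\<rho> \<in> borel_measurable borel"
    using \<rho> by (intro smooth_measurable) (simp add: standard_mollifier_def)
  show ?thesis unfolding scaled_mollifier_def[abs_def] by measurable
qed

lemma mollifier_nonneg: "0 \<le> \<rho>\<^sub>\<epsilon> x"
  using \<rho> \<epsilon> by (simp add: standard_mollifier_def scaled_mollifier_def)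

lemma mollifier_vanishes: "\<epsilon> \<le> \<bar>x\<bar> \<Longrightarrow> \<rho>\<^sub>\<epsilon> x = 0"
proof -
  assume "\<epsilon> \<le> \<bar>x\<bar>"
  then have "1 \<le> \<bar>x / \<epsilon>\<bar>" using \<epsilon> by simp
  then have "x / \<epsilon> \<notin> {-1<..<1}" by auto
  then show ?thesis using \<rho> by (simp add: standard_mollifier_def scaled_mollifier_def)
qed

lemma mollifier_integral: "integrable lborel \<rho>\<^sub>\<epsilon>" "(LINT x|lborel. \<rho>\<^sub>\<epsilon> x) = 1"
proof -
  show 1: "(LINT x|lborel. \<rho>\<^sub>\<epsilon> x) = 1"
    using \<rho> \<epsilon> by (subst lborel_integral_real_affine[where c=\<epsilon> and t=0])
      (auto simp: standard_mollifier_def scaled_mollifier_def)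
  show "integrable lborel \<rho>\<^sub>\<epsilon>" using 1 not_integrable_integral_eq by fastforce
qed

lemma sets_mollifier_law [measurable_cong, simp]: "sets \<nu> = sets borel"
  by (simp add: mollifier_law_def)

lemma space_mollifier_law [simp]: "space \<nu> = UNIV"
  by (simp add: mollifier_law_def)

sublocale \<nu>: prob_space \<nu>
proof
  have "emeasure \<nu> (space \<nu>) = (\<integral>\<^sup>+ x. ennreal (\<rho>\<^sub>\<epsilon> x) \<partial>lborel)"
    unfolding mollifier_law_def by (subst emeasure_density) auto
  also have "\<dots> = 1"
    using nn_integral_eq_integral[OF mollifier_integral(1)] mollifier_nonneg mollifier_integral(2) by simp
  finally show "emeasure \<nu> (space \<nu>) = 1" .
qed

lemma measure_mollifier_law_UNIV [simp]: "measure \<nu> UNIV = 1"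
  using \<nu>.prob_space by simp

sublocale \<nu>\<nu>: pair_prob_space \<nu> \<nu> ..

lemma sets_difference_law [measurable_cong, simp]: "sets \<mu> = sets borel"
  by (simp add: difference_law_def)

lemma space_difference_law [simp]: "space \<mu> = UNIV"
  by (simp add: difference_law_def)

sublocale \<mu>: prob_space \<mu>
  unfolding difference_law_def by (rule \<nu>\<nu>.prob_space_distr) simp

lemma measure_difference_law_UNIV [simp]: "measure \<mu> UNIV = 1"
  using \<mu>.prob_space by simp

lemma integral_mollifier_law:
  assumes [measurable]: "f \<in> borel_measurable borel"
  shows "(LINT a|\<nu>. f a) = (LINT a|lborel. \<rho>\<^sub>\<epsilon> a * f a)"
  unfolding mollifier_law_def by (subst integral_density) (auto simp: mollifier_nonneg)

lemma AE_mollifier_law: "AE a in \<nu>. \<bar>a\<bar> \<le> \<epsilon>"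
proof -
  have "\<bar>a\<bar> \<le> \<epsilon>" if "0 < \<rho>\<^sub>\<epsilon> a" for a using mollifier_vanishes[of a] that by force
  then show ?thesis unfolding mollifier_law_def by (subst AE_density) auto
qed

lemma AE_difference_law: "AE \<tau> in \<mu>. \<bar>\<tau>\<bar> \<le> 2 * \<epsilon>"
proof -
  have "AE p in \<nu> \<Otimes>\<^sub>M \<nu>. \<bar>fst p\<bar> \<le> \<epsilon>"
  proof (rule \<nu>\<nu>.AE_pair_measure)
    show "{p \<in> space (\<nu> \<Otimes>\<^sub>M \<nu>). \<bar>fst p\<bar> \<le> \<epsilon>} \<in> sets (\<nu> \<Otimes>\<^sub>M \<nu>)" by measurable
  qed (use AE_mollifier_law in simp)
  moreover have "AE p in \<nu> \<Otimes>\<^sub>M \<nu>. \<bar>snd p\<bar> \<le> \<epsilon>"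
  proof (rule \<nu>\<nu>.AE_pair_measure)
    show "{p \<in> space (\<nu> \<Otimes>\<^sub>M \<nu>). \<bar>snd p\<bar> \<le> \<epsilon>} \<in> sets (\<nu> \<Otimes>\<^sub>M \<nu>)" by measurable
  qed (use AE_mollifier_law in simp)
  ultimately have "AE p in \<nu> \<Otimes>\<^sub>M \<nu>. \<bar>snd p - fst p\<bar> \<le> 2 * \<epsilon>" by eventually_elim auto
  then show ?thesis
    unfolding difference_law_def by (subst AE_distr_iff) (auto simp: case_prod_unfold)
qed

text \<open>Exchanging the two independent points reverses the sign of their difference. This is
  what makes the mollified interaction odd.\<close>

lemma difference_law_symmetric:
  assumes [measurable]: "f \<in> borel_measurable borel"
  shows "(LINT \<tau>|\<mu>. f (- \<tau>)) = (LINT \<tau>|\<mu>. f \<tau> :: real)"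
proof -
  have "(LINT \<tau>|\<mu>. f (- \<tau>)) = (LINT p|(\<nu> \<Otimes>\<^sub>M \<nu>). f (fst p - snd p))"
    unfolding difference_law_def by (subst integral_distr) (auto simp: case_prod_unfold)
  also have "\<dots> = (LINT p|(\<nu> \<Otimes>\<^sub>M \<nu>). f (snd p - fst p))"
    by (subst \<nu>\<nu>.distr_pair_swap, subst integral_distr) (auto simp: case_prod_unfold)
  also have "\<dots> = (LINT \<tau>|\<mu>. f \<tau>)"
    unfolding difference_law_def by (subst integral_distr) (auto simp: case_prod_unfold)
  finally show ?thesis .
qed

lemma integral_difference_law:
  fixes f :: "real \<Rightarrow> real"
  assumes [measurable]: "f \<in> borel_measurable borel" and "\<And>x. \<bar>f x\<bar> \<le> B"
  shows "(LINT a|\<nu>. LINT b|\<nu>. f (b - a)) = (LINT \<tau>|\<mu>. f \<tau>)"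
proof -
  have "integrable (\<nu> \<Otimes>\<^sub>M \<nu>) (\<lambda>(a, b). f (b - a))"
    by (rule \<nu>\<nu>.integrable_const_bound[where B=B]) (use assms in \<open>auto simp: case_prod_unfold\<close>)
  then have "(LINT a|\<nu>. LINT b|\<nu>. f (b - a)) = (LINT p|(\<nu> \<Otimes>\<^sub>M \<nu>). (\<lambda>(a, b). f (b - a)) p)"
    using \<nu>\<nu>.integral_fst'[of "\<lambda>(a, b). f (b - a)"] by simp
  also have "\<dots> = (LINT \<tau>|\<mu>. f \<tau>)"
    unfolding difference_law_def by (subst integral_distr) (auto simp: case_prod_unfold)
  finally show ?thesis .
qed

lemma convolve_eq:
  assumes [measurable]: "f \<in> borel_measurable borel"
  shows "convolve \<rho>\<^sub>\<epsilon> f x = (LINT a|\<nu>. f (x - a))"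
proof -
  have "convolve \<rho>\<^sub>\<epsilon> f x = (LINT a|lborel. \<rho>\<^sub>\<epsilon> a * f (x - a))"
    unfolding convolve_def by (subst lborel_integral_real_affine[where c="-1" and t=x]) auto
  also have "\<dots> = (LINT a|\<nu>. f (x - a))" by (rule integral_mollifier_law[symmetric]) measurable
  finally show ?thesis .
qed

lemma mollified_sawtooth_measurable [measurable]: "S\<^sub>\<epsilon> \<in> borel_measurable borel"
  unfolding convolve_def[abs_def] by measurable

lemma sawtooth_integrable: "integrable \<nu> (\<lambda>a. sawtooth L (x - a))"
  by (rule \<nu>.integrable_const_bound[where B="1 / 2"]) (use sawtooth_abs_le in auto)

lemma mollified_sawtooth_eq: "S\<^sub>\<epsilon> x = (LINT a|\<nu>. sawtooth L (x - a))"
  by (rule convolve_eq) measurable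

lemma mollified_sawtooth_abs_le: "\<bar>S\<^sub>\<epsilon> x\<bar> \<le> 1 / 2"
proof -
  have "\<bar>S\<^sub>\<epsilon> x\<bar> \<le> (LINT a|\<nu>. \<bar>sawtooth L (x - a)\<bar>)" unfolding mollified_sawtooth_eq by (rule integral_abs_bound)
  also have "\<dots> \<le> (LINT a|\<nu>. 1 / 2)"
    by (intro integral_mono integrable_abs sawtooth_integrable sawtooth_abs_le) simp
  finally show ?thesis by simp
qed

lemma mollified_sawtooth_add_period: "S\<^sub>\<epsilon> (x + L) = S\<^sub>\<epsilon> x"
proof -
  have "sawtooth L (x + L - a) = sawtooth L (x - a)" for a
    using sawtooth_add_period[OF L, of "x - a"] by (simp add: algebra_simps)
  then show ?thesis by (simp add: mollified_sawtooth_eq)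
qed

section \<open>Increments of the mollified sawtooth\<close>

lemma mollifier_lipschitz: "\<exists>M\<ge>0. \<forall>u v. \<bar>\<rho>\<^sub>\<epsilon> u - \<rho>\<^sub>\<epsilon> v\<bar> \<le> M * \<bar>u - v\<bar>"
proof -
  have sm: "smooth \<rho>" using \<rho> by (simp add: standard_mollifier_def)
  have "\<rho> x = 0" if "\<bar>x\<bar> > 1" for x
  proof -
    have "x \<notin> {-1<..<1}" using that by auto
    then show ?thesis using \<rho> by (simp add: standard_mollifier_def)
  qed
  then have "test_function \<rho>" using sm unfolding test_function_def by blast
  then obtain R where R: "0 < R" "\<And>x. R \<le> \<bar>x\<bar> \<Longrightarrow> deriv \<rho> x = 0" using test_function_bound by metis
  have "compact (deriv \<rho> ` {- R..R})"
    using smooth_isCont[OF smooth_deriv[OF sm]]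
    by (intro compact_continuous_image continuous_at_imp_continuous_on) auto
  then have "\<exists>K. \<forall>x\<in>{- R..R}. \<bar>deriv \<rho> x\<bar> \<le> K"
    by (auto dest!: compact_imp_bounded simp: bounded_iff)
  then obtain K where K: "\<And>x. x \<in> {- R..R} \<Longrightarrow> \<bar>deriv \<rho> x\<bar> \<le> K" by blast
  have K0: "0 \<le> K" using K[of 0] R(1) by auto
  have Kall: "\<bar>deriv \<rho> x\<bar> \<le> K" for x
  proof (cases "x \<in> {- R..R}")
    case False
    then have "R \<le> \<bar>x\<bar>" by auto
    then show ?thesis using R(2) K0 by simp
  qed (rule K)
  have lip: "\<bar>\<rho> u - \<rho> v\<bar> \<le> K * \<bar>u - v\<bar>" for u v
    using field_differentiable_bound[of UNIV \<rho> "deriv \<rho>" K u v] smooth_differentiable[OF sm] Kall by auto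
  have "\<bar>\<rho>\<^sub>\<epsilon> u - \<rho>\<^sub>\<epsilon> v\<bar> \<le> (K / \<epsilon>\<^sup>2) * \<bar>u - v\<bar>" for u v
  proof -
    have "\<bar>\<rho>\<^sub>\<epsilon> u - \<rho>\<^sub>\<epsilon> v\<bar> = (1 / \<epsilon>) * \<bar>\<rho> (u / \<epsilon>) - \<rho> (v / \<epsilon>)\<bar>"
      using \<epsilon> by (simp add: scaled_mollifier_def diff_divide_distrib[symmetric])
    also have "\<dots> \<le> (1 / \<epsilon>) * (K * \<bar>u / \<epsilon> - v / \<epsilon>\<bar>)" using lip \<epsilon> by (intro mult_left_mono) auto
    also have "\<dots> = (K / \<epsilon>\<^sup>2) * \<bar>u - v\<bar>"
      using \<epsilon> by (simp add: diff_divide_distrib[symmetric] power2_eq_square)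
    finally show ?thesis .
  qed
  then show ?thesis using K0 by (intro exI[of _ "K / \<epsilon>\<^sup>2"]) auto
qed

text \<open>What the mollification buys: increments are O(|z|) uniformly in x, jumps included, so a
  product of two of them is dominated by z^2 near 0 and the energy integral converges, self-energy
  included.\<close>

lemma mollified_sawtooth_lipschitz: "\<exists>K\<ge>0. \<forall>x z. \<bar>z\<bar> \<le> 1 \<longrightarrow> \<bar>S\<^sub>\<epsilon> x - S\<^sub>\<epsilon> (x + z)\<bar> \<le> K * \<bar>z\<bar>"
proof -
  obtain M where M: "0 \<le> M" "\<And>u v. \<bar>\<rho>\<^sub>\<epsilon> u - \<rho>\<^sub>\<epsilon> v\<bar> \<le> M * \<bar>u - v\<bar>" using mollifier_lipschitz by blast
  have int: "integrable lborel (\<lambda>y. \<rho>\<^sub>\<epsilon> (x - y) * sawtooth L y)" for x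
  proof (rule Bochner_Integration.integrable_bound)
    show "integrable lborel (\<lambda>y. \<rho>\<^sub>\<epsilon> (x - y))"
      using lborel_integrable_real_affine[OF mollifier_integral(1), of "-1" x] by simp
    show "AE y in lborel. norm (\<rho>\<^sub>\<epsilon> (x - y) * sawtooth L y) \<le> norm (\<rho>\<^sub>\<epsilon> (x - y))"
    proof (rule AE_I2)
      fix y
      have "\<bar>\<rho>\<^sub>\<epsilon> (x - y)\<bar> * \<bar>sawtooth L y\<bar> \<le> \<bar>\<rho>\<^sub>\<epsilon> (x - y)\<bar> * 1"
        using sawtooth_abs_le[of L y] by (intro mult_left_mono) auto
      then show "norm (\<rho>\<^sub>\<epsilon> (x - y) * sawtooth L y) \<le> norm (\<rho>\<^sub>\<epsilon> (x - y))" by (simp add: abs_mult)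
    qed
  qed measurable
  have "\<bar>S\<^sub>\<epsilon> x - S\<^sub>\<epsilon> (x + z)\<bar> \<le> (M * (\<epsilon> + 1)) * \<bar>z\<bar>" if z: "\<bar>z\<bar> \<le> 1" for x z
  proof -
    \<comment> \<open>For |z| \<le> 1 both shifted mollifiers are supported here; the length 2 *
      (\<epsilon> + 1) times M * |z| / 2 gives the constant.\<close>
    let ?I = "{x - (\<epsilon> + 1)..x + (\<epsilon> + 1)}"
    have "\<bar>S\<^sub>\<epsilon> x - S\<^sub>\<epsilon> (x + z)\<bar> = \<bar>LINT y|lborel. \<rho>\<^sub>\<epsilon> (x - y) * sawtooth L y - \<rho>\<^sub>\<epsilon> (x + z - y) * sawtooth L y\<bar>"
      unfolding convolve_def by (subst Bochner_Integration.integral_diff[OF int int]) simp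
    also have "\<dots> \<le> (LINT y|lborel. \<bar>\<rho>\<^sub>\<epsilon> (x - y) * sawtooth L y - \<rho>\<^sub>\<epsilon> (x + z - y) * sawtooth L y\<bar>)"
      by (rule integral_abs_bound)
    also have "\<dots> \<le> (LINT y|lborel. indicator ?I y * (M * \<bar>z\<bar> / 2))"
    proof (rule integral_mono)
      show "integrable lborel (\<lambda>y. indicator ?I y * (M * \<bar>z\<bar> / 2))"
        by (rule integrable_indicator_bounded(1)[where B="\<bar>M * \<bar>z\<bar> / 2\<bar>"]) auto
      show "\<bar>\<rho>\<^sub>\<epsilon> (x - y) * sawtooth L y - \<rho>\<^sub>\<epsilon> (x + z - y) * sawtooth L y\<bar> \<le> indicator ?I y * (M * \<bar>z\<bar> / 2)" for y
      proof (cases "y \<in> ?I")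
        case True
        have "\<bar>\<rho>\<^sub>\<epsilon> (x - y) - \<rho>\<^sub>\<epsilon> (x + z - y)\<bar> \<le> M * \<bar>z\<bar>" using M(2)[of "x - y" "x + z - y"] by simp
        then have "\<bar>\<rho>\<^sub>\<epsilon> (x - y) - \<rho>\<^sub>\<epsilon> (x + z - y)\<bar> * \<bar>sawtooth L y\<bar> \<le> (M * \<bar>z\<bar>) * (1 / 2)"
          using sawtooth_abs_le[of L y] M(1) by (intro mult_mono) auto
        then show ?thesis using True by (simp add: left_diff_distrib[symmetric] abs_mult)
      next
        case False
        then have "\<epsilon> \<le> \<bar>x - y\<bar>" "\<epsilon> \<le> \<bar>x + z - y\<bar>" using z by auto
        then show ?thesis using False mollifier_vanishes by simp
      qed
    qed (intro integrable_abs Bochner_Integration.integrable_diff int)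
    also have "\<dots> = (M * (\<epsilon> + 1)) * \<bar>z\<bar>" using \<epsilon> by simp
    finally show ?thesis .
  qed
  then show ?thesis using M(1) \<epsilon> by (intro exI[of _ "M * (\<epsilon> + 1)"]) auto
qed

definition "\<delta> z x = S\<^sub>\<epsilon> x - S\<^sub>\<epsilon> (x + z)"

lemma \<delta>_measurable [measurable (raw)]:
  assumes [measurable]: "z \<in> borel_measurable M" "x \<in> borel_measurable M"
  shows "(\<lambda>p. \<delta> (z p) (x p)) \<in> borel_measurable M"
  unfolding \<delta>_def by measurable

lemma \<delta>_abs_le: "\<bar>\<delta> z x\<bar> \<le> 1"
  using mollified_sawtooth_abs_le[of x] mollified_sawtooth_abs_le[of "x + z"] unfolding \<delta>_def by linarith

lemma \<delta>_add_period: "\<delta> z (x + L) = \<delta> z x"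
  using mollified_sawtooth_add_period[of x] mollified_sawtooth_add_period[of "x + z"]
  by (simp add: \<delta>_def algebra_simps)

lemma \<delta>_product_bound: "\<exists>C\<ge>0. \<forall>x y z. \<bar>\<delta> z x * \<delta> z y\<bar> \<le> C * min 1 (z\<^sup>2)"
proof -
  obtain K where K: "0 \<le> K" "\<And>x z. \<bar>z\<bar> \<le> 1 \<Longrightarrow> \<bar>S\<^sub>\<epsilon> x - S\<^sub>\<epsilon> (x + z)\<bar> \<le> K * \<bar>z\<bar>"
    using mollified_sawtooth_lipschitz by blast
  have "\<bar>\<delta> z x * \<delta> z y\<bar> \<le> (K\<^sup>2 + 1) * min 1 (z\<^sup>2)" for x y z
  proof (cases "\<bar>z\<bar> \<le> 1")
    case True
    have "\<bar>\<delta> z x\<bar> * \<bar>\<delta> z y\<bar> \<le> (K * \<bar>z\<bar>) * (K * \<bar>z\<bar>)"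
      using K True by (intro mult_mono) (auto simp: \<delta>_def)
    also have "\<dots> = K\<^sup>2 * z\<^sup>2" by (simp add: power2_eq_square algebra_simps flip: abs_mult)
    also have "\<dots> \<le> (K\<^sup>2 + 1) * z\<^sup>2" by (intro mult_right_mono) auto
    also have "z\<^sup>2 = min 1 (z\<^sup>2)" using True by (simp add: abs_square_le_1 min_absorb2)
    finally show ?thesis by (simp add: abs_mult)
  next
    case False
    then have "1 \<le> z\<^sup>2" using abs_square_le_1[of z] by linarith
    have "\<bar>\<delta> z x\<bar> * \<bar>\<delta> z y\<bar> \<le> 1 * 1" by (intro mult_mono \<delta>_abs_le) auto
    also have "\<dots> \<le> (K\<^sup>2 + 1) * min 1 (z\<^sup>2)" using \<open>1 \<le> z\<^sup>2\<close> by (simp add: min_absorb1)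
    finally show ?thesis by (simp add: abs_mult)
  qed
  then show ?thesis by (intro exI[of _ "K\<^sup>2 + 1"]) (auto intro: add_nonneg_nonneg)
qed

definition "cross_correlation z t = (LINT x|lborel. indicator {0..L} x * (\<delta> z x * \<delta> z (x - t)))"

text \<open>Both mollified increments are averages over independent displacements a and b of the
  plain sawtooth. Integrating over x first and shifting by a leaves only the relative displacement b
  - a.\<close>

lemma cross_correlation_eq: "cross_correlation z t = (LINT \<tau>|\<mu>. second_diff (autocorrelation L) (t + \<tau>) z)"
proof -
  interpret P: pair_sigma_finite lborel \<nu> ..
  define \<sigma> where "\<sigma> x = sawtooth L x - sawtooth L (x + z)" for x
  have [measurable]: "\<sigma> \<in> borel_measurable borel" unfolding \<sigma>_def[abs_def] by measurable
  have \<sigma>1: "\<bar>\<sigma> x\<bar> \<le> 1" for x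
    using sawtooth_abs_le[of L x] sawtooth_abs_le[of L "x + z"] unfolding \<sigma>_def by linarith
  have \<sigma>per: "\<sigma> (x + L) = \<sigma> x" for x
    using sawtooth_add_period[OF L, of x] sawtooth_add_period[OF L, of "x + z"] by (simp add: \<sigma>_def algebra_simps)
  have \<delta>\<sigma>: "\<delta> z x = (LINT a|\<nu>. \<sigma> (x - a))" for x
  proof -
    have "\<delta> z x = (LINT a|\<nu>. sawtooth L (x - a) - sawtooth L (x + z - a))"
      unfolding \<delta>_def mollified_sawtooth_eq
      by (rule Bochner_Integration.integral_diff[symmetric]) (rule sawtooth_integrable)+
    then show ?thesis by (simp add: \<sigma>_def algebra_simps)
  qed
  have prod1: "\<bar>a * b\<bar> \<le> 1" if "\<bar>a\<bar> \<le> 1" "\<bar>b\<bar> \<le> 1" for a b :: real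
    using mult_mono[OF that] by (simp add: abs_mult)
  have swap: "(LINT x|lborel. indicator {0..L} x * (LINT a|\<nu>. f x a)) = (LINT a|\<nu>. LINT x|lborel. indicator {0..L} x * f x a)"
    if [measurable]: "case_prod f \<in> borel_measurable (borel \<Otimes>\<^sub>M borel)" and b: "\<And>x a. \<bar>f x a\<bar> \<le> 1" for f :: "real \<Rightarrow> real \<Rightarrow> real"
  proof -
    have "integrable (lborel \<Otimes>\<^sub>M \<nu>) (\<lambda>(x, a). indicator {0..L} x * f x a)"
    proof (rule P.integrable_product_bound[where g="\<lambda>x. indicator {0..L} x * 1" and w="\<lambda>_. 1"])
      show "integrable lborel (\<lambda>x. indicator {0..L} x * (1::real))"
        by (rule integrable_indicator_bounded(1)[where B=1]) auto
      show "\<bar>case (x, a) of (x, a) \<Rightarrow> indicator {0..L} x * f x a\<bar> \<le> indicator {0..L} x * 1 * 1" for x a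
        using b[of x a] by (auto simp: indicator_def)
    qed (simp_all, measurable)
    from P.Fubini_integral[OF this] show ?thesis by simp
  qed
  have "cross_correlation z t = (LINT x|lborel. indicator {0..L} x * (LINT a|\<nu>. \<sigma> (x - a) * \<delta> z (x - t)))"
    unfolding cross_correlation_def by (subst \<delta>\<sigma>) simp
  also have "\<dots> = (LINT a|\<nu>. LINT x|lborel. indicator {0..L} x * (\<sigma> (x - a) * \<delta> z (x - t)))"
    by (rule swap) (measurable, intro prod1 \<sigma>1 \<delta>_abs_le)
  also have "\<dots> = (LINT a|\<nu>. LINT b|\<nu>. second_diff (autocorrelation L) (t + (b - a)) z)"
  proof (rule Bochner_Integration.integral_cong[OF refl])
    fix a
    have "(LINT x|lborel. indicator {0..L} x * (\<sigma> (x - a) * \<delta> z (x - t))) =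
        (LINT x|lborel. indicator {0..L} x * (\<sigma> (x - a) * \<delta> z (x - a + a - t)))" by simp
    also have "\<dots> = (LINT x|lborel. indicator {0..L} x * (\<sigma> x * \<delta> z (x + a - t)))"
    proof (rule integral_period_shift[OF L, where f="\<lambda>x. \<sigma> x * \<delta> z (x + a - t)" and B=1])
      show "\<sigma> (x + L) * \<delta> z (x + L + a - t) = \<sigma> x * \<delta> z (x + a - t)" for x
        using \<sigma>per[of x] \<delta>_add_period[of z "x + a - t"] by (simp add: algebra_simps)
    qed (measurable, intro prod1 \<sigma>1 \<delta>_abs_le)
    also have "\<dots> = (LINT x|lborel. indicator {0..L} x * (LINT b|\<nu>. \<sigma> x * \<sigma> (x + a - t - b)))"
      by (simp add: \<delta>\<sigma>)
    also have "\<dots> = (LINT b|\<nu>. LINT x|lborel. indicator {0..L} x * (\<sigma> x * \<sigma> (x + a - t - b)))"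
      by (rule swap) (measurable, intro prod1 \<sigma>1)
    also have "\<dots> = (LINT b|\<nu>. second_diff (autocorrelation L) (t + (b - a)) z)"
    proof (rule Bochner_Integration.integral_cong[OF refl])
      fix b
      show "(LINT x|lborel. indicator {0..L} x * (\<sigma> x * \<sigma> (x + a - t - b))) = second_diff (autocorrelation L) (t + (b - a)) z"
        unfolding autocorrelation_expand[OF L, symmetric] by (simp add: \<sigma>_def algebra_simps)
    qed
    finally show "(LINT x|lborel. indicator {0..L} x * (\<sigma> (x - a) * \<delta> z (x - t))) =
        (LINT b|\<nu>. second_diff (autocorrelation L) (t + (b - a)) z)" .
  qed
  also have "\<dots> = (LINT \<tau>|\<mu>. second_diff (autocorrelation L) (t + \<tau>) z)"
    by (rule integral_difference_law[where f="\<lambda>\<tau>. second_diff (autocorrelation L) (t + \<tau>) z"])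
      (measurable, rule second_diff_autocorrelation_abs_le[OF L])
  finally show ?thesis .
qed

lemma cross_correlation_minus: "cross_correlation z (- t) = cross_correlation z t"
proof -
  have "(LINT x|lborel. indicator {0..L} x * (\<delta> z (x - t) * \<delta> z (x - t + t))) =
      (LINT x|lborel. indicator {0..L} x * (\<delta> z x * \<delta> z (x + t)))"
  proof (rule integral_period_shift[OF L, where f="\<lambda>x. \<delta> z x * \<delta> z (x + t)" and B=1])
    show "\<delta> z (x + L) * \<delta> z (x + L + t) = \<delta> z x * \<delta> z (x + t)" for x
      using \<delta>_add_period[of z x] \<delta>_add_period[of z "x + t"] by (simp add: algebra_simps)
    show "\<bar>\<delta> z x * \<delta> z (x + t)\<bar> \<le> 1" for x
      using mult_mono[OF \<delta>_abs_le \<delta>_abs_le] by (simp add: abs_mult)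
  qed measurable
  then show ?thesis by (simp add: cross_correlation_def mult.commute)
qed

end

lemma bounded_on_compact:
  fixes f :: "real \<Rightarrow> real"
  assumes "continuous_on {a..b} f"
  obtains B where "0 \<le> B" "\<And>x. x \<in> {a..b} \<Longrightarrow> \<bar>f x\<bar> \<le> B"
proof -
  have "\<exists>B. \<forall>x\<in>{a..b}. \<bar>f x\<bar> \<le> B"
    using compact_imp_bounded[OF compact_continuous_image[OF assms compact_Icc]] by (auto simp: bounded_iff)
  then obtain B where "\<forall>x\<in>{a..b}. \<bar>f x\<bar> \<le> B" by blast
  then show ?thesis by (intro that[of "\<bar>B\<bar>"]) force+
qed

context mollification
begin

text \<open>Defined through mollified increments, so that the integrals converge at every t, in
  particular at t = 0. The form as an average of pair energies is proved at distance more than 2 *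
  \<epsilon> from the ends of the cell.\<close>

definition "mutual_energy t = (LINT z|lborel. cross_correlation z t * kernel s z)"

lemma mutual_energy_minus: "mutual_energy (- t) = mutual_energy t"
  by (simp add: mutual_energy_def cross_correlation_minus)

lemma mutual_energy_eq:
  assumes t: "2 * \<epsilon> < t" "t < L - 2 * \<epsilon>"
  shows "mutual_energy t = (LINT \<tau>|\<mu>. pair_energy L s (t + \<tau>))"
proof -
  interpret P: pair_sigma_finite \<mu> lborel ..
  \<comment> \<open>The margin to the ends of the cell that is left after a displacement by at most
    2 * \<epsilon>.\<close>
  define \<theta> where "\<theta> = min (t - 2 * \<epsilon>) (L - 2 * \<epsilon> - t)"
  have \<theta>: "0 < \<theta>" "\<theta> \<le> t - 2 * \<epsilon>" "\<theta> \<le> L - 2 * \<epsilon> - t" using t by (auto simp: \<theta>_def)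
  let ?C = "1 / L + L / min 1 (\<theta>\<^sup>2)" and ?I = "{- (2 * \<epsilon>)..2 * \<epsilon>}"
  let ?D = "second_diff (autocorrelation L)"
  \<comment> \<open>The cutoff alters f only on a null set of the difference law. It keeps t +
    \<tau> inside the cell for all \<tau>, so the product majorant holds pointwise, as
    \<open>integrable_product_bound\<close> requires.\<close>
  define f where "f \<tau> z = indicator ?I \<tau> * ?D (t + \<tau>) z * kernel s z" for \<tau> z
  have [measurable]: "case_prod f \<in> borel_measurable (borel \<Otimes>\<^sub>M borel)"
    unfolding f_def by measurable
  have C: "0 \<le> ?C" using L \<theta> by simp
  have int: "integrable (\<mu> \<Otimes>\<^sub>M lborel) (case_prod f)"
  proof (rule P.integrable_product_bound[where g="\<lambda>_. ?C" and w="\<lambda>z. min 1 (z\<^sup>2) * kernel s z"])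
    show "integrable lborel (\<lambda>z. min 1 (z\<^sup>2) * kernel s z)" by (rule kernel_integrable[OF s])
    fix \<tau> z
    have "\<bar>indicator ?I \<tau> * ?D (t + \<tau>) z\<bar> \<le> ?C * min 1 (z\<^sup>2)"
    proof (cases "\<tau> \<in> ?I")
      case True
      then show ?thesis using second_diff_autocorrelation_bound[OF L \<theta>(1), of "t + \<tau>" z] \<theta> by auto
    qed (use C in simp)
    then have "\<bar>indicator ?I \<tau> * ?D (t + \<tau>) z\<bar> * kernel s z \<le> ?C * min 1 (z\<^sup>2) * kernel s z"
      by (rule mult_right_mono) simp
    then show "\<bar>case (\<tau>, z) of (\<tau>, z) \<Rightarrow> f \<tau> z\<bar> \<le> ?C * (min 1 (z\<^sup>2) * kernel s z)"
      by (simp only: f_def split abs_mult abs_of_nonneg[OF kernel_nonneg] mult.assoc)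
  qed (simp, measurable)
  have "mutual_energy t = (LINT z|lborel. LINT \<tau>|\<mu>. f \<tau> z)"
    unfolding mutual_energy_def
  proof (rule Bochner_Integration.integral_cong[OF refl])
    fix z
    have "cross_correlation z t * kernel s z = (LINT \<tau>|\<mu>. ?D (t + \<tau>) z * kernel s z)"
      unfolding cross_correlation_eq by simp
    also have "\<dots> = (LINT \<tau>|\<mu>. f \<tau> z)"
    proof (rule integral_cong_AE)
      show "AE \<tau> in \<mu>. ?D (t + \<tau>) z * kernel s z = f \<tau> z"
        using AE_difference_law by eventually_elim (auto simp: f_def indicator_def abs_le_iff)
    qed (unfold f_def, measurable)
    finally show "cross_correlation z t * kernel s z = (LINT \<tau>|\<mu>. f \<tau> z)" .
  qed
  also have "\<dots> = (LINT \<tau>|\<mu>. LINT z|lborel. f \<tau> z)" by (rule P.Fubini_integral[OF int])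
  also have "\<dots> = (LINT \<tau>|\<mu>. pair_energy L s (t + \<tau>))"
  proof (rule integral_cong_AE)
    show "AE \<tau> in \<mu>. (LINT z|lborel. f \<tau> z) = pair_energy L s (t + \<tau>)"
      using AE_difference_law
      by eventually_elim (auto simp: f_def pair_energy_def indicator_def abs_le_iff intro!: Bochner_Integration.integral_cong)
  qed measurable
  finally show ?thesis .
qed

text \<open>Differentiation under the integral over displacements. The displaced points lie in a
  compact ?K inside the cell, where the interaction is bounded by B; by the mean value inequality B
  dominates all difference quotients.\<close>

lemma DERIV_mutual_energy:
  assumes t: "2 * \<epsilon> < t" "t < L - 2 * \<epsilon>"
  shows "(mutual_energy has_real_derivative mollified_interaction \<rho> \<epsilon> L s t) (at t)"
proof -
  define \<theta> where "\<theta> = min (t - 2 * \<epsilon>) (L - 2 * \<epsilon> - t) / 2"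
  have \<theta>: "0 < \<theta>" "\<theta> < t - 2 * \<epsilon>" "\<theta> < L - 2 * \<epsilon> - t" using t by (auto simp: \<theta>_def min_def)
  let ?U = "{2 * \<epsilon> + \<theta><..<L - 2 * \<epsilon> - \<theta>}" and ?K = "{\<theta>..L - \<theta>}"
  let ?g = "pair_energy L s" and ?h = "interaction L s"
  have in_K: "x + \<tau> \<in> ?K" if "x \<in> ?U" "\<bar>\<tau>\<bar> \<le> 2 * \<epsilon>" for x \<tau>
    using that by (auto simp: abs_le_iff)
  have tU: "t \<in> ?U" using \<theta> by auto
  have dg: "(?g has_real_derivative ?h x) (at x)" if "x \<in> ?K" for x
    using that \<theta> by (intro DERIV_pair_energy s) auto
  have "continuous_on ?K ?h"
    by (rule continuous_on_subset[OF continuous_on_interaction[OF s, of L]]) (use \<theta> in auto)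
  then obtain B where B: "0 \<le> B" "\<And>x. x \<in> ?K \<Longrightarrow> \<bar>?h x\<bar> \<le> B"
    using bounded_on_compact by blast
  have "continuous_on ?K ?g" by (intro continuous_at_imp_continuous_on ballI DERIV_isCont[OF dg])
  then obtain B' where B': "0 \<le> B'" "\<And>x. x \<in> ?K \<Longrightarrow> \<bar>?g x\<bar> \<le> B'" using bounded_on_compact by blast
  have gi: "integrable \<mu> (\<lambda>\<tau>. ?g (x + \<tau>))" if x: "x \<in> ?U" for x
  proof (rule \<mu>.integrable_const_bound[where B=B'])
    show "AE \<tau> in \<mu>. norm (?g (x + \<tau>)) \<le> B'"
      using AE_difference_law by eventually_elim (use in_K[OF x] B'(2) in auto)
  qed measurable
  have me: "mutual_energy x = (LINT \<tau>|\<mu>. ?g (x + \<tau>))" if "x \<in> ?U" for x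
    using that \<theta> by (intro mutual_energy_eq) auto
  have "(\<lambda>n. (mutual_energy (u n) - mutual_energy t) / (u n - t)) \<longlonglongrightarrow> mollified_interaction \<rho> \<epsilon> L s t"
    if u: "\<And>n. u n \<in> ?U - {t}" "u \<longlonglongrightarrow> t" for u
  proof -
    have "(\<lambda>n. LINT \<tau>|\<mu>. (?g (u n + \<tau>) - ?g (t + \<tau>)) / (u n - t)) \<longlonglongrightarrow> mollified_interaction \<rho> \<epsilon> L s t"
      unfolding mollified_interaction_def
    proof (rule integral_dominated_convergence[where w="\<lambda>_. B"])
      show "AE \<tau> in \<mu>. (\<lambda>n. (?g (u n + \<tau>) - ?g (t + \<tau>)) / (u n - t)) \<longlonglongrightarrow> ?h (t + \<tau>)"
        using AE_difference_law
      proof eventually_elim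
        case (elim \<tau>)
        have "((\<lambda>x. ?g (x + \<tau>)) has_real_derivative ?h (t + \<tau>)) (at t)"
          using DERIV_shift[of ?g "?h (t + \<tau>)" t \<tau>] dg[OF in_K[OF tU elim]] by simp
        then have "((\<lambda>x. (?g (x + \<tau>) - ?g (t + \<tau>)) / (x - t)) \<longlongrightarrow> ?h (t + \<tau>)) (at t)"
          by (simp add: has_field_derivative_iff)
        then have "((\<lambda>x. (?g (x + \<tau>) - ?g (t + \<tau>)) / (x - t)) \<longlongrightarrow> ?h (t + \<tau>)) (at t within ?U)"
          by (rule tendsto_within_subset) simp
        then show ?case using u unfolding tendsto_at_iff_sequentially comp_def by blast
      qed
      show "AE \<tau> in \<mu>. norm ((?g (u n + \<tau>) - ?g (t + \<tau>)) / (u n - t)) \<le> B" for n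
        using AE_difference_law
      proof eventually_elim
        case (elim \<tau>)
        have un: "u n \<in> ?U" "u n \<noteq> t" using u(1)[of n] by auto
        have "norm (?g (u n + \<tau>) - ?g (t + \<tau>)) \<le> B * norm ((u n + \<tau>) - (t + \<tau>))"
        proof (rule field_differentiable_bound[of ?K])
          show "(?g has_field_derivative ?h z) (at z within ?K)" if "z \<in> ?K" for z
            using dg[OF that] by (rule has_field_derivative_at_within)
        qed (use B in_K[OF un(1) elim] in_K[OF tU elim] in auto)
        then show ?case using un by (simp add: divide_le_eq)
      qed
    qed simp_all
    moreover have eq: "(LINT \<tau>|\<mu>. (?g (u n + \<tau>) - ?g (t + \<tau>)) / (u n - t)) = (mutual_energy (u n) - mutual_energy t) / (u n - t)" for n
    proof -
      have un: "u n \<in> ?U" using u(1)[of n] by auto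
      show ?thesis
        using Bochner_Integration.integral_diff[OF gi[OF un] gi[OF tU]] by (simp add: me[OF un] me[OF tU])
    qed
    ultimately show ?thesis unfolding eq by simp
  qed
  then have "((\<lambda>y. (mutual_energy y - mutual_energy t) / (y - t)) \<longlongrightarrow> mollified_interaction \<rho> \<epsilon> L s t) (at t within ?U)"
    unfolding tendsto_at_iff_sequentially comp_def by blast
  moreover have "at t within ?U = at t" by (rule at_within_open) (use tU in auto)
  ultimately show ?thesis by (simp add: has_field_derivative_iff)
qed

lemma mollified_interaction_minus: "mollified_interaction \<rho> \<epsilon> L s (- t) = - mollified_interaction \<rho> \<epsilon> L s t"
proof -
  have "mollified_interaction \<rho> \<epsilon> L s (- t) = (LINT \<tau>|\<mu>. interaction L s (- t + (- \<tau>)))"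
    unfolding mollified_interaction_def by (rule difference_law_symmetric[symmetric]) measurable
  also have "\<dots> = (LINT \<tau>|\<mu>. - interaction L s (t + \<tau>))"
    using interaction_minus[of L s "t + \<tau>" for \<tau>] by (intro Bochner_Integration.integral_cong) auto
  finally show ?thesis by (simp add: mollified_interaction_def)
qed

lemma mollified_interaction_add_period: "mollified_interaction \<rho> \<epsilon> L s (t + L) = mollified_interaction \<rho> \<epsilon> L s t"
proof -
  have "interaction L s (t + L + \<tau>) = interaction L s (t + \<tau>)" for \<tau>
    using interaction_add_period[OF L, of s "t + \<tau>"] by (simp add: algebra_simps)
  then show ?thesis by (simp add: mollified_interaction_def)
qed

lemma interaction_shift_integrable:
  assumes t: "2 * \<epsilon> < t" "t < L - 2 * \<epsilon>"
  shows "integrable \<mu> (\<lambda>\<tau>. interaction L s (t + \<tau>))"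
proof -
  have "continuous_on {t - 2 * \<epsilon>..t + 2 * \<epsilon>} (interaction L s)"
    by (rule continuous_on_subset[OF continuous_on_interaction[OF s, of L]]) (use t in auto)
  then obtain B where B: "\<And>x. x \<in> {t - 2 * \<epsilon>..t + 2 * \<epsilon>} \<Longrightarrow> \<bar>interaction L s x\<bar> \<le> B"
    using bounded_on_compact by blast
  show ?thesis
  proof (rule \<mu>.integrable_const_bound[where B=B])
    show "AE \<tau> in \<mu>. norm (interaction L s (t + \<tau>)) \<le> B"
      using AE_difference_law by eventually_elim (use B in \<open>auto simp: abs_le_iff\<close>)
  qed measurable
qed

text \<open>Each displacement moves a and b together and keeps their distance, so averaging
  preserves the modulus; it does not depend on \<epsilon>.\<close>

lemma mollified_interaction_strongly_mono:
  assumes "2 * \<epsilon> < b" "b \<le> a" "a < L - 2 * \<epsilon>"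
  shows "L powr (- 1 - 2 * s) * (a - b) \<le> mollified_interaction \<rho> \<epsilon> L s a - mollified_interaction \<rho> \<epsilon> L s b"
proof -
  have ia: "integrable \<mu> (\<lambda>\<tau>. interaction L s (a + \<tau>))" and ib: "integrable \<mu> (\<lambda>\<tau>. interaction L s (b + \<tau>))"
    using assms by (auto intro!: interaction_shift_integrable)
  have "L powr (- 1 - 2 * s) * (a - b) = (LINT \<tau>|\<mu>. L powr (- 1 - 2 * s) * (a - b))" by simp
  also have "\<dots> \<le> (LINT \<tau>|\<mu>. interaction L s (a + \<tau>) - interaction L s (b + \<tau>))"
  proof (rule integral_mono_AE)
    show "AE \<tau> in \<mu>. L powr (- 1 - 2 * s) * (a - b) \<le> interaction L s (a + \<tau>) - interaction L s (b + \<tau>)"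
      using AE_difference_law
    proof eventually_elim
      case (elim \<tau>)
      then show ?case using interaction_strongly_mono[OF s, of "b + \<tau>" "a + \<tau>" L] assms by (auto simp: abs_le_iff)
    qed
  qed (use ia ib in auto)
  also have "\<dots> = mollified_interaction \<rho> \<epsilon> L s a - mollified_interaction \<rho> \<epsilon> L s b"
    unfolding mollified_interaction_def by (rule Bochner_Integration.integral_diff[OF ia ib])
  finally show ?thesis .
qed

lemma mollified_interaction_close:
  assumes t: "2 * \<epsilon> < t" "t < L - 2 * \<epsilon>"
    and close: "\<And>\<tau>. \<bar>\<tau>\<bar> \<le> 2 * \<epsilon> \<Longrightarrow> \<bar>interaction L s (t + \<tau>) - interaction L s t\<bar> \<le> \<eta>"
  shows "\<bar>mollified_interaction \<rho> \<epsilon> L s t - interaction L s t\<bar> \<le> \<eta>"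
proof -
  note int = interaction_shift_integrable[OF t]
  have "mollified_interaction \<rho> \<epsilon> L s t - interaction L s t = (LINT \<tau>|\<mu>. interaction L s (t + \<tau>) - interaction L s t)"
    using int by (simp add: mollified_interaction_def)
  also have "\<bar>\<dots>\<bar> \<le> (LINT \<tau>|\<mu>. \<bar>interaction L s (t + \<tau>) - interaction L s t\<bar>)" by (rule integral_abs_bound)
  also have "\<dots> \<le> (LINT \<tau>|\<mu>. \<eta>)"
  proof (rule integral_mono_AE)
    show "AE \<tau> in \<mu>. \<bar>interaction L s (t + \<tau>) - interaction L s t\<bar> \<le> \<eta>"
      using AE_difference_law by eventually_elim (rule close)
  qed (use int in auto)
  finally show ?thesis by simp
qed

end

section \<open>Energy and gradient of a configuration\<close>

text \<open>The additive constant of the potential cancels in increments, and the squared increment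
  of the sum of sawtooths expands over pairs. Fubini, justified by the bound on products of
  increments, integrates over x first, and a shift by X $ i leaves a function of X $ j - X $
  i.\<close>

lemma mollified_energy_eq:
  fixes X :: "real ^ 'n::finite"
  assumes "mollification \<rho> \<epsilon> (real CARD('n)) s"
  shows "mollified_energy \<rho> s \<epsilon> X =
    1 / 2 * (\<Sum>i\<in>UNIV. \<Sum>j\<in>UNIV. mollification.mutual_energy \<rho> \<epsilon> (real CARD('n)) s (X $ j - X $ i))"
proof -
  interpret mollification \<rho> \<epsilon> "real CARD('n)" s by (rule assms)
  let ?L = "real CARD('n)"
  obtain c where c: "AE x in lborel. potential X x = config_sawtooth X x + c" using potential_AE[OF \<rho>] .
  define v where "v = convolve \<rho>\<^sub>\<epsilon> (potential X)"
  have v: "v x = c + (\<Sum>i\<in>UNIV. S\<^sub>\<epsilon> (x - X $ i))" for x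
  proof -
    have "v x = convolve \<rho>\<^sub>\<epsilon> (\<lambda>x. config_sawtooth X x + c) x"
      unfolding v_def convolve_def
      by (rule integral_cong_AE) (use c in \<open>auto elim!: eventually_mono\<close>)
    also have "\<dots> = (LINT a|\<nu>. config_sawtooth X (x - a) + c)" by (rule convolve_eq) measurable
    also have "\<dots> = (LINT a|\<nu>. (\<Sum>i\<in>UNIV. sawtooth ?L (x - X $ i - a)) + c)"
      by (simp add: config_sawtooth_def algebra_simps)
    also have "\<dots> = (\<Sum>i\<in>UNIV. S\<^sub>\<epsilon> (x - X $ i)) + c"
      using sawtooth_integrable by (simp add: mollified_sawtooth_eq)
    finally show ?thesis by simp
  qed
  obtain C where C: "0 \<le> C" "\<And>x y z. \<bar>\<delta> z x * \<delta> z y\<bar> \<le> C * min 1 (z\<^sup>2)" using \<delta>_product_bound by blast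
  define f where "f i j x z = indicator {0..?L} x * (\<delta> z (x - X $ i) * \<delta> z (x - X $ j)) * kernel s z" for i j x z
  have [measurable]: "case_prod (f i j) \<in> borel_measurable (borel \<Otimes>\<^sub>M borel)" for i j
    unfolding f_def by measurable
  have fi: "integrable lborel (f i j x)" for i j x
  proof -
    have "integrable lborel (\<lambda>z. (\<delta> z (x - X $ i) * \<delta> z (x - X $ j)) * kernel s z)"
      by (rule kernel_integrable_bound[OF s _ C(2)]) measurable
    then have "integrable lborel (\<lambda>z. indicator {0..?L} x * ((\<delta> z (x - X $ i) * \<delta> z (x - X $ j)) * kernel s z))"
      by (rule integrable_mult_right)
    then show ?thesis unfolding f_def by (simp only: mult.assoc)
  qed
  have fpair: "integrable (lborel \<Otimes>\<^sub>M lborel) (case_prod (f i j))" for i j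
  proof (rule lborel_pair.integrable_product_bound[where g="\<lambda>x. indicator {0..?L} x * C" and w="\<lambda>z. min 1 (z\<^sup>2) * kernel s z"])
    show "integrable lborel (\<lambda>x. indicator {0..?L} x * C)"
      by (rule integrable_indicator_bounded(1)[where B="\<bar>C\<bar>"]) auto
    show "integrable lborel (\<lambda>z. min 1 (z\<^sup>2) * kernel s z)" by (rule kernel_integrable[OF s])
    show "\<bar>case (x, z) of (x, z) \<Rightarrow> f i j x z\<bar> \<le> indicator {0..?L} x * C * (min 1 (z\<^sup>2) * kernel s z)" for x z
    proof -
      have "\<bar>\<delta> z (x - X $ i) * \<delta> z (x - X $ j)\<bar> * kernel s z \<le> C * min 1 (z\<^sup>2) * kernel s z"
        by (rule mult_right_mono[OF C(2)]) simp
      then show ?thesis by (auto simp: f_def indicator_def abs_mult mult.assoc)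
    qed
  qed measurable
  have inner: "indicator {0..?L} x *\<^sub>R (LINT y|lborel. \<bar>v x - v y\<bar>\<^sup>2 / \<bar>x - y\<bar> powr (1 + 2 * s)) =
      (\<Sum>i\<in>UNIV. \<Sum>j\<in>UNIV. LINT z|lborel. f i j x z)" for x
  proof -
    have "(LINT y|lborel. \<bar>v x - v y\<bar>\<^sup>2 / \<bar>x - y\<bar> powr (1 + 2 * s)) =
        (LINT z|lborel. \<bar>v x - v (x + z)\<bar>\<^sup>2 / \<bar>x - (x + z)\<bar> powr (1 + 2 * s))"
      by (subst lborel_integral_real_affine[where c=1 and t=x]) auto
    then have "indicator {0..?L} x *\<^sub>R (LINT y|lborel. \<bar>v x - v y\<bar>\<^sup>2 / \<bar>x - y\<bar> powr (1 + 2 * s)) =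
        (LINT z|lborel. indicator {0..?L} x * (\<bar>v x - v (x + z)\<bar>\<^sup>2 / \<bar>x - (x + z)\<bar> powr (1 + 2 * s)))"
      by (simp only: real_scaleR_def Bochner_Integration.integral_mult_right_zero)
    also have "\<dots> = (LINT z|lborel. (\<Sum>i\<in>UNIV. \<Sum>j\<in>UNIV. f i j x z))"
    proof (rule Bochner_Integration.integral_cong[OF refl])
      fix z
      have "v x - v (x + z) = (\<Sum>i\<in>UNIV. \<delta> z (x - X $ i))"
        by (simp add: v \<delta>_def sum_subtractf algebra_simps)
      then have "\<bar>v x - v (x + z)\<bar>\<^sup>2 = (\<Sum>i\<in>UNIV. \<Sum>j\<in>UNIV. \<delta> z (x - X $ i) * \<delta> z (x - X $ j))"
        by (simp add: power2_eq_square sum_product)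
      then show "indicator {0..?L} x * (\<bar>v x - v (x + z)\<bar>\<^sup>2 / \<bar>x - (x + z)\<bar> powr (1 + 2 * s)) =
          (\<Sum>i\<in>UNIV. \<Sum>j\<in>UNIV. f i j x z)"
        by (simp add: f_def kernel_def sum_distrib_left sum_distrib_right sum_divide_distrib mult.assoc)
    qed
    also have "\<dots> = (\<Sum>i\<in>UNIV. \<Sum>j\<in>UNIV. LINT z|lborel. f i j x z)"
      using fi by simp
    finally show ?thesis .
  qed
  have "mollified_energy \<rho> s \<epsilon> X = 1 / 2 * (LINT x|lborel. (\<Sum>i\<in>UNIV. \<Sum>j\<in>UNIV. LINT z|lborel. f i j x z))"
    unfolding mollified_energy_def Let_def v_def[symmetric] set_lebesgue_integral_def inner ..
  also have "(LINT x|lborel. (\<Sum>i\<in>UNIV. \<Sum>j\<in>UNIV. LINT z|lborel. f i j x z)) =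
      (\<Sum>i\<in>UNIV. \<Sum>j\<in>UNIV. LINT x|lborel. LINT z|lborel. f i j x z)"
    using lborel_pair.integrable_fst[OF fpair] by simp
  also have "\<dots> = (\<Sum>i\<in>UNIV. \<Sum>j\<in>UNIV. mutual_energy (X $ j - X $ i))"
  proof (intro sum.cong refl)
    fix i j
    have "(LINT x|lborel. LINT z|lborel. f i j x z) = (LINT z|lborel. LINT x|lborel. f i j x z)"
      by (rule lborel_pair.Fubini_integral[OF fpair, symmetric])
    also have "\<dots> = mutual_energy (X $ j - X $ i)"
      unfolding mutual_energy_def
    proof (rule Bochner_Integration.integral_cong[OF refl])
      fix z
      have "(LINT x|lborel. indicator {0..?L} x * (\<delta> z (x - X $ i) * \<delta> z (x - X $ i - (X $ j - X $ i)))) = cross_correlation z (X $ j - X $ i)"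
        unfolding cross_correlation_def
      proof (rule integral_period_shift[OF L, where f="\<lambda>x. \<delta> z x * \<delta> z (x - (X $ j - X $ i))" and B=1])
        show "\<delta> z (x + ?L) * \<delta> z (x + ?L - (X $ j - X $ i)) = \<delta> z x * \<delta> z (x - (X $ j - X $ i))" for x
          using \<delta>_add_period[of z x] \<delta>_add_period[of z "x - (X $ j - X $ i)"] by (simp add: algebra_simps)
        show "\<bar>\<delta> z x * \<delta> z (x - (X $ j - X $ i))\<bar> \<le> 1" for x
          using mult_mono[OF \<delta>_abs_le \<delta>_abs_le] by (simp add: abs_mult)
      qed measurable
      then show "(LINT x|lborel. f i j x z) = cross_correlation z (X $ j - X $ i) * kernel s z"
        by (simp add: f_def)
    qed
    finally show "(LINT x|lborel. LINT z|lborel. f i j x z) = mutual_energy (X $ j - X $ i)" .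
  qed
  finally show ?thesis .
qed

text \<open>Each pair occurs twice in the double sum, which cancels the factor 1 / 2 of the energy.
  Negative distances are reduced to positive ones by evenness of the mutual energy and oddness of
  its derivative.\<close>

lemma gradient_mollified_energy:
  fixes X :: "real ^ 'n::finite"
  assumes "mollification \<rho> \<epsilon> (real CARD('n)) s"
    and sep: "\<And>i j. j \<noteq> i \<Longrightarrow> 2 * \<epsilon> < \<bar>X $ i - X $ j\<bar> \<and> \<bar>X $ i - X $ j\<bar> < real CARD('n) - 2 * \<epsilon>"
  shows "gradient (mollified_energy \<rho> s \<epsilon>) X =
    (\<chi> i. \<Sum>j\<in>UNIV. mollified_interaction \<rho> \<epsilon> (real CARD('n)) s (X $ i - X $ j))"
proof -
  interpret mollification \<rho> \<epsilon> "real CARD('n)" s by (rule assms(1))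
  let ?L = "real CARD('n)"
  let ?k = "mollified_interaction \<rho> \<epsilon> ?L s"
  define G where "G = (\<chi> i. \<Sum>j\<in>UNIV. ?k (X $ i - X $ j))"
  have k0: "?k 0 = 0" using mollified_interaction_minus[of 0] by simp
  have dpos: "(mutual_energy has_real_derivative ?k t) (at t)" if "2 * \<epsilon> < \<bar>t\<bar>" "\<bar>t\<bar> < ?L - 2 * \<epsilon>" for t
  proof (cases "0 \<le> t")
    case False
    then have "(mutual_energy has_real_derivative ?k (- t)) (at (- t))" using that by (intro DERIV_mutual_energy) auto
    from DERIV_chain'[OF DERIV_minus[OF DERIV_ident] this]
    show ?thesis by (simp add: mutual_energy_minus mollified_interaction_minus)
  qed (use that in \<open>auto intro: DERIV_mutual_energy\<close>)
  have dterm: "((\<lambda>Y. mutual_energy (Y $ j - Y $ i)) has_derivative (\<lambda>H. (H $ j - H $ i) * ?k (X $ j - X $ i))) (at X)" for i j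
  \<comment> \<open>On the diagonal the term is the constant \<open>mutual_energy 0\<close>, so no
    derivative of the mutual energy at 0 is taken.\<close>
  proof (cases "i = j")
    case False
    have "(mutual_energy has_derivative (\<lambda>h. ?k (X $ j - X $ i) * h)) (at (X $ j - X $ i))"
      using dpos[of "X $ j - X $ i"] sep[OF False] by (simp add: has_field_derivative_def)
    moreover have "((\<lambda>Y :: (real, 'n) vec. Y $ j - Y $ i) has_derivative (\<lambda>H. H $ j - H $ i)) (at X)"
      by (intro derivative_intros bounded_linear_imp_has_derivative bounded_linear_vec_nth)
    ultimately show ?thesis
      using has_derivative_compose[of "\<lambda>Y. Y $ j - Y $ i" "\<lambda>H. H $ j - H $ i" X UNIV mutual_energy] by (simp add: mult.commute)
  qed (simp add: has_derivative_const)
  have "(mollified_energy \<rho> s \<epsilon> has_derivative (\<lambda>H. 1 / 2 * (\<Sum>i\<in>UNIV. \<Sum>j\<in>UNIV. (H $ j - H $ i) * ?k (X $ j - X $ i)))) (at X)"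
    unfolding mollified_energy_eq[OF assms(1), abs_def]
    by (intro has_derivative_mult_right has_derivative_sum dterm)
  also have "(\<lambda>H. 1 / 2 * (\<Sum>i\<in>UNIV. \<Sum>j\<in>UNIV. (H $ j - H $ i) * ?k (X $ j - X $ i))) = (\<lambda>H. G \<bullet> H)"
  proof
    fix H :: "real ^ 'n"
    have odd: "?k (X $ i - X $ j) = - ?k (X $ j - X $ i)" for i j
      using mollified_interaction_minus[of "X $ j - X $ i"] by simp
    have "(\<Sum>i\<in>UNIV. \<Sum>j\<in>UNIV. (H $ j - H $ i) * ?k (X $ j - X $ i)) =
        (\<Sum>i\<in>UNIV. \<Sum>j\<in>UNIV. (H $ i - H $ j) * ?k (X $ i - X $ j))"
      by (rule sum.swap)
    also have "\<dots> = 2 * (\<Sum>i\<in>UNIV. H $ i * (\<Sum>j\<in>UNIV. ?k (X $ i - X $ j)))"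
      by (rule sum_odd_symmetrize[OF odd, symmetric])
    finally show "1 / 2 * (\<Sum>i\<in>UNIV. \<Sum>j\<in>UNIV. (H $ j - H $ i) * ?k (X $ j - X $ i)) = G \<bullet> H"
      by (simp add: G_def inner_vec_def mult.commute)
  qed
  finally have "GDERIV (mollified_energy \<rho> s \<epsilon>) X :> G" by (simp add: gderiv_def inner_commute)
  then have "gradient (mollified_energy \<rho> s \<epsilon>) X = G"
    unfolding gradient_def
  proof (rule the_equality)
    fix g assume "GDERIV (mollified_energy \<rho> s \<epsilon>) X :> g"
    then have "(\<lambda>h. h \<bullet> g) = (\<lambda>h. h \<bullet> G)"
      using \<open>GDERIV (mollified_energy \<rho> s \<epsilon>) X :> G\<close> unfolding gderiv_def by (rule has_derivative_unique)
    from fun_cong[OF this, of "g - G"] have "(g - G) \<bullet> (g - G) = 0" by (simp add: inner_diff_right)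
    then show "g = G" by simp
  qed
  then show ?thesis by (simp add: G_def)
qed

section \<open>Convergence\<close>

lemma abs_per_le:
  "0 \<le> abs_per L t" "abs_per L t \<le> \<bar>t\<bar>"
proof -
  have bdd: "bdd_below (range (\<lambda>z::int. \<bar>t + L * of_int z\<bar>))" by (rule bdd_belowI[of _ 0]) auto
  show "0 \<le> abs_per L t" unfolding abs_per_def by (rule cINF_greatest) auto
  show "abs_per L t \<le> \<bar>t\<bar>" unfolding abs_per_def using cINF_lower[OF bdd, of 0] by simp
qed

section \<open>Sorting and separation of configurations\<close>

lemma sorted_list_of_config:
  fixes X :: "real ^ 'n::{finite,linorder}"
  shows "length (sorted_list_of_multiset (image_mset (\<lambda>j. X $ j) (mset_set UNIV))) = CARD('n)"
  by (metis mset_sorted_list_of_multiset size_image_mset size_mset size_mset_set)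

lemma card_lessThan_label:
  assumes "k < CARD('n::{finite,linorder})"
  shows "card {..<label k :: 'n} = k"
proof -
  have "{..<label k :: 'n} = label ` {..<k}"
  proof (intro equalityI subsetI)
    fix j :: 'n assume "j \<in> {..<label k}"
    obtain l where l: "l < CARD('n)" "label l = j" using label_surj by blast
    have "l < k"
    proof (rule ccontr)
      assume "\<not> l < k"
      then have "l = k \<or> label k < (label l :: 'n)" using label_strict_mono[of k l] l by force
      then show False using \<open>j \<in> {..<label k}\<close> l by auto
    qed
    then show "j \<in> label ` {..<k}" using l by auto
  qed (use label_strict_mono assms in auto)
  moreover have "inj_on (label :: nat \<Rightarrow> 'n) {..<k}"
    using bij_betw_label[where 'n='n] assms by (auto simp: bij_betw_def intro: inj_on_subset)
  ultimately show ?thesis by (simp add: card_image)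
qed

lemma ord_config_eq:
  fixes X :: "real ^ 'n::{finite,linorder}"
  assumes "\<And>i j. i < j \<Longrightarrow> X $ i \<le> X $ j"
  shows "ord_config X = X"
proof -
  let ?xs = "map (\<lambda>j. X $ j) (sorted_list_of_set UNIV)"
  have "sorted ?xs"
    unfolding sorted_map
    by (rule sorted_wrt_mono_rel[OF _ strict_sorted_list_of_set]) (use assms in auto)
  moreover have "mset ?xs = image_mset (\<lambda>j. X $ j) (mset_set UNIV)"
    using mset_set_set[OF distinct_sorted_list_of_set[of "UNIV :: 'n set"]] by simp
  ultimately have xs: "sorted_list_of_multiset (image_mset (\<lambda>j. X $ j) (mset_set UNIV)) = ?xs"
    by (metis sorted_list_of_multiset_mset sorted_sort_id)
  have "ord_config X $ i = X $ i" for i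
  proof -
    obtain k where k: "k < CARD('n)" "label k = i" using label_surj by blast
    have "card {..<i} = k" using card_lessThan_label[OF k(1)] k(2) by simp
    then show ?thesis using k by (simp add: ord_config_def xs label_def)
  qed
  then show ?thesis by (simp add: vec_eq_iff)
qed

lemma ord_config_mono:
  fixes X :: "real ^ 'n::{finite,linorder}"
  assumes "i < j"
  shows "ord_config X $ i \<le> ord_config X $ j"
proof -
  have "card {..<i} \<le> card {..<j}" by (rule card_mono) (use assms in auto)
  moreover have "card {..<j} < CARD('n)" by (rule psubset_card_mono) auto
  ultimately show ?thesis
    unfolding ord_config_def
    by (simp add: sorted_nth_mono[OF sorted_sorted_list_of_multiset] sorted_list_of_config)
qed

lemma config_dist_le:
  fixes X Y :: "real ^ 'n::{finite,linorder}"
  assumes "ord_config X = X" "ord_config Y = Y"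
  shows "config_dist X Y \<le> norm (X - Y)"
proof -
  have "(abs_per (real CARD('n)) (X $ i - Y $ i))\<^sup>2 \<le> (norm ((X - Y) $ i))\<^sup>2" for i
    using abs_per_le[of "real CARD('n)" "X $ i - Y $ i"] by (intro power_mono) auto
  then show ?thesis
    unfolding config_dist_def assms norm_vec_def L2_set_def by (intro real_sqrt_le_mono sum_mono) auto
qed

text \<open>Along the flows particles keep their order, so the sorting inside
  \<open>config_dist\<close> does nothing and the distance is controlled by the Euclidean
  norm.\<close>

lemma separated_imp_sorted:
  fixes X :: "real ^ 'n::{finite,linorder}"
  assumes "separated d X" "0 \<le> d"
  shows "ord_config X = X"
  using separated_pair[OF assms] assms(2) by (intro ord_config_eq) force

lemma separated_abs:
  fixes X :: "real ^ 'n::{finite,linorder}"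
  assumes "separated d X" "0 \<le> d" "j \<noteq> i"
  shows "d \<le> \<bar>X $ i - X $ j\<bar> \<and> \<bar>X $ i - X $ j\<bar> \<le> real CARD('n) - d"
proof -
  from assms(3) consider "i < j" | "j < i" by fastforce
  then show ?thesis
    using separated_pair[OF assms(1,2), of i j] separated_pair[OF assms(1,2), of j i] assms(2)
    by cases auto
qed

lemma regular_config_separated:
  fixes X :: "real ^ 'n::{finite,linorder}"
  assumes "X \<in> regular_configs" "X = ord_config X"
  shows "\<exists>d>0. separated d X"
proof -
  have range: "0 \<le> X $ i" "X $ i < real CARD('n)" for i
    using assms(1) by (auto simp: regular_configs_def config_space_def)
  have inj: "inj (\<lambda>i. X $ i)" using assms(1) by (simp add: regular_configs_def)
  have strict: "X $ i < X $ j" if "i < j" for i j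
  proof -
    have "X $ i \<le> X $ j" using ord_config_mono[OF that, of X] assms(2) by simp
    moreover have "X $ i \<noteq> X $ j" using inj that by (auto dest: injD)
    ultimately show ?thesis by simp
  qed
  define gap where "gap k = lift_config X (int k + 1) - lift_config X (int k)" for k :: nat
  have pos: "0 < gap k" if "k < CARD('n)" for k
  proof (cases "Suc k < CARD('n)")
    case True
    have "lift_config X (int k + 1) = X $ label (Suc k)"
      using lift_config_of_nat[OF True, of X] by (simp add: add.commute)
    then show ?thesis
      using strict[OF label_strict_mono[of k "Suc k"]] True lift_config_of_nat[OF that, of X] by (simp add: gap_def)
  next
    case False
    \<comment> \<open>The last gap wraps around to the first particle of the next period; it is
      positive because all positions lie in [0, CARD('n)).\<close>
    then have "int k + 1 = 0 + int CARD('n)" using that by simp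
    then have "lift_config X (int k + 1) = lift_config X (int 0) + real CARD('n)"
      using lift_config_add_card[of X 0] by simp
    then have "lift_config X (int k + 1) = X $ label 0 + real CARD('n)"
      using lift_config_of_nat[of 0 X] by simp
    then show ?thesis
      using range(1)[of "label 0"] range(2)[of "label k"] lift_config_of_nat[OF that, of X] by (simp add: gap_def)
  qed
  define d where "d = Min (gap ` {..<CARD('n)})"
  have ne: "gap ` {..<CARD('n)} \<noteq> {}" by (simp add: lessThan_empty_iff)
  have "0 < d" unfolding d_def using pos ne by (subst Min_gr_iff) auto
  moreover have "separated d X"
    unfolding separated_iff_finite d_def gap_def[symmetric] by auto
  ultimately show ?thesis by blast
qed

theorem proposition4p5:
  fixes s :: real
    and \<rho> :: "real \<Rightarrow> real"
    and X_init :: "real ^ ('n::{finite,linorder})"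
    and X_eps :: "real \<Rightarrow> real \<Rightarrow> real ^ ('n::{finite,linorder})"
  assumes "1 / 2 \<le> s" and "s < 1"
    and "standard_mollifier \<rho>"
    and "X_init \<in> regular_configs" and "X_init = ord_config X_init"
    and "\<And>\<epsilon>. \<epsilon> > 0 \<Longrightarrow>
           solves_cauchy (\<lambda>X. - gradient (mollified_energy \<rho> s \<epsilon>) X) X_init (X_eps \<epsilon>)"
  shows "\<exists>X_lim :: real \<Rightarrow> real ^ ('n::{finite,linorder}).
           solves_cauchy (\<lambda>X. - force s X) X_init X_lim \<and>
           (\<forall>Y. solves_cauchy (\<lambda>X. - force s X) X_init Y \<longrightarrow> (\<forall>t\<ge>0. Y t = X_lim t)) \<and>
           uniform_limit {0..} (\<lambda>\<epsilon> t. config_dist (X_eps \<epsilon> t) (X_lim t)) (\<lambda>t. 0) (at_right 0)"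
proof -
  let ?L = "real CARD('n)"
  define h where "h = interaction ?L s"
  define k where "k \<epsilon> = mollified_interaction \<rho> \<epsilon> ?L s" for \<epsilon>
  define c where "c = ?L powr (- 1 - 2 * s)"
  have s: "0 < s" "s < 1" using assms(1,2) by auto
  have L: "0 < ?L" by simp
  have moll: "mollification \<rho> \<epsilon> ?L s" if "0 < \<epsilon>" for \<epsilon>
    using that assms(3) s by unfold_locales auto
  obtain \<delta> where \<delta>: "0 < \<delta>" "separated \<delta> X_init"
    using regular_config_separated[OF assms(4,5)] by blast
  have hcont: "continuous_on {0<..<?L} h" unfolding h_def by (rule continuous_on_interaction[OF s])
  have W: "- force s Z = drift h Z" if "0 < d" "separated d Z" for Z :: "real ^ 'n::{finite,linorder}" and d
  proof -
    have "force s Z $ i = (\<Sum>j\<in>UNIV. h (Z $ i - Z $ j))" for i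
      unfolding h_def
    \<comment> \<open>Taking the minimum makes the requirement \<theta> \<le> CARD('n) of
      \<open>force_eq\<close> true by construction.\<close>
    proof (rule force_eq[OF s assms(3), of i "min d ?L"])
      show "min d ?L \<le> \<bar>Z $ i - Z $ j\<bar> \<and> \<bar>Z $ i - Z $ j\<bar> \<le> ?L - min d ?L" if "j \<noteq> i" for j
        using separated_abs[OF \<open>separated d Z\<close> _ that] \<open>0 < d\<close> by auto
    qed (use that in auto)
    then show ?thesis by (simp add: vec_eq_iff drift_def)
  qed
  have V: "- gradient (mollified_energy \<rho> s \<epsilon>) Z = drift (k \<epsilon>) Z"
    if "0 < \<epsilon>" "2 * \<epsilon> < d" "separated d Z" for \<epsilon> d and Z :: "real ^ 'n::{finite,linorder}"
  proof -
    have "gradient (mollified_energy \<rho> s \<epsilon>) Z = (\<chi> i. \<Sum>j\<in>UNIV. mollified_interaction \<rho> \<epsilon> ?L s (Z $ i - Z $ j))"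
    proof (rule gradient_mollified_energy[OF moll[OF that(1)]])
      show "2 * \<epsilon> < \<bar>Z $ i - Z $ j\<bar> \<and> \<bar>Z $ i - Z $ j\<bar> < ?L - 2 * \<epsilon>" if "j \<noteq> i" for i j
        using separated_abs[OF \<open>separated d Z\<close> _ that] \<open>0 < \<epsilon>\<close> \<open>2 * \<epsilon> < d\<close> by auto
    qed
    then show ?thesis by (simp add: vec_eq_iff drift_def k_def)
  qed
  have close: "\<exists>\<epsilon>\<^sub>0>0. \<forall>\<epsilon> b. 0 < \<epsilon> \<longrightarrow> \<epsilon> < \<epsilon>\<^sub>0 \<longrightarrow> \<delta> \<le> b \<longrightarrow> b \<le> ?L - \<delta> \<longrightarrow> \<bar>k \<epsilon> b - h b\<bar> \<le> \<eta>"
    if "0 < \<eta>" for \<eta>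
  proof -
    \<comment> \<open>The halved margin leaves room for displacements b + \<tau> with |\<tau>| \<le>
      2 * \<epsilon> < \<delta> / 2.\<close>
    have "uniformly_continuous_on {\<delta> / 2..?L - \<delta> / 2} h"
      by (rule compact_uniformly_continuous[OF continuous_on_subset[OF hcont]]) (use \<delta> in auto)
    then obtain e where e: "e > 0" "\<And>x y. x \<in> {\<delta> / 2..?L - \<delta> / 2} \<Longrightarrow> y \<in> {\<delta> / 2..?L - \<delta> / 2} \<Longrightarrow> \<bar>y - x\<bar> < e \<Longrightarrow> \<bar>h y - h x\<bar> < \<eta>"
      using \<open>0 < \<eta>\<close> unfolding uniformly_continuous_on_def dist_real_def by meson
    define \<epsilon>\<^sub>0 where "\<epsilon>\<^sub>0 = min (e / 2) (\<delta> / 4)"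
    show ?thesis
    proof (intro exI[of _ \<epsilon>\<^sub>0] conjI allI impI)
      show "0 < \<epsilon>\<^sub>0" using e \<delta> by (simp add: \<epsilon>\<^sub>0_def)
      fix \<epsilon> b assume \<epsilon>: "0 < \<epsilon>" "\<epsilon> < \<epsilon>\<^sub>0" and b: "\<delta> \<le> b" "b \<le> ?L - \<delta>"
      have \<epsilon>2: "2 * \<epsilon> < e" "2 * \<epsilon> < \<delta> / 2" using \<epsilon> by (auto simp: \<epsilon>\<^sub>0_def)
      show "\<bar>k \<epsilon> b - h b\<bar> \<le> \<eta>"
        unfolding k_def h_def
      proof (rule mollification.mollified_interaction_close[OF moll[OF \<epsilon>(1)]])
        show "\<bar>interaction ?L s (b + \<tau>) - interaction ?L s b\<bar> \<le> \<eta>" if "\<bar>\<tau>\<bar> \<le> 2 * \<epsilon>" for \<tau>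
        proof -
          have "\<bar>h (b + \<tau>) - h b\<bar> < \<eta>"
            using that \<epsilon>2 b by (intro e(2)) (auto simp: abs_le_iff)
          then show ?thesis by (simp add: h_def)
        qed
      qed (use \<epsilon>2 b \<delta> in auto)
    qed
  qed
  have "\<exists>Z. solves_cauchy (\<lambda>X. - force s X) X_init Z \<and>
    (\<forall>Y. solves_cauchy (\<lambda>X. - force s X) X_init Y \<longrightarrow> (\<forall>t\<ge>0. Y t = Z t)) \<and>
    (\<forall>t\<ge>0. separated \<delta> (Z t)) \<and> (\<forall>\<epsilon> t. 0 < \<epsilon> \<longrightarrow> 2 * \<epsilon> < \<delta> \<longrightarrow> 0 \<le> t \<longrightarrow> separated \<delta> (X_eps \<epsilon> t)) \<and>
    uniform_limit {0..} X_eps Z (at_right 0)"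
  proof (rule perturbed_drift_flows_converge[where V="\<lambda>\<epsilon> X. - gradient (mollified_energy \<rho> s \<epsilon>) X" and h=h and k=k and c=c, OF \<delta> _ W V _ _ hcont _ _ _ _ close assms(6)])
    show "0 < c" by (simp add: c_def)
    show "h (- t) = - h t" for t unfolding h_def by (rule interaction_minus)
    show "h (t + ?L) = h t" for t unfolding h_def by (rule interaction_add_period[OF L])
    show "c * (a - b) \<le> h a - h b" if "0 < b" "b \<le> a" "a < ?L" for a b
      unfolding h_def c_def by (rule interaction_strongly_mono[OF s that])
    show "k \<epsilon> (- t) = - k \<epsilon> t" if "0 < \<epsilon>" for \<epsilon> t
      unfolding k_def by (rule mollification.mollified_interaction_minus[OF moll[OF that]])
    show "k \<epsilon> (t + ?L) = k \<epsilon> t" if "0 < \<epsilon>" for \<epsilon> t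
      unfolding k_def by (rule mollification.mollified_interaction_add_period[OF moll[OF that]])
    show "c * (a - b) \<le> k \<epsilon> a - k \<epsilon> b" if "0 < \<epsilon>" "2 * \<epsilon> < b" "b \<le> a" "a < ?L - 2 * \<epsilon>" for \<epsilon> a b
      unfolding k_def c_def by (rule mollification.mollified_interaction_strongly_mono[OF moll[OF that(1)] that(2-)])
  qed
  then obtain Z where Z: "solves_cauchy (\<lambda>X. - force s X) X_init Z"
      "\<forall>Y. solves_cauchy (\<lambda>X. - force s X) X_init Y \<longrightarrow> (\<forall>t\<ge>0. Y t = Z t)"
    and sepZ: "\<And>t. t \<ge> 0 \<Longrightarrow> separated \<delta> (Z t)"
    and sepX: "\<And>\<epsilon> t. 0 < \<epsilon> \<Longrightarrow> 2 * \<epsilon> < \<delta> \<Longrightarrow> 0 \<le> t \<Longrightarrow> separated \<delta> (X_eps \<epsilon> t)"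
    and lim: "uniform_limit {0..} X_eps Z (at_right 0)"
    by blast
  have "uniform_limit {0..} (\<lambda>\<epsilon> t. config_dist (X_eps \<epsilon> t) (Z t)) (\<lambda>t. 0) (at_right 0)"
    unfolding uniform_limit_iff
  proof (intro allI impI)
    fix r :: real assume "r > 0"
    \<comment> \<open>For such \<epsilon> the mollified flow is separated, hence sorted, at all
      times, as \<open>config_dist_le\<close> requires.\<close>
    have "\<forall>\<^sub>F \<epsilon> in at_right 0. 0 < \<epsilon> \<and> 2 * \<epsilon> < \<delta>"
      using \<delta>(1) by (auto simp: eventually_at_right_field intro!: exI[of _ "\<delta> / 2"])
    with uniform_limitD[OF lim \<open>r > 0\<close>]
    show "\<forall>\<^sub>F \<epsilon> in at_right 0. \<forall>t\<in>{0..}. dist (config_dist (X_eps \<epsilon> t) (Z t)) 0 < r"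
    proof eventually_elim
      case (elim \<epsilon>)
      show ?case
      proof
        fix t :: real assume t: "t \<in> {0..}"
        have "config_dist (X_eps \<epsilon> t) (Z t) \<le> norm (X_eps \<epsilon> t - Z t)"
          using elim(2) t \<delta>(1) by (intro config_dist_le separated_imp_sorted[of \<delta>] sepX sepZ) auto
        moreover have "norm (X_eps \<epsilon> t - Z t) < r" using elim(1) t by (simp add: dist_norm)
        moreover have "0 \<le> config_dist (X_eps \<epsilon> t) (Z t)"
          unfolding config_dist_def by (intro real_sqrt_ge_zero sum_nonneg) auto
        ultimately show "dist (config_dist (X_eps \<epsilon> t) (Z t)) 0 < r" by simp
      qed
    qed
  qed
  then show ?thesis using Z by blast
qed

end
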